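(* Let $\mathfrak g$ be the Lie algebra of a Lie group $G$, and $\mathcal X\subset\mathfrak g^*$ a coadjoint orbit of maximal dimension with a $G$-invariant complex structure for which the standard symplectic form $\omega_0$ is Kähler, and let $\frac1{2\pi\hbar}[\omega_0]\in H^2(\mathcal X,\mathbb Z)$. Then the character of the irreducible representation $\pi_{\mathcal X}$ of the group $G$ in $\mathcal L(\mathcal X)$ is $$\operatorname{tr}\pi_{\mathcal X}(\exp(\eta))=\frac1{(2\pi\hbar)^{\dim\mathcal X/2}}\int_{\mathcal X}e_*^{i\eta/\hbar}\,dm=\frac1{(2\pi\hbar)^{\dim\mathcal X/2}}\,E_{\mathcal X}\big(-i\hbar\stackrel1{\partial/\partial\eta},\stackrel2\eta\big)\int_{\mathcal X}e^{i\eta/\hbar}\,dm,\qquad\eta\in\mathfrak g,$$ for those $\eta$ for which the trace is defined.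
   Context: Let $\hbar>0$. $\omega_0$ is the symplectic form on $\mathcal X$ generated by the linear Lie–Poisson bracket on $\mathfrak g^*$. With $2n=\dim\mathcal X$, let $F_0$ be local Kähler potentials, $\omega_0=i\bar\partial\partial F_0$. $\mathcal L(\mathcal X)$ is the Hilbert space of antiholomorphic sections of the Hermitian line bundle with fiber form $(u,v)_\hbar=u\bar v\,e^{-F_0/\hbar}$, with $\|u\|^2=\frac1{(2\pi\hbar)^n}\int_{\mathcal X}(u,u)_\hbar\,dm$, where $dm=\mathrm{const}\cdot\frac1{n!}|\omega_0\wedge\dots\wedge\omega_0|$ and the constant is such that the reproducing kernel $\mathcal K=\sum_j|u_j|^2$ ($\{u_j\}$ an orthonormal basis) equals $e^{F_0/\hbar}$. The Wick symbol of an operator $T$ in $\mathcal L(\mathcal X)$ is $\psi=\frac1{\mathcal K}T\mathcal K$ (i.e. $T\mathcal K^{\#}=\psi^{\#}\mathcal K^{\#}$, where $\mathcal K^{\#}(x|y)=\sum_ju_j(x)\overline{u_j(y)}$, $T$ acts on the first argument, $\psi(x)=\psi^{\#}(x|x)$). In local complex coordinates $\omega_0=i\omega_{0\,\nu\mu}d\bar z^\nu\wedge dz^\mu$, and $\mathrm{ad}_-(\psi)=i\omega_0^{-1\mu\nu}\partial_\mu\psi\,\bar\partial_\nu$. Fix a basis $\eta^1,\dots,\eta^m$ of $\mathfrak g$, regarded as linear functions on $\mathfrak g^*$; put $x^j=\eta^j|_{\mathcal X}$ and $\widehat x^{\,j}=x^j+i\,\mathrm{ad}_-(x^j)(F_0)-i\hbar\,\mathrm{ad}_-(x^j)$,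 operators in $\mathcal L(\mathcal X)$. For $\eta=\sum_j\eta_j\eta^j\in\mathfrak g$ let $\pi_{\mathcal X}(\exp(\eta))=\exp\{\frac i\hbar\sum_j\eta_j\widehat x^{\,j}\}$, and let $e_*^{i\eta/\hbar}=e^{i\eta/\hbar}|_{\widehat{\mathcal X}}$ be the Wick symbol of this operator. In $\int_{\mathcal X}e^{i\eta/\hbar}dm$, $\eta$ is the linear function $\xi\mapsto\langle\eta,\xi\rangle$ restricted to $\mathcal X$. The symbol of quantum restriction is $E_{\mathcal X}(\xi,\eta)=e^{-i\langle\eta,\xi\rangle/\hbar}\,e_*^{i\eta/\hbar}(\xi)$, $\xi\in\mathcal X$. The operator $E_{\mathcal X}(-i\hbar\stackrel1{\partial/\partial\eta},\stackrel2\eta)$ has the derivatives in $\eta$ acting first and multiplication by functions of $\eta$ second, so that it sends $e^{i\langle\eta,\xi\rangle/\hbar}$ (as a function of $\eta$, $\xi\in\mathcal X$ fixed) to $E_{\mathcal X}(\xi,\eta)e^{i\langle\eta,\xi\rangle/\hbar}$, extended linearly to superpositions of such exponentials over $\xi\in\mathcal X$. *)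

theory Defs
  imports "HOL-Analysis.Analysis" "HOL-Algebra.Group" "HOL-Combinatorics.Permutations"
begin

section \<open>Smooth maps and Lie groups\<close>

text \<open>
  For maps on an open subset of a finite-dimensional space, \<open>Ck_on k\<close> is \<open>C^k\<close>: the map is
  differentiable and all its directional derivatives are \<open>C^(k-1)\<close>.
\<close>

primrec Ck_on :: "nat \<Rightarrow> 'a::real_normed_vector set \<Rightarrow> ('a \<Rightarrow> 'b::real_normed_vector) \<Rightarrow> bool" where
  "Ck_on 0 S f \<longleftrightarrow> continuous_on S f"
| "Ck_on (Suc k) S f \<longleftrightarrow> continuous_on S f \<and> (\<forall>x\<in>S. f differentiable (at x)) \<and>
     (\<forall>v. Ck_on k S (\<lambda>x. frechet_derivative f (at x) v))"

definition smooth_on :: "'a::real_normed_vector set \<Rightarrow> ('a \<Rightarrow> 'b::real_normed_vector) \<Rightarrow> bool" where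
  "smooth_on S f \<longleftrightarrow> (\<forall>k. Ck_on k S f)"

text \<open>
  The group carries an atlas of pairs (chart domain, chart map).  The model space \<open>'e\<close> is a
  finite-dimensional normed space rather than a Euclidean space, so that dimension 0 is included.
\<close>

record ('g, 'e) lie_data = "'g monoid" +
  atlas :: "('g set \<times> ('g \<Rightarrow> 'e)) set"

definition lie_group ::
    "('g::{t2_space,second_countable_topology}, 'e::real_normed_vector) lie_data \<Rightarrow> bool" where
  "lie_group G \<longleftrightarrow>
     group G \<and> carrier G = UNIV \<and>
     (\<exists>B::'e set. finite B \<and> span B = UNIV) \<and>
     (\<Union>(U, \<phi>)\<in>atlas G. U) = UNIV \<and>
     (\<forall>(U, \<phi>)\<in>atlas G. open U \<and> open (\<phi> ` U) \<and> homeomorphism U (\<phi> ` U) \<phi> (inv_into U \<phi>)) \<and>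
     (\<forall>(U, \<phi>)\<in>atlas G. \<forall>(V, \<psi>)\<in>atlas G.
        smooth_on (\<phi> ` (U \<inter> V)) (\<psi> \<circ> inv_into U \<phi>)) \<and>
     continuous_on UNIV (\<lambda>(x, y). x \<otimes>\<^bsub>G\<^esub> y) \<and>
     (\<forall>(U, \<phi>)\<in>atlas G. \<forall>(V, \<psi>)\<in>atlas G. \<forall>(W, \<rho>)\<in>atlas G.
        smooth_on {(\<phi> x, \<psi> y) | x y. x \<in> U \<and> y \<in> V \<and> x \<otimes>\<^bsub>G\<^esub> y \<in> W}
          (\<lambda>(a, b). \<rho> (inv_into U \<phi> a \<otimes>\<^bsub>G\<^esub> inv_into V \<psi> b))) \<and>
     continuous_on UNIV (\<lambda>x. inv\<^bsub>G\<^esub> x) \<and>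
     (\<forall>(U, \<phi>)\<in>atlas G. \<forall>(V, \<psi>)\<in>atlas G.
        smooth_on (\<phi> ` {x\<in>U. inv\<^bsub>G\<^esub> x \<in> V}) (\<lambda>a. \<psi> (inv\<^bsub>G\<^esub> (inv_into U \<phi> a))))"

definition smooth_on_group ::
    "('g::topological_space, 'e::real_normed_vector) lie_data \<Rightarrow> 'g set \<Rightarrow>
     ('g \<Rightarrow> 'b::real_normed_vector) \<Rightarrow> bool" where
  "smooth_on_group G W f \<longleftrightarrow> (\<forall>(U, \<phi>)\<in>atlas G. smooth_on (\<phi> ` (U \<inter> W)) (f \<circ> inv_into U \<phi>))"

text \<open>
  The Lie algebra is the tangent space at the identity, identified with \<open>'e\<close> by the differential of
  a fixed chart around the identity.
\<close>

definition one_chart :: "('g, 'e) lie_data \<Rightarrow> 'g set \<times> ('g \<Rightarrow> 'e)" where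
  "one_chart G = (SOME c. c \<in> atlas G \<and> \<one>\<^bsub>G\<^esub> \<in> fst c)"

definition one_param_subgroup ::
    "('g, 'e::real_normed_vector) lie_data \<Rightarrow> (real \<Rightarrow> 'g) \<Rightarrow> bool" where
  "one_param_subgroup G \<gamma> \<longleftrightarrow>
     (\<forall>s t. \<gamma> (s + t) = \<gamma> s \<otimes>\<^bsub>G\<^esub> \<gamma> t) \<and>
     (\<forall>(U, \<phi>)\<in>atlas G. open (\<gamma> -` U) \<and> smooth_on (\<gamma> -` U) (\<phi> \<circ> \<gamma>))"

definition lie_exp :: "('g, 'e::real_normed_vector) lie_data \<Rightarrow> 'e \<Rightarrow> 'g" where
  "lie_exp G \<eta> = (THE g. \<exists>\<gamma>. one_param_subgroup G \<gamma> \<and>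
     ((snd (one_chart G) \<circ> \<gamma>) has_vector_derivative \<eta>) (at 0) \<and> g = \<gamma> 1)"

definition Ad :: "('g, 'e::real_normed_vector) lie_data \<Rightarrow> 'g \<Rightarrow> 'e \<Rightarrow> 'e" where
  "Ad G g = (case one_chart G of (U, \<phi>) \<Rightarrow>
     frechet_derivative (\<lambda>a. \<phi> (g \<otimes>\<^bsub>G\<^esub> inv_into U \<phi> a \<otimes>\<^bsub>G\<^esub> inv\<^bsub>G\<^esub> g)) (at (\<phi> \<one>\<^bsub>G\<^esub>)))"

definition bracket :: "('g, 'e::real_normed_vector) lie_data \<Rightarrow> 'e \<Rightarrow> 'e \<Rightarrow> 'e" where
  "bracket G \<eta> \<zeta> = vector_derivative (\<lambda>t. Ad G (lie_exp G (t *\<^sub>R \<eta>)) \<zeta>) (at 0)"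


section \<open>Coadjoint orbits\<close>

type_synonym 'e dual = "'e \<Rightarrow>\<^sub>L real"

definition coAd :: "('g, 'e::real_normed_vector) lie_data \<Rightarrow> 'g \<Rightarrow> 'e dual \<Rightarrow> 'e dual" where
  "coAd G g \<xi> = Blinfun (\<lambda>\<zeta>. blinfun_apply \<xi> (Ad G (inv\<^bsub>G\<^esub> g) \<zeta>))"

definition coadjoint_orbit :: "('g, 'e::real_normed_vector) lie_data \<Rightarrow> 'e dual \<Rightarrow> 'e dual set" where
  "coadjoint_orbit G \<xi>\<^sub>0 = range (\<lambda>g. coAd G g \<xi>\<^sub>0)"

text \<open>The velocity at \<open>\<xi>\<close> of the curve \<open>t \<mapsto> Ad*(exp (t \<eta>)) \<xi>\<close>.\<close>

definition fund :: "('g, 'e::real_normed_vector) lie_data \<Rightarrow> 'e \<Rightarrow> 'e dual \<Rightarrow> 'e dual" where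
  "fund G \<eta> \<xi> = Blinfun (\<lambda>\<zeta>. - blinfun_apply \<xi> (bracket G \<eta> \<zeta>))"

definition tangent :: "('g, 'e::real_normed_vector) lie_data \<Rightarrow> 'e dual \<Rightarrow> 'e dual set" where
  "tangent G \<xi> = range (\<lambda>\<eta>. fund G \<eta> \<xi>)"

definition maximal_orbit :: "('g, 'e::real_normed_vector) lie_data \<Rightarrow> 'e dual \<Rightarrow> bool" where
  "maximal_orbit G \<xi>\<^sub>0 \<longleftrightarrow> (\<forall>\<xi>. dim (tangent G \<xi>) \<le> dim (tangent G \<xi>\<^sub>0))"

text \<open>
  An orbit is an immersed, in general not embedded, submanifold of the dual: its topology and its
  smooth structure are those of the quotient of \<open>G\<close> by the stabilizer, not those of the subspace.
\<close>

definition orbit_open ::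
    "('g::topological_space, 'e::real_normed_vector) lie_data \<Rightarrow> 'e dual \<Rightarrow> 'e dual set \<Rightarrow> bool" where
  "orbit_open G \<xi>\<^sub>0 W \<longleftrightarrow> W \<subseteq> coadjoint_orbit G \<xi>\<^sub>0 \<and> open {g. coAd G g \<xi>\<^sub>0 \<in> W}"

definition smooth_on_orbit ::
    "('g::topological_space, 'e::real_normed_vector) lie_data \<Rightarrow> 'e dual \<Rightarrow> 'e dual set \<Rightarrow>
     ('e dual \<Rightarrow> 'b::real_normed_vector) \<Rightarrow> bool" where
  "smooth_on_orbit G \<xi>\<^sub>0 W f \<longleftrightarrow>
     smooth_on_group G {g. coAd G g \<xi>\<^sub>0 \<in> W} (\<lambda>g. f (coAd G g \<xi>\<^sub>0))"

text \<open>Derivative along the fundamental vector field of \<open>\<eta>\<close>, and the differential \<open>df\<close> of a smooth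
  function at \<open>\<xi>\<close> on tangent vectors (independent of the chosen \<open>\<eta>\<close>).\<close>

definition fund_deriv ::
    "('g, 'e::real_normed_vector) lie_data \<Rightarrow> 'e \<Rightarrow> ('e dual \<Rightarrow> 'b::real_normed_vector) \<Rightarrow> 'e dual \<Rightarrow> 'b"
    where
  "fund_deriv G \<eta> f \<xi> = vector_derivative (\<lambda>t. f (coAd G (lie_exp G (t *\<^sub>R \<eta>)) \<xi>)) (at 0)"

definition diff_at ::
    "('g, 'e::real_normed_vector) lie_data \<Rightarrow> ('e dual \<Rightarrow> 'b::real_normed_vector) \<Rightarrow> 'e dual \<Rightarrow>
     'e dual \<Rightarrow> 'b" where
  "diff_at G f \<xi> v = fund_deriv G (SOME \<eta>. fund G \<eta> \<xi> = v) f \<xi>"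

text \<open>
  The symplectic form of the Lie--Poisson bracket \<open>{\<eta>,\<zeta>}(\<xi>) = \<langle>[\<eta>,\<zeta>], \<xi>\<rangle>\<close>.  The Hamiltonian field
  \<open>{\<eta>, \<cdot>}\<close> is the negative of the fundamental field of \<open>\<eta>\<close>; the two signs cancel.
\<close>

definition omega0 ::
    "('g, 'e::real_normed_vector) lie_data \<Rightarrow> 'e dual \<Rightarrow> 'e dual \<Rightarrow> 'e dual \<Rightarrow> real" where
  "omega0 G \<xi> v w = blinfun_apply \<xi>
     (bracket G (SOME \<eta>. fund G \<eta> \<xi> = v) (SOME \<zeta>. fund G \<zeta> \<xi> = w))"


section \<open>Invariant Kaehler structures on an orbit\<close>

text \<open>
  The orbit of \<open>base_pt\<close> is covered by patches, each carrying complex coordinates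
  \<open>coord \<alpha> \<xi> 0, ..., coord \<alpha> \<xi> (cdim - 1)\<close>, a local potential \<open>F\<^sub>0\<close>, and a trivialization of the line
  bundle; \<open>trans \<alpha> \<beta>\<close> are the transition functions of the bundle and \<open>vol\<close> is the measure \<open>dm\<close>.
\<close>

record ('g, 'e, 'x, 'i) orbit_record =
  lie :: "('g, 'e) lie_data"
  base_pt :: 'x
  cdim :: nat
  patches :: "'i set"
  patch :: "'i \<Rightarrow> 'x set"
  coord :: "'i \<Rightarrow> 'x \<Rightarrow> nat \<Rightarrow> complex"
  pot :: "'i \<Rightarrow> 'x \<Rightarrow> real"
  trans :: "'i \<Rightarrow> 'i \<Rightarrow> 'x \<Rightarrow> complex"
  vol :: "'x measure"
  hbar :: real

type_synonym ('g, 'e, 'i) orbit_data = "('g, 'e, 'e dual, 'i) orbit_record"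

abbreviation orb :: "('g, 'e::real_normed_vector, 'i) orbit_data \<Rightarrow> 'e dual set" where
  "orb X \<equiv> coadjoint_orbit (lie X) (base_pt X)"

abbreviation smooth_fun ::
    "('g::topological_space, 'e::real_normed_vector, 'i) orbit_data \<Rightarrow> 'e dual set \<Rightarrow>
     ('e dual \<Rightarrow> 'b::real_normed_vector) \<Rightarrow> bool" where
  "smooth_fun X \<equiv> smooth_on_orbit (lie X) (base_pt X)"

text \<open>
  With \<open>z\<^sup>\<mu> = x\<^sup>\<mu> + i y\<^sup>\<mu>\<close>, \<open>coord_vec X \<alpha> \<mu> 1 \<xi>\<close> is the tangent vector \<open>\<partial>/\<partial>x\<^sup>\<mu>\<close> and
  \<open>coord_vec X \<alpha> \<mu> \<i> \<xi>\<close> is \<open>\<partial>/\<partial>y\<^sup>\<mu>\<close>.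
\<close>

definition coord_vec ::
    "('g, 'e::real_normed_vector, 'i) orbit_data \<Rightarrow> 'i \<Rightarrow> nat \<Rightarrow> complex \<Rightarrow> 'e dual \<Rightarrow> 'e dual" where
  "coord_vec X \<alpha> \<mu> c \<xi> = (THE v. v \<in> tangent (lie X) \<xi> \<and>
     (\<forall>\<nu><cdim X. diff_at (lie X) (\<lambda>\<xi>. coord X \<alpha> \<xi> \<nu>) \<xi> v = (if \<nu> = \<mu> then c else 0)))"

definition dz ::
    "('g, 'e::real_normed_vector, 'i) orbit_data \<Rightarrow> 'i \<Rightarrow> nat \<Rightarrow> ('e dual \<Rightarrow> complex) \<Rightarrow> 'e dual \<Rightarrow> complex"
    where
  "dz X \<alpha> \<mu> f \<xi> = (diff_at (lie X) f \<xi> (coord_vec X \<alpha> \<mu> 1 \<xi>)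
                  - \<i> * diff_at (lie X) f \<xi> (coord_vec X \<alpha> \<mu> \<i> \<xi>)) / 2"

definition dzbar ::
    "('g, 'e::real_normed_vector, 'i) orbit_data \<Rightarrow> 'i \<Rightarrow> nat \<Rightarrow> ('e dual \<Rightarrow> complex) \<Rightarrow> 'e dual \<Rightarrow> complex"
    where
  "dzbar X \<alpha> \<mu> f \<xi> = (diff_at (lie X) f \<xi> (coord_vec X \<alpha> \<mu> 1 \<xi>)
                     + \<i> * diff_at (lie X) f \<xi> (coord_vec X \<alpha> \<mu> \<i> \<xi>)) / 2"

text \<open>
  A complex structure is an atlas of complex charts.  Smooth functions that are jointly injective
  and whose differentials map each tangent space bijectively onto \<open>\<complex>\<^sup>n\<close> form a chart with
  open image, by the inverse function theorem.
\<close>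

definition complex_structure ::
    "('g::topological_space, 'e::real_normed_vector, 'i) orbit_data \<Rightarrow> bool" where
  "complex_structure X \<longleftrightarrow>
     dim (tangent (lie X) (base_pt X)) = 2 * cdim X \<and>
     (\<Union>\<alpha>\<in>patches X. patch X \<alpha>) = orb X \<and>
     (\<forall>\<alpha>\<in>patches X.
        orbit_open (lie X) (base_pt X) (patch X \<alpha>) \<and>
        coord X \<alpha> ` patch X \<alpha> \<subseteq> extensional {..<cdim X} \<and>
        inj_on (coord X \<alpha>) (patch X \<alpha>) \<and>
        (\<forall>\<mu><cdim X. smooth_fun X (patch X \<alpha>) (\<lambda>\<xi>. coord X \<alpha> \<xi> \<mu>)) \<and>
        (\<forall>\<xi>\<in>patch X \<alpha>.
           bij_betw (\<lambda>v. \<lambda>\<mu>\<in>{..<cdim X}. diff_at (lie X) (\<lambda>\<xi>. coord X \<alpha> \<xi> \<mu>) \<xi> v)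
             (tangent (lie X) \<xi>) (extensional {..<cdim X}))) \<and>
     (\<forall>\<alpha>\<in>patches X. \<forall>\<beta>\<in>patches X. \<forall>\<xi>\<in>patch X \<alpha> \<inter> patch X \<beta>. \<forall>\<mu><cdim X. \<forall>\<nu><cdim X.
        dzbar X \<alpha> \<mu> (\<lambda>\<xi>. coord X \<beta> \<xi> \<nu>) \<xi> = 0)"

definition invariant_complex_structure ::
    "('g, 'e::real_normed_vector, 'i) orbit_data \<Rightarrow> bool" where
  "invariant_complex_structure X \<longleftrightarrow>
     (\<forall>g. \<forall>\<alpha>\<in>patches X. \<forall>\<beta>\<in>patches X. \<forall>\<xi>\<in>patch X \<alpha>. coAd (lie X) g \<xi> \<in> patch X \<beta> \<longrightarrow>
        (\<forall>\<mu><cdim X. \<forall>\<nu><cdim X.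
           dzbar X \<alpha> \<mu> (\<lambda>\<xi>. coord X \<beta> (coAd (lie X) g \<xi>) \<nu>) \<xi> = 0))"

text \<open>\<open>kmat X \<alpha> \<nu> \<mu>\<close> is \<open>\<omega>\<^sub>0\<^sub>\<nu>\<^sub>\<mu> = dzbar\<^sub>\<nu> dz\<^sub>\<mu> F\<^sub>0\<close>, the coefficient of \<open>i dzbar\<^sup>\<nu> \<and> dz\<^sup>\<mu>\<close>.\<close>

definition kmat ::
    "('g, 'e::real_normed_vector, 'i) orbit_data \<Rightarrow> 'i \<Rightarrow> nat \<Rightarrow> nat \<Rightarrow> 'e dual \<Rightarrow> complex" where
  "kmat X \<alpha> \<nu> \<mu> \<xi> = dzbar X \<alpha> \<nu> (dz X \<alpha> \<mu> (\<lambda>\<xi>. complex_of_real (pot X \<alpha> \<xi>))) \<xi>"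

definition kaehler_potentials ::
    "('g::topological_space, 'e::real_normed_vector, 'i) orbit_data \<Rightarrow> bool" where
  "kaehler_potentials X \<longleftrightarrow> (\<forall>\<alpha>\<in>patches X.
     smooth_fun X (patch X \<alpha>) (pot X \<alpha>) \<and>
     (\<forall>\<xi>\<in>patch X \<alpha>.
        (\<forall>v\<in>tangent (lie X) \<xi>. \<forall>w\<in>tangent (lie X) \<xi>.
           let z = (\<lambda>\<mu>. diff_at (lie X) (\<lambda>\<xi>. coord X \<alpha> \<xi> \<mu>) \<xi>) in
           complex_of_real (omega0 (lie X) \<xi> v w) =
             \<i> * (\<Sum>\<nu><cdim X. \<Sum>\<mu><cdim X. kmat X \<alpha> \<nu> \<mu> \<xi> *
                   (cnj (z \<nu> v) * z \<mu> w - cnj (z \<nu> w) * z \<mu> v))) \<and>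
        (\<forall>c::nat \<Rightarrow> complex. (\<exists>\<mu><cdim X. c \<mu> \<noteq> 0) \<longrightarrow>
           (let s = (\<Sum>\<nu><cdim X. \<Sum>\<mu><cdim X. kmat X \<alpha> \<nu> \<mu> \<xi> * cnj (c \<nu>) * c \<mu>) in
            Im s = 0 \<and> Re s > 0))))"


section \<open>Quantization data\<close>

text \<open>
  The class of \<open>\<omega>\<^sub>0 / (2\<pi>\<hbar>)\<close> is integral: for some open cover with local primitives \<open>\<theta>\<close> of \<open>\<omega>\<^sub>0\<close>, and
  functions \<open>f\<close> on the overlaps with \<open>\<theta>\<^sub>V - \<theta>\<^sub>W = df\<^sub>V\<^sub>W\<close>, the Cech cocycle
  \<open>(f\<^sub>V\<^sub>W + f\<^sub>W\<^sub>Z + f\<^sub>Z\<^sub>V) / (2\<pi>\<hbar>)\<close> representing the class takes integer values.  The exterior derivative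
  is evaluated on fundamental fields \<open>X\<^sub>\<eta>\<close>, which satisfy \<open>[X\<^sub>\<eta>, X\<^sub>\<zeta>] = - X\<^bsub>[\<eta>,\<zeta>]\<^esub>\<close>.
\<close>

definition integral_class ::
    "('g::topological_space, 'e::real_normed_vector, 'i) orbit_data \<Rightarrow> bool" where
  "integral_class X \<longleftrightarrow>
     (\<exists>(\<V>::'e dual set set) (\<theta>::'e dual set \<Rightarrow> 'e dual \<Rightarrow> 'e dual \<Rightarrow> real)
        (f::'e dual set \<Rightarrow> 'e dual set \<Rightarrow> 'e dual \<Rightarrow> real).
        \<Union>\<V> = orb X \<and> (\<forall>V\<in>\<V>. orbit_open (lie X) (base_pt X) V) \<and>
        (\<forall>V\<in>\<V>. (\<forall>\<xi>\<in>V. linear (\<theta> V \<xi>)) \<and>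
           (\<forall>\<eta>. smooth_fun X V (\<lambda>\<xi>. \<theta> V \<xi> (fund (lie X) \<eta> \<xi>))) \<and>
           (\<forall>\<xi>\<in>V. \<forall>\<eta> \<zeta>.
              fund_deriv (lie X) \<eta> (\<lambda>\<xi>. \<theta> V \<xi> (fund (lie X) \<zeta> \<xi>)) \<xi>
              - fund_deriv (lie X) \<zeta> (\<lambda>\<xi>. \<theta> V \<xi> (fund (lie X) \<eta> \<xi>)) \<xi>
              + \<theta> V \<xi> (fund (lie X) (bracket (lie X) \<eta> \<zeta>) \<xi>)
              = omega0 (lie X) \<xi> (fund (lie X) \<eta> \<xi>) (fund (lie X) \<zeta> \<xi>))) \<and>
        (\<forall>V\<in>\<V>. \<forall>W\<in>\<V>. smooth_fun X (V \<inter> W) (f V W) \<and>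
           (\<forall>\<xi>\<in>V \<inter> W. \<forall>v\<in>tangent (lie X) \<xi>. \<theta> V \<xi> v - \<theta> W \<xi> v = diff_at (lie X) (f V W) \<xi> v)) \<and>
        (\<forall>V\<in>\<V>. \<forall>W\<in>\<V>. \<forall>Z\<in>\<V>. \<forall>\<xi>\<in>V \<inter> W \<inter> Z.
           (f V W \<xi> + f W Z \<xi> + f Z V \<xi>) / (2 * pi * hbar X) \<in> \<int>))"

definition antiholomorphic_on ::
    "('g::topological_space, 'e::real_normed_vector, 'i) orbit_data \<Rightarrow> 'i \<Rightarrow> 'e dual set \<Rightarrow>
     ('e dual \<Rightarrow> complex) \<Rightarrow> bool" where
  "antiholomorphic_on X \<alpha> W f \<longleftrightarrow>
     smooth_fun X W f \<and> (\<forall>\<xi>\<in>W. \<forall>\<mu><cdim X. dz X \<alpha> \<mu> f \<xi> = 0)"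

text \<open>
  Antiholomorphic transition functions, \<open>u\<^sub>\<alpha> = trans \<alpha> \<beta> u\<^sub>\<beta>\<close>; the condition on the modulus says that
  \<open>u \<cdot> cnj v \<cdot> exp (- F\<^sub>0 / \<hbar>)\<close> does not depend on the trivialization.
\<close>

definition hermitian_line_bundle ::
    "('g::topological_space, 'e::real_normed_vector, 'i) orbit_data \<Rightarrow> bool" where
  "hermitian_line_bundle X \<longleftrightarrow>
     (\<forall>\<alpha>\<in>patches X. \<forall>\<beta>\<in>patches X.
        antiholomorphic_on X \<alpha> (patch X \<alpha> \<inter> patch X \<beta>) (trans X \<alpha> \<beta>) \<and>
        (\<forall>\<xi>\<in>patch X \<alpha> \<inter> patch X \<beta>.
           (cmod (trans X \<alpha> \<beta> \<xi>))\<^sup>2 = exp ((pot X \<alpha> \<xi> - pot X \<beta> \<xi>) / hbar X)) \<and>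
        (\<forall>\<gamma>\<in>patches X. \<forall>\<xi>\<in>patch X \<alpha> \<inter> patch X \<beta> \<inter> patch X \<gamma>.
           trans X \<alpha> \<beta> \<xi> * trans X \<beta> \<gamma> \<xi> = trans X \<alpha> \<gamma> \<xi>))"

text \<open>The value of the k-th exterior power of the 2-form \<open>\<omega>\<close> on the vectors \<open>v 0, ..., v (2k - 1)\<close>.\<close>

definition wedge_power :: "('v \<Rightarrow> 'v \<Rightarrow> real) \<Rightarrow> nat \<Rightarrow> (nat \<Rightarrow> 'v) \<Rightarrow> real" where
  "wedge_power \<omega> k v =
     (\<Sum>\<sigma> | \<sigma> permutes {..<2 * k}.
        of_int (sign \<sigma>) * (\<Prod>i<k. \<omega> (v (\<sigma> (2 * i))) (v (\<sigma> (2 * i + 1))))) / 2 ^ k"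

text \<open>Density of \<open>|\<omega>\<^sub>0 \<and> ... \<and> \<omega>\<^sub>0| / n!\<close> with respect to \<open>dx\<^sup>1 dy\<^sup>1 ... dx\<^sup>n dy\<^sup>n\<close>.\<close>

definition liouville_density ::
    "('g, 'e::real_normed_vector, 'i) orbit_data \<Rightarrow> 'i \<Rightarrow> 'e dual \<Rightarrow> real" where
  "liouville_density X \<alpha> \<xi> =
     \<bar>wedge_power (omega0 (lie X) \<xi>) (cdim X)
        (\<lambda>j. coord_vec X \<alpha> (j div 2) (if even j then 1 else \<i>) \<xi>)\<bar> / fact (cdim X)"

definition liouville_measure ::
    "('g::topological_space, 'e::real_normed_vector, 'i) orbit_data \<Rightarrow> bool" where
  "liouville_measure X \<longleftrightarrow>
     space (vol X) = orb X \<and>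
     sets (vol X) = sigma_sets (orb X) {W. orbit_open (lie X) (base_pt X) W} \<and>
     (\<exists>c>0. \<forall>\<alpha>\<in>patches X. \<forall>A\<in>sets (vol X). A \<subseteq> patch X \<alpha> \<longrightarrow>
        emeasure (vol X) A =
          (\<integral>\<^sup>+ p. ennreal (c * liouville_density X \<alpha> (inv_into (patch X \<alpha>) (coord X \<alpha>) p)) *
                  indicator (coord X \<alpha> ` A) p \<partial>(PiM {..<cdim X} (\<lambda>_. lborel :: complex measure))))"


section \<open>The Hilbert space of antiholomorphic sections\<close>

text \<open>
  A section is the family of its components \<open>u \<alpha>\<close> in the trivializations, extended by 0.
\<close>

type_synonym ('e, 'i) sect = "'i \<Rightarrow> 'e dual \<Rightarrow> complex"

definition patch_at :: "('g, 'e::real_normed_vector, 'i) orbit_data \<Rightarrow> 'e dual \<Rightarrow> 'i" where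
  "patch_at X \<xi> = (SOME \<alpha>. \<alpha> \<in> patches X \<and> \<xi> \<in> patch X \<alpha>)"

definition antiholomorphic_sections ::
    "('g::topological_space, 'e::real_normed_vector, 'i) orbit_data \<Rightarrow> ('e, 'i) sect set" where
  "antiholomorphic_sections X = {u.
     (\<forall>\<alpha> \<xi>. \<not> (\<alpha> \<in> patches X \<and> \<xi> \<in> patch X \<alpha>) \<longrightarrow> u \<alpha> \<xi> = 0) \<and>
     (\<forall>\<alpha>\<in>patches X. antiholomorphic_on X \<alpha> (patch X \<alpha>) (u \<alpha>)) \<and>
     (\<forall>\<alpha>\<in>patches X. \<forall>\<beta>\<in>patches X. \<forall>\<xi>\<in>patch X \<alpha> \<inter> patch X \<beta>. u \<alpha> \<xi> = trans X \<alpha> \<beta> \<xi> * u \<beta> \<xi>)}"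

definition fiber_form ::
    "('g, 'e::real_normed_vector, 'i) orbit_data \<Rightarrow> ('e, 'i) sect \<Rightarrow> ('e, 'i) sect \<Rightarrow> 'e dual \<Rightarrow> complex"
    where
  "fiber_form X u v \<xi> = (let \<alpha> = patch_at X \<xi> in
     u \<alpha> \<xi> * cnj (v \<alpha> \<xi>) * complex_of_real (exp (- pot X \<alpha> \<xi> / hbar X)))"

definition Lspace ::
    "('g::topological_space, 'e::real_normed_vector, 'i) orbit_data \<Rightarrow> ('e, 'i) sect set" where
  "Lspace X = {u \<in> antiholomorphic_sections X. integrable (vol X) (fiber_form X u u)}"

definition sprod ::
    "('g, 'e::real_normed_vector, 'i) orbit_data \<Rightarrow> ('e, 'i) sect \<Rightarrow> ('e, 'i) sect \<Rightarrow> complex" where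
  "sprod X u v = 1 / (2 * pi * hbar X) ^ cdim X * (\<integral>\<xi>. fiber_form X u v \<xi> \<partial>vol X)"

definition snorm :: "('g, 'e::real_normed_vector, 'i) orbit_data \<Rightarrow> ('e, 'i) sect \<Rightarrow> real" where
  "snorm X u = sqrt (Re (sprod X u u))"

definition orthonormal_basis ::
    "('g::topological_space, 'e::real_normed_vector, 'i) orbit_data \<Rightarrow> ('e, 'i) sect set \<Rightarrow> bool" where
  "orthonormal_basis X B \<longleftrightarrow>
     B \<subseteq> Lspace X \<and>
     (\<forall>u\<in>B. \<forall>v\<in>B. sprod X u v = (if u = v then 1 else 0)) \<and>
     (\<forall>u\<in>Lspace X. (\<forall>v\<in>B. sprod X u v = 0) \<longrightarrow> u = (\<lambda>\<alpha> \<xi>. 0))"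

text \<open>
  \<open>repro_kernel B \<alpha> \<eta>\<close> is the section \<open>K(\<cdot>|\<eta>) = \<Sum>\<^sub>j u\<^sub>j(\<cdot>) cnj (u\<^sub>j(\<eta>))\<close>, with the second argument in the
  trivialization \<open>\<alpha>\<close>.
\<close>

definition repro_kernel :: "('e::real_normed_vector, 'i) sect set \<Rightarrow> 'i \<Rightarrow> 'e dual \<Rightarrow> ('e, 'i) sect" where
  "repro_kernel B \<alpha> \<eta> = (\<lambda>\<beta> \<xi>. \<Sum>\<^sub>\<infinity>u\<in>B. u \<beta> \<xi> * cnj (u \<alpha> \<eta>))"

text \<open>This condition fixes the constant in \<open>dm\<close>.\<close>

definition kernel_normalized ::
    "('g, 'e::real_normed_vector, 'i) orbit_data \<Rightarrow> ('e, 'i) sect set \<Rightarrow> bool" where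
  "kernel_normalized X B \<longleftrightarrow> (\<forall>\<alpha>\<in>patches X. \<forall>\<xi>\<in>patch X \<alpha>.
     ((\<lambda>u. (cmod (u \<alpha> \<xi>))\<^sup>2) has_sum exp (pot X \<alpha> \<xi> / hbar X)) B)"


section \<open>Operators, symbols and traces\<close>

type_synonym ('e, 'i) oper = "('e, 'i) sect \<Rightarrow> ('e, 'i) sect"

text \<open>The inverse \<open>\<omega>\<^sub>0\<^sup>-\<^sup>1\<^sup>\<mu>\<^sup>\<nu>\<close> (unique for indices below \<open>cdim X\<close>).\<close>

definition kinv ::
    "('g, 'e::real_normed_vector, 'i) orbit_data \<Rightarrow> 'i \<Rightarrow> 'e dual \<Rightarrow> nat \<Rightarrow> nat \<Rightarrow> complex" where
  "kinv X \<alpha> \<xi> = (SOME W. \<forall>\<mu><cdim X. \<forall>\<kappa><cdim X.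
     (\<Sum>\<nu><cdim X. W \<mu> \<nu> * kmat X \<alpha> \<nu> \<kappa> \<xi>) = (if \<mu> = \<kappa> then 1 else 0))"

definition ad_minus ::
    "('g, 'e::real_normed_vector, 'i) orbit_data \<Rightarrow> 'i \<Rightarrow> ('e dual \<Rightarrow> complex) \<Rightarrow> ('e dual \<Rightarrow> complex) \<Rightarrow>
     'e dual \<Rightarrow> complex" where
  "ad_minus X \<alpha> \<psi> h \<xi> =
     \<i> * (\<Sum>\<mu><cdim X. \<Sum>\<nu><cdim X. kinv X \<alpha> \<xi> \<mu> \<nu> * dz X \<alpha> \<mu> \<psi> \<xi> * dzbar X \<alpha> \<nu> h \<xi>)"

definition quantized_linear ::
    "('g, 'e::real_normed_vector, 'i) orbit_data \<Rightarrow> 'e \<Rightarrow> ('e, 'i) oper" where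
  "quantized_linear X \<eta> u = (\<lambda>\<alpha> \<xi>.
     if \<alpha> \<in> patches X \<and> \<xi> \<in> patch X \<alpha> then
       (let x = (\<lambda>\<xi>. complex_of_real (blinfun_apply \<xi> \<eta>)) in
        x \<xi> * u \<alpha> \<xi>
        + \<i> * ad_minus X \<alpha> x (\<lambda>\<xi>. complex_of_real (pot X \<alpha> \<xi>)) \<xi> * u \<alpha> \<xi>
        - \<i> * complex_of_real (hbar X) * ad_minus X \<alpha> x (u \<alpha>) \<xi>)
     else 0)"

definition unitary_operator ::
    "('g::topological_space, 'e::real_normed_vector, 'i) orbit_data \<Rightarrow> ('e, 'i) oper \<Rightarrow> bool" where
  "unitary_operator X T \<longleftrightarrow>
     bij_betw T (Lspace X) (Lspace X) \<and>
     (\<forall>u\<in>Lspace X. \<forall>v\<in>Lspace X. T (\<lambda>\<alpha> \<xi>. u \<alpha> \<xi> + v \<alpha> \<xi>) = (\<lambda>\<alpha> \<xi>. T u \<alpha> \<xi> + T v \<alpha> \<xi>)) \<and>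
     (\<forall>c. \<forall>u\<in>Lspace X. T (\<lambda>\<alpha> \<xi>. c * u \<alpha> \<xi>) = (\<lambda>\<alpha> \<xi>. c * T u \<alpha> \<xi>)) \<and>
     (\<forall>u\<in>Lspace X. \<forall>v\<in>Lspace X. sprod X (T u) (T v) = sprod X u v)"

text \<open>
  \<open>T = exp A\<close> in the sense of Stone's theorem: \<open>T\<close> is the value at time 1 of the strongly continuous
  unitary group with generator \<open>A\<close>.  Here \<open>A\<close> is a differential operator on sections, taken with its
  maximal domain \<open>{u \<in> Lspace X. A u \<in> Lspace X}\<close>.
\<close>

definition is_op_exp ::
    "('g::topological_space, 'e::real_normed_vector, 'i) orbit_data \<Rightarrow> ('e, 'i) oper \<Rightarrow> ('e, 'i) oper \<Rightarrow>
     bool" where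
  "is_op_exp X A T \<longleftrightarrow> (\<exists>U::real \<Rightarrow> ('e, 'i) oper.
     (\<forall>t. unitary_operator X (U t)) \<and>
     (\<forall>u\<in>Lspace X. U 0 u = u \<and> (\<forall>s t. U (s + t) u = U s (U t u))) \<and>
     (\<forall>u\<in>Lspace X. ((\<lambda>t. snorm X (\<lambda>\<alpha> \<xi>. U t u \<alpha> \<xi> - u \<alpha> \<xi>)) \<longlongrightarrow> 0) (at 0)) \<and>
     (\<forall>u\<in>Lspace X. \<forall>v\<in>Lspace X.
        ((\<lambda>t. snorm X (\<lambda>\<alpha> \<xi>. (U t u \<alpha> \<xi> - u \<alpha> \<xi>) / complex_of_real t - v \<alpha> \<xi>)) \<longlongrightarrow> 0) (at 0)
        \<longleftrightarrow> A u = v) \<and>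
     (\<forall>u\<in>Lspace X. T u = U 1 u))"

definition irreducible_unitary_rep ::
    "('g::topological_space, 'e::real_normed_vector, 'i) orbit_data \<Rightarrow> ('g \<Rightarrow> ('e, 'i) oper) \<Rightarrow> bool" where
  "irreducible_unitary_rep X \<pi> \<longleftrightarrow>
     (\<forall>g. unitary_operator X (\<pi> g)) \<and>
     (\<forall>u\<in>Lspace X. \<pi> \<one>\<^bsub>lie X\<^esub> u = u \<and> (\<forall>g h. \<pi> (g \<otimes>\<^bsub>lie X\<^esub> h) u = \<pi> g (\<pi> h u))) \<and>
     (\<forall>u\<in>Lspace X. \<forall>g. ((\<lambda>h. snorm X (\<lambda>\<alpha> \<xi>. \<pi> h u \<alpha> \<xi> - \<pi> g u \<alpha> \<xi>)) \<longlongrightarrow> 0) (at g)) \<and>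
     Lspace X \<noteq> {\<lambda>\<alpha> \<xi>. 0} \<and>
     (\<forall>M. M \<subseteq> Lspace X \<and> (\<lambda>\<alpha> \<xi>. 0) \<in> M \<and>
        (\<forall>u\<in>M. \<forall>v\<in>M. (\<lambda>\<alpha> \<xi>. u \<alpha> \<xi> + v \<alpha> \<xi>) \<in> M) \<and>
        (\<forall>c. \<forall>u\<in>M. (\<lambda>\<alpha> \<xi>. c * u \<alpha> \<xi>) \<in> M) \<and>
        (\<forall>s u. range s \<subseteq> M \<and> u \<in> Lspace X \<and>
           (\<lambda>k::nat. snorm X (\<lambda>\<alpha> \<xi>. s k \<alpha> \<xi> - u \<alpha> \<xi>)) \<longlonglongrightarrow> 0 \<longrightarrow> u \<in> M) \<and>
        (\<forall>g. \<pi> g ` M \<subseteq> M)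
        \<longrightarrow> M = {\<lambda>\<alpha> \<xi>. 0} \<or> M = Lspace X)"

text \<open>\<open>\<pi>(exp \<eta>) = exp {(i/\<hbar>) \<Sum>\<^sub>j \<eta>\<^sub>j xhat\<^sup>j}\<close> for the basis \<open>b 0, ..., b (m - 1)\<close> of the Lie algebra.\<close>

definition quantizes ::
    "('g::topological_space, 'e::real_normed_vector, 'i) orbit_data \<Rightarrow> nat \<Rightarrow> (nat \<Rightarrow> 'e) \<Rightarrow>
     ('g \<Rightarrow> ('e, 'i) oper) \<Rightarrow> bool" where
  "quantizes X m b \<pi> \<longleftrightarrow> (\<forall>c::nat \<Rightarrow> real.
     is_op_exp X
       (\<lambda>u \<alpha> \<xi>. \<i> / complex_of_real (hbar X) *
          (\<Sum>j<m. complex_of_real (c j) * quantized_linear X (b j) u \<alpha> \<xi>))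
       (\<pi> (lie_exp (lie X) (\<Sum>j<m. c j *\<^sub>R b j))))"

text \<open>The Wick symbol \<open>\<psi>(\<xi>) = (T K(\<cdot>|\<xi>))(\<xi>) / K(\<xi>|\<xi>)\<close>; the choice of trivialization cancels.\<close>

definition wick_symbol ::
    "('g, 'e::real_normed_vector, 'i) orbit_data \<Rightarrow> ('e, 'i) sect set \<Rightarrow> ('e, 'i) oper \<Rightarrow> 'e dual \<Rightarrow> complex"
    where
  "wick_symbol X B T \<xi> = (let \<alpha> = patch_at X \<xi> in
     T (repro_kernel B \<alpha> \<xi>) \<alpha> \<xi> / repro_kernel B \<alpha> \<xi> \<alpha> \<xi>)"

definition star_exp ::
    "('g, 'e::real_normed_vector, 'i) orbit_data \<Rightarrow> ('e, 'i) sect set \<Rightarrow> ('g \<Rightarrow> ('e, 'i) oper) \<Rightarrow>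
     'e \<Rightarrow> 'e dual \<Rightarrow> complex" where
  "star_exp X B \<pi> \<eta> = wick_symbol X B (\<pi> (lie_exp (lie X) \<eta>))"

definition pure_exp :: "real \<Rightarrow> 'e::real_normed_vector dual \<Rightarrow> 'e \<Rightarrow> complex" where
  "pure_exp h \<xi> \<eta> = exp (\<i> * complex_of_real (blinfun_apply \<xi> \<eta> / h))"

definition restriction_symbol ::
    "('g, 'e::real_normed_vector, 'i) orbit_data \<Rightarrow> ('e, 'i) sect set \<Rightarrow> ('g \<Rightarrow> ('e, 'i) oper) \<Rightarrow>
     'e dual \<Rightarrow> 'e \<Rightarrow> complex" where
  "restriction_symbol X B \<pi> \<xi> \<eta> =
     exp (- \<i> * complex_of_real (blinfun_apply \<xi> \<eta> / hbar X)) * star_exp X B \<pi> \<eta> \<xi>"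

text \<open>
  \<open>Op\<close> is the operator on functions of \<open>\<eta>\<close> with symbol \<open>E\<close>, derivatives acting first: it multiplies
  the exponentials by their symbol and is extended linearly to their superpositions over the orbit.
\<close>

definition ordered_operator ::
    "('g, 'e::real_normed_vector, 'i) orbit_data \<Rightarrow> ('e dual \<Rightarrow> 'e \<Rightarrow> complex) \<Rightarrow>
     (('e \<Rightarrow> complex) \<Rightarrow> ('e \<Rightarrow> complex)) \<Rightarrow> bool" where
  "ordered_operator X E Op \<longleftrightarrow>
     (\<forall>\<xi>\<in>orb X. Op (pure_exp (hbar X) \<xi>) = (\<lambda>\<eta>. E \<xi> \<eta> * pure_exp (hbar X) \<xi> \<eta>)) \<and>
     (\<forall>(\<nu>::'e dual measure) (a::'e dual \<Rightarrow> complex). sets \<nu> = sets (vol X) \<and> integrable \<nu> a \<longrightarrow>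
        Op (\<lambda>\<eta>. \<integral>\<xi>. a \<xi> * pure_exp (hbar X) \<xi> \<eta> \<partial>\<nu>) =
        (\<lambda>\<eta>. \<integral>\<xi>. a \<xi> * Op (pure_exp (hbar X) \<xi>) \<eta> \<partial>\<nu>))"

text \<open>The trace is defined if the diagonal sum converges unconditionally in every orthonormal basis,
  to the same value.\<close>

definition has_trace ::
    "('g::topological_space, 'e::real_normed_vector, 'i) orbit_data \<Rightarrow> ('e, 'i) oper \<Rightarrow> complex \<Rightarrow> bool"
    where
  "has_trace X T t \<longleftrightarrow> (\<forall>B. orthonormal_basis X B \<longrightarrow> ((\<lambda>u. sprod X (T u) u) has_sum t) B)"

definition trace_defined ::
    "('g::topological_space, 'e::real_normed_vector, 'i) orbit_data \<Rightarrow> ('e, 'i) oper \<Rightarrow> bool" where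
  "trace_defined X T \<longleftrightarrow> (\<exists>t. has_trace X T t)"

definition op_trace ::
    "('g::topological_space, 'e::real_normed_vector, 'i) orbit_data \<Rightarrow> ('e, 'i) oper \<Rightarrow> complex" where
  "op_trace X T = (THE t. has_trace X T t)"

end

theory Submission
  imports Defs
begin

text \<open>
  The operator \<open>\<pi> (exp \<eta>)\<close> is unitary.  A unitary operator \<open>T\<close> on an infinite-dimensional space has
  orthonormal bases in which the diagonal sum diverges (lemma \<open>finite_if_diagonals_summable\<close>), so the
  trace is defined only if the space of sections has finite dimension.  Then every orthonormal basis \<open>u\<^sub>j\<close>
  is finite, and everything else is a finite computation: the Wick symbol is
  \<open>\<psi> (\<xi>) = K (\<xi>|\<xi>)\<^sup>-\<^sup>1 \<Sum>\<^sub>j (T u\<^sub>j)(\<xi>) cnj (u\<^sub>j (\<xi>))\<close>, which by the normalization \<open>K = exp (F\<^sub>0 / \<hbar>)\<close> is the sum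
  of the pointwise Hermitian products \<open>(T u\<^sub>j, u\<^sub>j)\<^sub>\<hbar>\<close>.  Its integral is the sum of the diagonal values of
  \<open>T\<close>, up to the constant in the inner product (lemma \<open>trace_formula\<close>).  For \<open>T = 1\<close> the same identity
  shows that the orbit has finite volume.  Hence the integral of \<open>exp (i \<eta> / \<hbar>)\<close> over the orbit is
  a superposition of exponentials with a finite measure, on which the ordered operator acts
  under the integral sign; it replaces \<open>exp (i \<langle>\<eta>, \<xi>\<rangle> / \<hbar>)\<close> by the Wick symbol
  (lemma \<open>ordered_operator_integral\<close>).

  The argument in the Hilbert space uses linear combinations of sections, so it presupposes that the
  square-integrable antiholomorphic sections form a vector space.  The condition of antiholomorphy is
  expressed by derivatives along the curves \<open>t \<mapsto> Ad* (exp (t \<eta>)) \<xi>\<close>, where \<open>exp\<close> is a definite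
  description over one-parameter subgroups.  These derivatives are additive only if smooth functions
  are differentiable along the curves, which requires that each \<open>\<eta>\<close> generates exactly one one-parameter
  subgroup and that the coadjoint action is an action.  One-parameter subgroups are obtained by
  solving the differential equation of the left-invariant vector field in a chart and extending the
  local solution by the group law (\<open>one_param_subgroup_exists\<close>, \<open>generated_unique\<close>).
\<close>


section \<open>Finite-dimensional normed spaces\<close>

definition finite_dim :: "'a::real_vector itself \<Rightarrow> bool" where
  "finite_dim _ \<longleftrightarrow> (\<exists>B::'a set. finite B \<and> span B = UNIV)"

text \<open>A normed space carries no a priori relation between its norm and coordinates.  Compactness of the
  unit sphere of coefficients supplies it, and makes coordinate functions continuous.\<close>

lemma independent_norm_lower_bound:
  fixes B :: "'a::real_normed_vector set"
  assumes "finite B" "independent B"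
  shows "\<exists>m>0. \<forall>a. m * (\<Sum>b\<in>B. \<bar>a b\<bar>) \<le> norm (\<Sum>b\<in>B. a b *\<^sub>R b)"
proof (cases "B = {}")
  case True
  then show ?thesis by (intro exI[of _ 1]) auto
next
  case False
  define K where "K = (PiE UNIV (\<lambda>b. if b \<in> B then {-1..1::real} else {0}) :: ('a \<Rightarrow> real) set)"
  define S where "S = K \<inter> {a. (\<Sum>b\<in>B. \<bar>a b\<bar>) = 1}"
  have coord: "continuous_on T (\<lambda>a::'a \<Rightarrow> real. a b)" for T b
    by (rule continuous_on_subset[OF continuous_on_product_coordinates]) simp
  have "compact K"
    using compactin_PiE[of "\<lambda>_::'a. euclidean :: real topology" UNIV
        "\<lambda>b. if b \<in> B then {-1..1} else {0}"]
    by (auto simp: K_def euclidean_product_topology)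
  moreover have "closed {a::'a \<Rightarrow> real. (\<Sum>b\<in>B. \<bar>a b\<bar>) = 1}"
    by (intro closed_Collect_eq continuous_intros coord)
  ultimately have "compact S"
    unfolding S_def by blast
  have cont: "continuous_on S (\<lambda>a. norm (\<Sum>b\<in>B. a b *\<^sub>R b))"
    by (intro continuous_intros coord)
  obtain b0 where "b0 \<in> B" using False by blast
  have "(\<lambda>b. if b = b0 then 1 else 0) \<in> S"
    using assms \<open>b0 \<in> B\<close> by (auto simp: S_def K_def if_distrib[of abs] sum.delta cong: if_cong)
  then have "S \<noteq> {}" by blast
  then obtain a0 where a0: "a0 \<in> S"
    "\<And>a. a \<in> S \<Longrightarrow> norm (\<Sum>b\<in>B. a0 b *\<^sub>R b) \<le> norm (\<Sum>b\<in>B. a b *\<^sub>R b)"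
    using continuous_attains_inf[OF \<open>compact S\<close> _ cont] by blast
  define m where "m = norm (\<Sum>b\<in>B. a0 b *\<^sub>R b)"
  have "m > 0"
  proof (rule ccontr)
    assume "\<not> m > 0"
    then have "(\<Sum>b\<in>B. a0 b *\<^sub>R b) = 0" by (simp add: m_def)
    then have "\<forall>b\<in>B. a0 b = 0"
      using assms independentD[OF assms(2,1)] by blast
    then show False using a0(1) by (simp add: S_def)
  qed
  show ?thesis
  proof (intro exI conjI allI)
    fix a :: "'a \<Rightarrow> real"
    define s where "s = (\<Sum>b\<in>B. \<bar>a b\<bar>)"
    show "m * (\<Sum>b\<in>B. \<bar>a b\<bar>) \<le> norm (\<Sum>b\<in>B. a b *\<^sub>R b)"
    proof (cases "s = 0")
      case True
      then show ?thesis by (simp add: s_def)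
    next
      case False
      moreover have "s \<ge> 0" by (simp add: s_def sum_nonneg)
      ultimately have "s > 0" by simp
      define a' where "a' b = (if b \<in> B then a b / s else 0)" for b
      have le: "\<bar>a b\<bar> \<le> s" if "b \<in> B" for b
        unfolding s_def using that assms(1) by (intro member_le_sum) auto
      have "a' \<in> S"
        using \<open>s > 0\<close> le by (auto simp: S_def K_def a'_def abs_le_iff field_simps minus_le_iff sum_divide_distrib[symmetric] s_def[symmetric] cong: sum.cong)
      then have "m \<le> norm (\<Sum>b\<in>B. a' b *\<^sub>R b)" unfolding m_def by (rule a0(2))
      also have "(\<Sum>b\<in>B. a' b *\<^sub>R b) = (1/s) *\<^sub>R (\<Sum>b\<in>B. a b *\<^sub>R b)"
        by (simp add: a'_def scaleR_sum_right cong: sum.cong)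
      finally show ?thesis using \<open>s > 0\<close> by (simp add: s_def[symmetric] field_simps)
    qed
  qed fact
qed

lemma finite_dim_coordinates:
  assumes "finite_dim TYPE('a::real_normed_vector)"
  obtains B :: "'a::real_normed_vector set" and r :: "'a::real_normed_vector \<Rightarrow> 'a \<Rightarrow> real" where
    "finite B" "\<And>b. bounded_linear (r b)" "\<And>x. (\<Sum>b\<in>B. r b x *\<^sub>R b) = x"
proof -
  obtain S :: "'a set" where S: "finite S" "span S = UNIV"
    using assms by (auto simp: finite_dim_def)
  obtain B where B: "B \<subseteq> S" "independent B" "S \<subseteq> span B"
    using maximal_independent_subset[of S] by metis
  then have fin: "finite B" and sp: "span B = UNIV"
    using S finite_subset by (blast, metis span_minimal subspace_span top.extremum_unique)
  define r where "r b x = (if b \<in> B then representation B x b else 0)" for b x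
  have sum: "(\<Sum>b\<in>B. r b x *\<^sub>R b) = x" for x
    using real_vector.sum_representation_eq[OF B(2) _ fin order_refl, of x] sp
    by (simp add: r_def cong: sum.cong)
  obtain m where m: "m > 0" "\<And>a. m * (\<Sum>b\<in>B. \<bar>a b\<bar>) \<le> norm (\<Sum>b\<in>B. a b *\<^sub>R b)"
    using independent_norm_lower_bound[OF fin B(2)] by blast
  have "bounded_linear (r b)" for b
  proof (cases "b \<in> B")
    case True
    have "linear (\<lambda>x. representation B x b)"
      by (rule linearI) (simp_all add: real_vector.representation_add[OF B(2)]
          real_vector.representation_scale[OF B(2)] sp)
    then have lin: "linear (r b)" using True by (simp add: r_def[abs_def])
    show ?thesis
    proof (rule bounded_linear_intro[where K="1/m"])
      show "r b (x + y) = r b x + r b y" "r b (c *\<^sub>R x) = c *\<^sub>R r b x" for x y c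
        using lin by (simp_all add: linear_add linear_cmul)
      fix x
      have "m * \<bar>r b x\<bar> \<le> m * (\<Sum>b\<in>B. \<bar>r b x\<bar>)"
        using m True fin by (intro mult_left_mono member_le_sum) auto
      also have "\<dots> \<le> norm x" using m(2)[of "\<lambda>b. r b x"] sum by simp
      finally show "norm (r b x) \<le> norm x * (1 / m)" using m(1) by (simp add: field_simps)
    qed
  qed (simp add: r_def[abs_def])
  then show thesis using that fin sum by blast
qed

lemma finite_dim_prod:
  assumes "finite_dim TYPE('a::real_vector)" "finite_dim TYPE('b::real_vector)"
  shows "finite_dim TYPE('a \<times> 'b)"
proof -
  obtain A :: "'a set" and B :: "'b set" where
    A: "finite A" "span A = UNIV" and B: "finite B" "span B = UNIV"
    using assms by (auto simp: finite_dim_def)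
  let ?f = "\<lambda>a::'a. (a, 0::'b)" and ?g = "\<lambda>b::'b. (0::'a, b)"
  have lin: "linear ?f" "linear ?g" by (auto intro!: linearI)
  have "(x, y) \<in> span (?f ` A \<union> ?g ` B)" for x y
  proof -
    have "?f x \<in> span (?f ` A)" "?g y \<in> span (?g ` B)"
      using A B by (auto simp: real_vector.linear_span_image lin)
    then have "?f x \<in> span (?f ` A \<union> ?g ` B)" "?g y \<in> span (?f ` A \<union> ?g ` B)"
      using span_mono[of "?f ` A" "?f ` A \<union> ?g ` B"] span_mono[of "?g ` B" "?f ` A \<union> ?g ` B"] by auto
    from span_add[OF this] show ?thesis by simp
  qed
  then show ?thesis unfolding finite_dim_def
    using A B by (intro exI[of _ "?f ` A \<union> ?g ` B"]) auto
qed


lemma finite_dim_real: "finite_dim TYPE(real)"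
proof -
  have "x \<in> span {1}" for x :: real
  proof -
    have "x *\<^sub>R 1 \<in> span {1::real}" by (intro span_scale span_base) simp
    then show ?thesis by (simp only: real_scaleR_def mult_1_right)
  qed
  then show ?thesis unfolding finite_dim_def by (intro exI[of _ "{1}"]) auto
qed


section \<open>Calculus of maps of class \<open>C^k\<close>\<close>

lemma Ck_on_cong:
  assumes "open S" "\<And>x. x \<in> S \<Longrightarrow> f x = g x" "Ck_on k S f"
  shows "Ck_on k S g"
  using assms
proof (induction k arbitrary: f g)
  case 0
  then show ?case using continuous_on_cong[of S S f g] by simp
next
  case (Suc k)
  have d: "g differentiable (at x)" and e: "frechet_derivative f (at x) = frechet_derivative g (at x)"
    if "x \<in> S" for x
  proof -
    have f: "(f has_derivative frechet_derivative f (at x)) (at x)"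
      using Suc.prems that by (simp add: frechet_derivative_works[symmetric])
    have g: "(g has_derivative frechet_derivative f (at x)) (at x)"
      by (rule has_derivative_transform_within_open[OF f \<open>open S\<close> that]) (use Suc.prems in auto)
    then show "g differentiable (at x)" by (auto simp: differentiable_def)
    show "frechet_derivative f (at x) = frechet_derivative g (at x)"
      using frechet_derivative_at[OF g] .
  qed
  have "continuous_on S g" using Suc.prems continuous_on_cong[of S S f g] by simp
  moreover have "Ck_on k S (\<lambda>x. frechet_derivative g (at x) v)" for v
    by (rule Suc.IH[of "\<lambda>x. frechet_derivative f (at x) v"]) (use Suc.prems e in auto)
  ultimately show ?case using d by auto
qed

lemma Ck_on_SucI:
  assumes "open S" "\<And>x. x \<in> S \<Longrightarrow> (f has_derivative f' x) (at x)"
    and "\<And>v. Ck_on k S (\<lambda>x. f' x v)"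
  shows "Ck_on (Suc k) S f"
proof -
  have "Ck_on k S (\<lambda>x. frechet_derivative f (at x) v)" for v
    by (rule Ck_on_cong[OF assms(1) _ assms(3)[of v]])
      (use frechet_derivative_at[OF assms(2)] in auto)
  moreover have "continuous_on S f"
    using assms(2) has_derivative_continuous continuous_at_imp_continuous_on by blast
  ultimately show ?thesis using assms(2) by (auto simp: differentiable_def)
qed

lemma Ck_on_imp_continuous_on: "Ck_on k S f \<Longrightarrow> continuous_on S f"
  by (cases k) auto

lemma Ck_on_Suc_has_derivative:
  "Ck_on (Suc k) S f \<Longrightarrow> x \<in> S \<Longrightarrow> (f has_derivative frechet_derivative f (at x)) (at x)"
  by (simp add: frechet_derivative_works[symmetric])

lemma Ck_on_SucD: "Ck_on (Suc k) S f \<Longrightarrow> Ck_on k S f"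
proof (induction k arbitrary: f)
  case (Suc k)
  then have "Ck_on k S (\<lambda>x. frechet_derivative f (at x) v)" for v
    using Suc.IH[of "\<lambda>x. frechet_derivative f (at x) v"] by simp
  then show ?case using Suc.prems by auto
qed simp

lemma Ck_on_const: "open S \<Longrightarrow> Ck_on k S (\<lambda>x. c)"
proof (induction k arbitrary: c)
  case (Suc k)
  then show ?case by (intro Ck_on_SucI[where f'="\<lambda>_ _. 0"]) auto
qed simp

lemma Ck_on_add:
  assumes "open S"
  shows "Ck_on k S f \<Longrightarrow> Ck_on k S g \<Longrightarrow> Ck_on k S (\<lambda>x. f x + g x)"
proof (induction k arbitrary: f g)
  case (Suc k)
  show ?case
    by (rule Ck_on_SucI[OF assms has_derivative_add[OF Ck_on_Suc_has_derivative Ck_on_Suc_has_derivative]])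
      (use Suc in auto)
qed (auto intro: continuous_intros)

lemma Ck_on_sum:
  assumes "open S" "\<And>i. i \<in> I \<Longrightarrow> Ck_on k S (f i)"
  shows "Ck_on k S (\<lambda>x. \<Sum>i\<in>I. f i x)"
  using assms(2)
  by (induction I rule: infinite_finite_induct) (auto intro: Ck_on_add Ck_on_const assms(1))

lemma Ck_on_linear_compose:
  assumes "open S" "bounded_linear L"
  shows "Ck_on k S f \<Longrightarrow> Ck_on k S (\<lambda>x. L (f x))"
proof (induction k arbitrary: f)
  case 0
  then show ?case
    using linear_continuous_on[OF assms(2)] continuous_on_compose2[of UNIV L S f] by auto
next
  case (Suc k)
  show ?case
    by (rule Ck_on_SucI[OF assms(1) bounded_linear.has_derivative[OF assms(2) Ck_on_Suc_has_derivative]])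
      (use Suc in auto)
qed

lemma Ck_on_linear:
  assumes "open S" "bounded_linear L"
  shows "Ck_on k S L"
proof (cases k)
  case 0
  then show ?thesis by (simp add: linear_continuous_on assms(2))
next
  case (Suc n)
  then show ?thesis
    using Ck_on_SucI[OF assms(1) bounded_linear_imp_has_derivative[OF assms(2)]
        Ck_on_const[OF assms(1)]] by blast
qed

lemma Ck_on_bilinear:
  assumes "open S" "bounded_bilinear h"
  shows "Ck_on k S f \<Longrightarrow> Ck_on k S g \<Longrightarrow> Ck_on k S (\<lambda>x. h (f x) (g x))"
proof (induction k arbitrary: f g)
  case 0
  then show ?case by (auto intro: bounded_bilinear.continuous_on[OF assms(2)])
next
  case (Suc k)
  show ?case
  proof (rule Ck_on_SucI[OF assms(1) bounded_bilinear.FDERIV[OF assms(2) Ck_on_Suc_has_derivative Ck_on_Suc_has_derivative]])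
    fix v
    show "Ck_on k S (\<lambda>x. h (f x) (frechet_derivative g (at x) v) + h (frechet_derivative f (at x) v) (g x))"
      by (intro Ck_on_add[OF assms(1)] Suc.IH) (use Suc.prems Ck_on_SucD[OF Suc.prems(1)] Ck_on_SucD[OF Suc.prems(2)] in auto)
  qed (use Suc.prems in auto)
qed

text \<open>The chain rule writes the derivative of a composite in coordinates of the middle space, which
  exhibits it as a sum of products of maps of class one less; hence the finite dimension.\<close>

lemma Ck_on_compose:
  fixes f :: "'a::real_normed_vector \<Rightarrow> 'b::real_normed_vector"
    and g :: "'b \<Rightarrow> 'c::real_normed_vector"
  assumes fd: "finite_dim TYPE('b)" and "open S"
  shows "Ck_on k S f \<Longrightarrow> Ck_on k T g \<Longrightarrow> f ` S \<subseteq> T \<Longrightarrow> Ck_on k S (\<lambda>x. g (f x))"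
proof (induction k arbitrary: g)
  case 0
  then show ?case by (auto intro: continuous_on_compose2)
next
  case (Suc k)
  obtain B :: "'b set" and r where B: "finite B" "\<And>b. bounded_linear (r b)"
    "\<And>x. (\<Sum>b\<in>B. r b x *\<^sub>R b) = x"
    using finite_dim_coordinates[OF fd] by blast
  let ?f' = "\<lambda>x. frechet_derivative f (at x)" and ?g' = "\<lambda>y. frechet_derivative g (at y)"
  show ?case
  proof (rule Ck_on_SucI[OF \<open>open S\<close>])
    fix x assume x: "x \<in> S"
    have g: "(g has_derivative ?g' (f x)) (at (f x))"
      using Suc.prems x by (intro Ck_on_Suc_has_derivative) auto
    have "((\<lambda>x. g (f x)) has_derivative (\<lambda>v. ?g' (f x) (?f' x v))) (at x)"
      using diff_chain_at[OF Ck_on_Suc_has_derivative[OF Suc.prems(1) x] g] by (simp add: o_def)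
    moreover have "?g' (f x) (?f' x v) = (\<Sum>b\<in>B. r b (?f' x v) *\<^sub>R ?g' (f x) b)" for v
    proof -
      have "linear (?g' (f x))" using g by (rule has_derivative_linear)
      then show ?thesis
        by (subst B(3)[of "?f' x v", symmetric]) (simp add: linear_sum linear_cmul)
    qed
    ultimately show "((\<lambda>x. g (f x)) has_derivative
        (\<lambda>v. \<Sum>b\<in>B. r b (?f' x v) *\<^sub>R ?g' (f x) b)) (at x)" by simp
  next
    fix v
    have "Ck_on k S (\<lambda>x. ?g' (f x) b)" for b
      by (rule Suc.IH[of "\<lambda>y. ?g' y b"]) (use Suc.prems Ck_on_SucD[OF Suc.prems(1)] in auto)
    moreover have "Ck_on k S (\<lambda>x. r b (?f' x v))" for b
      using Suc.prems(1) Ck_on_linear_compose[OF \<open>open S\<close> B(2)] by simp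
    ultimately show "Ck_on k S (\<lambda>x. \<Sum>b\<in>B. r b (?f' x v) *\<^sub>R ?g' (f x) b)"
      by (intro Ck_on_sum[OF \<open>open S\<close>] Ck_on_bilinear[OF \<open>open S\<close> bounded_bilinear_scaleR])
  qed
qed

lemma Ck_on_Pair:
  assumes "open S" "Ck_on k S f" "Ck_on k S g"
  shows "Ck_on k S (\<lambda>x. (f x, g x))"
proof -
  have l: "bounded_linear (\<lambda>a. (a, 0))" "bounded_linear (\<lambda>b. (0, b))"
    by (auto intro!: bounded_linear_intro[where K=1] simp: norm_Pair)
  show ?thesis
    using Ck_on_add[OF assms(1) Ck_on_linear_compose[OF assms(1) l(1) assms(2)]
        Ck_on_linear_compose[OF assms(1) l(2) assms(3)]] by simp
qed

lemma smooth_on_compose: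
  fixes f :: "'a::real_normed_vector \<Rightarrow> 'b::real_normed_vector"
  assumes "finite_dim TYPE('b)" "open S" "smooth_on S f" "smooth_on T g" "f ` S \<subseteq> T"
  shows "smooth_on S (\<lambda>x. g (f x))"
  using assms Ck_on_compose by (fastforce simp: smooth_on_def)

lemma smooth_on_imp_continuous_on: "smooth_on S f \<Longrightarrow> continuous_on S f"
  unfolding smooth_on_def using Ck_on_imp_continuous_on by blast

lemma smooth_on_has_derivative:
  assumes "smooth_on S f" "x \<in> S"
  shows "(f has_derivative frechet_derivative f (at x)) (at x)"
  using assms Ck_on_Suc_has_derivative unfolding smooth_on_def by blast

lemma smooth_on_differentiable: "smooth_on S f \<Longrightarrow> x \<in> S \<Longrightarrow> f differentiable (at x)"
  using smooth_on_has_derivative differentiable_def by blast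

lemma smooth_on_frechet: "smooth_on S f \<Longrightarrow> smooth_on S (\<lambda>x. frechet_derivative f (at x) v)"
  unfolding smooth_on_def using Ck_on.simps(2) by blast

lemma smooth_on_cong:
  "open S \<Longrightarrow> (\<And>x. x \<in> S \<Longrightarrow> f x = g x) \<Longrightarrow> smooth_on S f \<Longrightarrow> smooth_on S g"
  unfolding smooth_on_def using Ck_on_cong by metis

lemma smooth_on_const: "open S \<Longrightarrow> smooth_on S (\<lambda>x. c)"
  by (simp add: smooth_on_def Ck_on_const)

lemma smooth_on_linear: "open S \<Longrightarrow> bounded_linear L \<Longrightarrow> smooth_on S L"
  by (simp add: smooth_on_def Ck_on_linear)

lemma smooth_on_add:
  "open S \<Longrightarrow> smooth_on S f \<Longrightarrow> smooth_on S g \<Longrightarrow> smooth_on S (\<lambda>x. f x + g x)"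
  by (simp add: smooth_on_def Ck_on_add)

lemma smooth_on_linear_compose:
  "open S \<Longrightarrow> bounded_linear L \<Longrightarrow> smooth_on S f \<Longrightarrow> smooth_on S (\<lambda>x. L (f x))"
  by (simp add: smooth_on_def Ck_on_linear_compose)

lemma smooth_on_Pair:
  "open S \<Longrightarrow> smooth_on S f \<Longrightarrow> smooth_on S g \<Longrightarrow> smooth_on S (\<lambda>x. (f x, g x))"
  by (simp add: smooth_on_def Ck_on_Pair)

text \<open>Differentiability at a point of \<open>S\<close> refers to the ambient space, so \<open>S\<close> itself need not be open:
  being of class \<open>C^k\<close> near each of its points is enough.\<close>

lemma Ck_on_local:
  assumes "\<And>x. x \<in> S \<Longrightarrow> \<exists>T. open T \<and> x \<in> T \<and> Ck_on k T f"
  shows "Ck_on k S f"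
  using assms
proof (induction k arbitrary: f)
  case 0
  have "isCont f x" if "x \<in> S" for x
    using 0[OF that] continuous_on_eq_continuous_at by auto
  then show ?case by (simp add: continuous_at_imp_continuous_on)
next
  case (Suc k)
  have d: "f differentiable (at x)" if "x \<in> S" for x
    using Suc.prems[OF that] by auto
  then have "continuous_on S f"
    by (auto intro: continuous_at_imp_continuous_on differentiable_imp_continuous_within)
  moreover have "Ck_on k S (\<lambda>x. frechet_derivative f (at x) v)" for v
  proof (rule Suc.IH)
    fix x assume "x \<in> S"
    from Suc.prems[OF this]
    show "\<exists>T. open T \<and> x \<in> T \<and> Ck_on k T (\<lambda>x. frechet_derivative f (at x) v)" by auto
  qed
  ultimately show ?case using d by simp
qed

lemma smooth_on_local:
  assumes "\<And>x. x \<in> S \<Longrightarrow> \<exists>T. open T \<and> x \<in> T \<and> smooth_on T f"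
  shows "smooth_on S f"
  unfolding smooth_on_def
proof
  fix k
  show "Ck_on k S f"
  proof (rule Ck_on_local)
    fix x assume "x \<in> S"
    from assms[OF this] show "\<exists>T. open T \<and> x \<in> T \<and> Ck_on k T f" by (auto simp: smooth_on_def)
  qed
qed

section \<open>Local solutions of autonomous differential equations\<close>

lemma vector_derivative_bound:
  fixes f :: "real \<Rightarrow> 'a::real_normed_vector"
  assumes "convex I" "\<And>t. t \<in> I \<Longrightarrow> (f has_vector_derivative f' t) (at t within I)"
    and "\<And>t. t \<in> I \<Longrightarrow> norm (f' t) \<le> B" "s \<in> I" "t \<in> I"
  shows "norm (f s - f t) \<le> B * \<bar>s - t\<bar>"
proof -
  have "norm (f s - f t) \<le> B * norm (s - t)"
  proof (rule differentiable_bound[OF assms(1), where f'="\<lambda>t h. h *\<^sub>R f' t"])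
    show "(f has_derivative (\<lambda>h. h *\<^sub>R f' x)) (at x within I)" if "x \<in> I" for x
      using assms(2)[OF that] by (simp add: has_vector_derivative_def)
    show "onorm (\<lambda>h. h *\<^sub>R f' x) \<le> B" if "x \<in> I" for x
      using assms(3)[OF that]
      by (intro onorm_le) (simp add: mult.commute[of B] mult_left_mono)
  qed fact+
  then show ?thesis by simp
qed

text \<open>On an interval so short that \<open>\<delta> L < 1\<close> the largest distance of two solutions is at most
  \<open>\<delta> L\<close> times itself.\<close>

lemma ode_unique:
  fixes x y :: "real \<Rightarrow> 'a::real_normed_vector"
  assumes "0 < \<delta>" "0 \<le> L" "\<delta> * L < 1"
    and lip: "\<And>a b. a \<in> D \<Longrightarrow> b \<in> D \<Longrightarrow> norm (V a - V b) \<le> L * norm (a - b)"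
    and x: "\<And>t. t \<in> {-\<delta>..\<delta>} \<Longrightarrow> x t \<in> D \<and> (x has_vector_derivative V (x t)) (at t within {-\<delta>..\<delta>})"
    and y: "\<And>t. t \<in> {-\<delta>..\<delta>} \<Longrightarrow> y t \<in> D \<and> (y has_vector_derivative V (y t)) (at t within {-\<delta>..\<delta>})"
    and "x 0 = y 0" "t \<in> {-\<delta>..\<delta>}"
  shows "x t = y t"
proof -
  let ?I = "{-\<delta>..\<delta>}"
  have "continuous_on ?I x" "continuous_on ?I y"
    using x y has_vector_derivative_continuous continuous_on_eq_continuous_within by blast+
  then have "continuous_on ?I (\<lambda>t. norm (x t - y t))" by (intro continuous_intros)
  then obtain u where u: "u \<in> ?I" "\<And>t. t \<in> ?I \<Longrightarrow> norm (x t - y t) \<le> norm (x u - y u)"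
    using continuous_attains_sup[of ?I "\<lambda>t. norm (x t - y t)"] \<open>0 < \<delta>\<close> by force
  define m where "m = norm (x u - y u)"
  have "norm ((x u - y u) - (x 0 - y 0)) \<le> (L * m) * \<bar>u - 0\<bar>"
  proof (rule vector_derivative_bound[where I="?I" and f'="\<lambda>t. V (x t) - V (y t)"])
    show "((\<lambda>t. x t - y t) has_vector_derivative V (x t) - V (y t)) (at t within ?I)" if "t \<in> ?I" for t
      using x[OF that] y[OF that] by (auto intro: has_vector_derivative_diff)
    show "norm (V (x t) - V (y t)) \<le> L * m" if "t \<in> ?I" for t
    proof -
      have "norm (V (x t) - V (y t)) \<le> L * norm (x t - y t)"
        using x[OF that] y[OF that] by (intro lip) auto
      also have "\<dots> \<le> L * m" using u(2)[OF that] \<open>0 \<le> L\<close> by (simp add: m_def mult_left_mono)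
      finally show ?thesis .
    qed
  qed (use u \<open>0 < \<delta>\<close> in auto)
  then have "m \<le> (L * m) * \<bar>u\<bar>" using \<open>x 0 = y 0\<close> by (simp add: m_def)
  also have "\<dots> \<le> (L * m) * \<delta>" using u(1) \<open>0 \<le> L\<close> by (intro mult_left_mono) (auto simp: m_def)
  finally have "m * (1 - \<delta> * L) \<le> 0" by (simp add: algebra_simps)
  then have "m \<le> 0" using assms(3) by (simp add: mult_le_0_iff)
  then have "norm (x t - y t) \<le> 0" using u(2)[OF assms(8)] by (simp add: m_def)
  then show ?thesis by simp
qed

text \<open>Picard iteration as a contraction of the bounded continuous functions on the whole line; the
  time variable is clamped to \<open>[-\<delta>, \<delta>]\<close>, outside of which the iterates could leave the ball.\<close>

lemma ode_exists_banach:
  fixes W :: "'b::banach \<Rightarrow> 'b"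
  assumes \<delta>: "0 < \<delta>" "0 \<le> L" "\<delta> * L < 1" "\<delta> * M \<le> r" "0 \<le> M"
    and lip: "\<And>a b. a \<in> cball y0 r \<Longrightarrow> b \<in> cball y0 r \<Longrightarrow> norm (W a - W b) \<le> L * norm (a - b)"
    and bound: "\<And>a. a \<in> cball y0 r \<Longrightarrow> norm (W a) \<le> M"
  shows "\<exists>y. y 0 = y0 \<and> (\<forall>t\<in>{-\<delta>..\<delta>}. y t \<in> cball y0 r \<and>
    (y has_vector_derivative W (y t)) (at t within {-\<delta>..\<delta>}))"
proof -
  let ?I = "{-\<delta>..\<delta>}"
  define S where "S = PiC (UNIV :: real set) (\<lambda>_. cball y0 r)"
  define \<Psi> where "\<Psi> f t = y0 + (integral {-\<delta>..t} (\<lambda>\<tau>. W (apply_bcontfun f \<tau>))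
      - integral {-\<delta>..0} (\<lambda>\<tau>. W (apply_bcontfun f \<tau>)))" for f t
  define cl where "cl t = max (-\<delta>) (min \<delta> t)" for t :: real
  define \<Phi> where "\<Phi> f = Bcontfun (\<lambda>t. \<Psi> f (cl t))" for f
  have r: "0 \<le> r" using \<delta> by (metis mult_nonneg_nonneg less_imp_le order_trans)
  have cl: "cl t \<in> ?I" for t using \<delta> by (auto simp: cl_def)
  have contW: "continuous_on (cball y0 r) W"
    unfolding continuous_on_iff
  proof (intro ballI allI impI)
    fix a and e :: real assume a: "a \<in> cball y0 r" and "e > 0"
    show "\<exists>d>0. \<forall>b\<in>cball y0 r. dist b a < d \<longrightarrow> dist (W b) (W a) < e"
    proof (intro exI conjI ballI impI)
      show "0 < e / (L + 1)" using \<open>e > 0\<close> \<open>0 \<le> L\<close> by simp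
      fix b assume b: "b \<in> cball y0 r" "dist b a < e / (L + 1)"
      have "dist (W b) (W a) \<le> L * dist b a" using lip[OF b(1) a] by (simp add: dist_norm)
      also have "\<dots> \<le> (L + 1) * dist b a" by (simp add: mult_right_mono)
      also have "\<dots> < e" using b \<open>0 \<le> L\<close> by (simp add: pos_less_divide_eq mult.commute)
      finally show "dist (W b) (W a) < e" .
    qed
  qed
  have fS: "apply_bcontfun f t \<in> cball y0 r" if "f \<in> S" for f t
    using that by (auto simp: S_def mem_PiC_iff)
  have deriv: "(\<Psi> f has_vector_derivative W (apply_bcontfun f t)) (at t within ?I)"
    if "f \<in> S" "t \<in> ?I" for f t
  proof -
    have "continuous_on ?I (\<lambda>\<tau>. W (apply_bcontfun f \<tau>))"
      using fS[OF that(1)] by (intro continuous_on_compose2[OF contW]) auto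
    from integral_has_vector_derivative[OF this that(2)]
    show ?thesis unfolding \<Psi>_def by (auto intro!: derivative_eq_intros)
  qed
  have \<Psi>0: "\<Psi> f 0 = y0" for f by (simp add: \<Psi>_def)
  have \<Psi>_ball: "\<Psi> f t \<in> cball y0 r" if "f \<in> S" "t \<in> ?I" for f t
  proof -
    have "norm (\<Psi> f t - \<Psi> f 0) \<le> M * \<bar>t - 0\<bar>"
      by (rule vector_derivative_bound[OF _ deriv[OF that(1)]])
        (use that \<delta> bound fS in auto)
    also have "\<dots> \<le> M * \<delta>" using that(2) \<delta> by (intro mult_left_mono) auto
    also have "\<dots> \<le> r" using \<delta> by (simp add: mult.commute)
    finally show ?thesis by (simp add: \<Psi>0 dist_norm norm_minus_commute)
  qed
  have ap: "apply_bcontfun (\<Phi> f) t = \<Psi> f (cl t)" if "f \<in> S" for f t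
  proof -
    have "continuous_on ?I (\<Psi> f)"
      using deriv[OF that] has_vector_derivative_continuous continuous_on_eq_continuous_within by blast
    then have "continuous_on UNIV (\<lambda>t. \<Psi> f (cl t))"
      by (rule continuous_on_compose2) (auto simp: cl_def intro!: continuous_intros, use \<delta> in auto)
    moreover have "bounded (range (\<lambda>t. \<Psi> f (cl t)))"
      by (rule bounded_subset[OF bounded_cball[of y0 r]]) (use \<Psi>_ball[OF that cl] in auto)
    ultimately have "(\<lambda>t. \<Psi> f (cl t)) \<in> bcontfun" by (simp add: bcontfun_def)
    then show ?thesis by (simp add: \<Phi>_def Bcontfun_inverse)
  qed
  have "\<exists>!f\<in>S. \<Phi> f = f"
  proof (rule Banach_fix)
    show "complete S" unfolding S_def by (intro closed_PiC[THEN complete_eq_closed[THEN iffD2]]) auto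
    have "const_bcontfun y0 \<in> S" using r by (auto simp: S_def mem_PiC_iff const_bcontfun.rep_eq)
    then show "S \<noteq> {}" by blast
    show "0 \<le> \<delta> * L" "\<delta> * L < 1" using \<delta> by auto
    show "\<Phi> ` S \<subseteq> S"
      using ap \<Psi>_ball cl by (auto simp: S_def mem_PiC_iff)
    fix f g assume fg: "f \<in> S" "g \<in> S"
    show "dist (\<Phi> f) (\<Phi> g) \<le> \<delta> * L * dist f g"
    proof (rule dist_bound)
      fix t
      let ?t = "cl t"
      have "norm ((\<Psi> f ?t - \<Psi> g ?t) - (\<Psi> f 0 - \<Psi> g 0)) \<le> (L * dist f g) * \<bar>?t - 0\<bar>"
      proof (rule vector_derivative_bound[where I="?I" and
            f'="\<lambda>t. W (apply_bcontfun f t) - W (apply_bcontfun g t)"])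
        show "((\<lambda>t. \<Psi> f t - \<Psi> g t) has_vector_derivative
            W (apply_bcontfun f t) - W (apply_bcontfun g t)) (at t within ?I)" if "t \<in> ?I" for t
          using deriv[OF fg(1) that] deriv[OF fg(2) that] by (rule has_vector_derivative_diff)
        fix t
        have "norm (W (apply_bcontfun f t) - W (apply_bcontfun g t))
            \<le> L * dist (apply_bcontfun f t) (apply_bcontfun g t)"
          using lip[OF fS[OF fg(1)] fS[OF fg(2)]] by (simp add: dist_norm)
        also have "\<dots> \<le> L * dist f g" by (intro mult_left_mono dist_bounded \<delta>)
        finally show "norm (W (apply_bcontfun f t) - W (apply_bcontfun g t)) \<le> L * dist f g" .
      qed (use cl \<delta> in auto)
      also have "\<dots> \<le> (L * dist f g) * \<delta>"
        using cl[of t] \<delta> by (intro mult_left_mono) auto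
      finally show "dist (apply_bcontfun (\<Phi> f) t) (apply_bcontfun (\<Phi> g) t) \<le> \<delta> * L * dist f g"
        by (simp add: ap fg \<Psi>0 dist_norm algebra_simps)
    qed
  qed
  then obtain f where f: "f \<in> S" "\<Phi> f = f" by blast
  have eq: "apply_bcontfun f t = \<Psi> f t" if "t \<in> ?I" for t
    using ap[OF f(1), of t] f(2) that by (auto simp: cl_def)
  show ?thesis
  proof (intro exI[of _ "apply_bcontfun f"] conjI ballI)
    show "apply_bcontfun f 0 = y0" using eq[of 0] \<delta> \<Psi>0 by simp
    fix t assume t: "t \<in> ?I"
    show "apply_bcontfun f t \<in> cball y0 r" using fS f by blast
    show "(apply_bcontfun f has_vector_derivative W (apply_bcontfun f t)) (at t within ?I)"
      by (rule has_vector_derivative_transform[OF t _ deriv[OF f(1) t]]) (use eq in auto)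
  qed
qed

text \<open>Picard iteration needs a complete space.  A finite-dimensional space is a retract of its bidual,
  which is a Banach space, and the differential equation is solved there.\<close>

lemma ode_exists:
  fixes V :: "'e::real_normed_vector \<Rightarrow> 'e"
  assumes fd: "finite_dim TYPE('e)" and "0 < \<rho>" "0 \<le> L"
    and lip: "\<And>a b. a \<in> ball x0 \<rho> \<Longrightarrow> b \<in> ball x0 \<rho> \<Longrightarrow> norm (V a - V b) \<le> L * norm (a - b)"
  shows "\<exists>\<delta>>0. \<exists>x. x 0 = x0 \<and> (\<forall>t\<in>{-\<delta>..\<delta>}. x t \<in> ball x0 \<rho> \<and>
    (x has_vector_derivative V (x t)) (at t within {-\<delta>..\<delta>}))"
proof -
  obtain B :: "'e set" and r where B: "finite B" "\<And>b. bounded_linear (r b)"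
    "\<And>x. (\<Sum>b\<in>B. r b x *\<^sub>R b) = x"
    using finite_dim_coordinates[OF fd] by blast
  define J :: "'e \<Rightarrow> ('e \<Rightarrow>\<^sub>L real) \<Rightarrow>\<^sub>L real" where "J x = Blinfun (\<lambda>\<phi>. blinfun_apply \<phi> x)" for x
  define K :: "(('e \<Rightarrow>\<^sub>L real) \<Rightarrow>\<^sub>L real) \<Rightarrow> 'e" where
    "K \<Phi> = (\<Sum>b\<in>B. blinfun_apply \<Phi> (Blinfun (r b)) *\<^sub>R b)" for \<Phi>
  have J_apply: "blinfun_apply (J x) \<phi> = blinfun_apply \<phi> x" for x \<phi>
    unfolding J_def by (simp add: bounded_linear_Blinfun_apply blinfun.bounded_linear_left)
  have J_diff: "J x - J y = J (x - y)" for x y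
    by (rule blinfun_eqI) (simp add: J_apply blinfun.diff_left blinfun.diff_right)
  have J_norm: "norm (J x) \<le> norm x" for x
  proof (rule norm_blinfun_bound)
    show "norm (blinfun_apply (J x) \<phi>) \<le> norm x * norm \<phi>" for \<phi>
      using norm_blinfun[of \<phi> x] by (simp add: J_apply mult.commute)
  qed simp
  have KJ: "K (J x) = x" for x
    by (simp add: K_def J_apply bounded_linear_Blinfun_apply B)
  have Klin: "bounded_linear K"
    unfolding K_def
    by (intro bounded_linear_sum bounded_linear_compose[OF bounded_linear_scaleR_left]
        blinfun.bounded_linear_left)
  obtain k where k: "k > 0" "\<And>\<Phi>. norm (K \<Phi>) \<le> norm \<Phi> * k"
    using bounded_linear.pos_bounded[OF Klin] by blast
  define W where "W = (\<lambda>\<Phi>. J (V (K \<Phi>)))"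
  define R where "R = \<rho> / (2 * k)"
  define M where "M = norm (V x0) + L * \<rho>"
  have R: "R > 0" using \<open>0 < \<rho>\<close> k by (simp add: R_def)
  have M: "M \<ge> 0" using assms by (simp add: M_def)
  have Kball: "K \<Phi> \<in> ball x0 \<rho>" if "\<Phi> \<in> cball (J x0) R" for \<Phi>
  proof -
    have "norm (x0 - K \<Phi>) = norm (K (J x0 - \<Phi>))"
      by (simp add: linear_diff[OF bounded_linear.linear[OF Klin]] KJ)
    also have "\<dots> \<le> norm (J x0 - \<Phi>) * k" by (rule k)
    also have "\<dots> \<le> R * k" using that k by (intro mult_right_mono) (auto simp: dist_norm)
    also have "\<dots> < \<rho>" using k \<open>0 < \<rho>\<close> by (simp add: R_def)
    finally show ?thesis by (simp add: dist_norm)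
  qed
  have Wlip: "norm (W a - W b) \<le> (L * k) * norm (a - b)"
    if "a \<in> cball (J x0) R" "b \<in> cball (J x0) R" for a b
  proof -
    have "norm (W a - W b) \<le> norm (V (K a) - V (K b))" by (simp add: W_def J_diff J_norm)
    also have "\<dots> \<le> L * norm (K (a - b))"
      using lip[OF Kball[OF that(1)] Kball[OF that(2)]] by (simp add: linear_diff[OF bounded_linear.linear[OF Klin]])
    also have "\<dots> \<le> L * (norm (a - b) * k)" by (intro mult_left_mono k \<open>0 \<le> L\<close>)
    finally show ?thesis by (simp add: mult_ac)
  qed
  have Wb: "norm (W a) \<le> M" if "a \<in> cball (J x0) R" for a
  proof -
    have "norm (W a) \<le> norm (V (K a))" by (simp add: W_def J_norm)
    also have "\<dots> \<le> norm (V x0) + norm (V (K a) - V x0)" by norm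
    also have "norm (V (K a) - V x0) \<le> L * norm (K a - x0)"
      using lip[OF Kball[OF that]] \<open>0 < \<rho>\<close> by simp
    also have "\<dots> \<le> L * \<rho>" using Kball[OF that] \<open>0 \<le> L\<close>
      by (intro mult_left_mono) (auto simp: dist_norm norm_minus_commute)
    finally show ?thesis by (simp add: M_def)
  qed
  define \<delta> where "\<delta> = min (R / (M + 1)) (1 / (2 * (L * k + 1)))"
  have Lk: "0 \<le> L * k" using assms k by simp
  have \<delta>: "0 < \<delta>" using R M Lk by (simp add: \<delta>_def)
  have "\<delta> * M \<le> R"
  proof -
    have "\<delta> * M \<le> R / (M + 1) * (M + 1)" using \<delta> M R by (intro mult_mono) (auto simp: \<delta>_def)
    then show ?thesis using M by simp
  qed
  moreover have "\<delta> * (L * k) < 1"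
  proof -
    have "\<delta> * (L * k) \<le> 1 / (2 * (L * k + 1)) * (L * k + 1)" using \<delta> Lk by (intro mult_mono) (auto simp: \<delta>_def)
    also have "\<dots> = 1/2" using Lk by (simp add: field_simps)
    finally show ?thesis by simp
  qed
  ultimately obtain y where y: "y 0 = J x0" "\<And>t. t \<in> {-\<delta>..\<delta>} \<Longrightarrow> y t \<in> cball (J x0) R \<and>
      (y has_vector_derivative W (y t)) (at t within {-\<delta>..\<delta>})"
    using ode_exists_banach[OF \<delta> Lk _ _ M Wlip Wb] by blast
  show ?thesis
  proof (rule exI[of _ \<delta>], intro exI[of _ "\<lambda>t. K (y t)"] conjI ballI \<delta>)
    show "K (y 0) = x0" by (simp add: y KJ)
    fix t assume t: "t \<in> {-\<delta>..\<delta>}"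
    show "K (y t) \<in> ball x0 \<rho>" using y(2)[OF t] Kball by blast
    have "((\<lambda>t. K (y t)) has_vector_derivative K (W (y t))) (at t within {-\<delta>..\<delta>})"
      using y(2)[OF t] bounded_linear.has_vector_derivative[OF Klin] by blast
    then show "((\<lambda>t. K (y t)) has_vector_derivative V (K (y t))) (at t within {-\<delta>..\<delta>})"
      by (simp add: W_def KJ)
  qed
qed

lemma smooth_on_locally_Lipschitz:
  fixes V :: "'e::real_normed_vector \<Rightarrow> 'b::real_normed_vector"
  assumes fd: "finite_dim TYPE('e)" and "open S" "x0 \<in> S" "smooth_on S V"
  shows "\<exists>\<rho>>0. \<exists>L\<ge>0. ball x0 \<rho> \<subseteq> S \<and>
    (\<forall>a\<in>ball x0 \<rho>. \<forall>b\<in>ball x0 \<rho>. norm (V a - V b) \<le> L * norm (a - b))"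
proof -
  obtain B :: "'e set" and r where B: "finite B" "\<And>b. bounded_linear (r b)"
    "\<And>x. (\<Sum>b\<in>B. r b x *\<^sub>R b) = x"
    using finite_dim_coordinates[OF fd] by blast
  let ?V' = "\<lambda>x. frechet_derivative V (at x)"
  define g where "g x = (\<Sum>b\<in>B. onorm (r b) * norm (?V' x b))" for x
  have V': "(V has_derivative ?V' x) (at x)" if "x \<in> S" for x
    using smooth_on_has_derivative[OF assms(4) that] .
  have g0: "g x \<ge> 0" for x
    unfolding g_def by (intro sum_nonneg mult_nonneg_nonneg onorm_pos_le B) auto
  have on: "onorm (?V' x) \<le> g x" if "x \<in> S" for x
  proof (rule onorm_bound[OF g0])
    fix v
    have "linear (?V' x)" using V'[OF that] by (rule has_derivative_linear)
    then have "?V' x v = (\<Sum>b\<in>B. r b v *\<^sub>R ?V' x b)"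
      by (subst B(3)[of v, symmetric]) (simp add: linear_sum linear_cmul)
    then have "norm (?V' x v) \<le> (\<Sum>b\<in>B. norm (r b v *\<^sub>R ?V' x b))"
      by (simp only: norm_sum)
    also have "\<dots> \<le> (\<Sum>b\<in>B. (onorm (r b) * norm v) * norm (?V' x b))"
      using onorm[OF B(2)] by (intro sum_mono) (auto intro!: mult_right_mono)
    also have "\<dots> = g x * norm v" by (simp add: g_def sum_distrib_left mult_ac)
    finally show "norm (?V' x v) \<le> g x * norm v" .
  qed
  have "continuous_on S (\<lambda>x. ?V' x b)" for b
    using smooth_on_imp_continuous_on[OF smooth_on_frechet[OF assms(4)]] .
  then have "continuous_on S g" unfolding g_def by (intro continuous_intros)
  then have "isCont g x0" using \<open>open S\<close> \<open>x0 \<in> S\<close> continuous_on_eq_continuous_at by blast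
  then have "\<forall>\<^sub>F x in nhds x0. g x < g x0 + 1"
    using order_tendstoD(2)[of g "g x0" "nhds x0" "g x0 + 1"] by (simp add: isCont_def tendsto_at_iff_tendsto_nhds)
  moreover have "\<forall>\<^sub>F x in nhds x0. x \<in> S" using assms by (simp add: eventually_nhds_in_open)
  ultimately have "\<forall>\<^sub>F x in nhds x0. g x < g x0 + 1 \<and> x \<in> S" by (rule eventually_conj)
  then obtain \<rho> where \<rho>: "\<rho> > 0" "\<And>x. x \<in> ball x0 \<rho> \<Longrightarrow> g x < g x0 + 1 \<and> x \<in> S"
    unfolding eventually_nhds_metric by (auto simp: dist_commute)
  show ?thesis
  proof (rule exI[of _ \<rho>], intro exI[of _ "g x0 + 1"] conjI ballI \<rho>(1))
    fix a b assume ab: "a \<in> ball x0 \<rho>" "b \<in> ball x0 \<rho>"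
    show "norm (V a - V b) \<le> (g x0 + 1) * norm (a - b)"
    proof (rule differentiable_bound[OF convex_ball[of x0 \<rho>] _ _ ab])
      fix x assume "x \<in> ball x0 \<rho>"
      from \<rho>(2)[OF this]
      show "(V has_derivative ?V' x) (at x within ball x0 \<rho>)" "onorm (?V' x) \<le> g x0 + 1"
        using V' on[of x] has_derivative_at_withinI by (blast, simp)
    qed
  qed (use \<rho> g0[of x0] in auto)
qed

section \<open>Lie groups in charts\<close>

locale lie_grp =
  fixes G :: "('g::{t2_space,second_countable_topology}, 'e::real_normed_vector) lie_data" (structure)
  assumes lie: "lie_group G"
begin

sublocale group G
  using lie by (simp add: lie_group_def)

lemma carrier_UNIV [simp]: "carrier G = UNIV"
  using lie by (simp add: lie_group_def)

lemma fin_dim: "finite_dim TYPE('e)"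
  using lie by (simp add: lie_group_def finite_dim_def)

lemma chart_ex: obtains U \<phi> where "(U, \<phi>) \<in> atlas G" "x \<in> U"
proof -
  have "(\<Union>(U, \<phi>)\<in>atlas G. U) = UNIV" using lie by (simp add: lie_group_def)
  then have "x \<in> (\<Union>(U, \<phi>)\<in>atlas G. U)" by simp
  then show thesis using that by blast
qed

lemma
  assumes "(U, \<phi>) \<in> atlas G"
  shows chart_open: "open U" and chart_image_open: "open (\<phi> ` U)"
    and chart_homeo: "homeomorphism U (\<phi> ` U) \<phi> (inv_into U \<phi>)"
  using lie assms by (auto simp: lie_group_def)

lemma
  assumes "(U, \<phi>) \<in> atlas G"
  shows chart_inv: "x \<in> U \<Longrightarrow> inv_into U \<phi> (\<phi> x) = x"
    and chart_cont: "continuous_on U \<phi>"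
    and chart_inv_cont: "continuous_on (\<phi> ` U) (inv_into U \<phi>)"
  using chart_homeo[OF assms] by (auto simp: homeomorphism_def)

lemma chart_inv_mem: "a \<in> \<phi> ` U \<Longrightarrow> inv_into U \<phi> a \<in> U"
  by (rule inv_into_into)

lemma chart_inv_right: "a \<in> \<phi> ` U \<Longrightarrow> \<phi> (inv_into U \<phi> a) = a"
  by (rule f_inv_into_f)

lemma open_chart_preimage:
  assumes "(U, \<phi>) \<in> atlas G" "open {x. P x}"
  shows "open {a \<in> \<phi> ` U. P (inv_into U \<phi> a)}"
proof -
  have "{a \<in> \<phi> ` U. P (inv_into U \<phi> a)} = \<phi> ` U \<inter> inv_into U \<phi> -` {x. P x}" by auto
  then show ?thesis
    using continuous_open_preimage[OF chart_inv_cont chart_image_open, OF assms(1) assms(1) assms(2)]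
    by simp
qed

lemma open_chart_image:
  assumes "(U, \<phi>) \<in> atlas G" "open W"
  shows "open (\<phi> ` (U \<inter> W))"
proof -
  have "\<phi> ` (U \<inter> W) = {a \<in> \<phi> ` U. inv_into U \<phi> a \<in> W}"
    using chart_inv[OF assms(1)] by force
  then show ?thesis using open_chart_preimage[OF assms(1), of "\<lambda>x. x \<in> W"] assms(2) by simp
qed

lemma mult_cont: "continuous_on UNIV (\<lambda>(x, y). x \<otimes> y)"
  using lie by (simp add: lie_group_def)

lemma mult_left_cont: "continuous_on UNIV (\<lambda>x. g \<otimes> x)"
  using continuous_on_compose2[OF mult_cont, of UNIV "\<lambda>x. (g, x)"] by (simp add: continuous_on_Pair continuous_on_const continuous_on_id)

lemma mult_right_cont: "continuous_on UNIV (\<lambda>x. x \<otimes> g)"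
  using continuous_on_compose2[OF mult_cont, of UNIV "\<lambda>x. (x, g)"] by (simp add: continuous_on_Pair continuous_on_const continuous_on_id)

definition mult_dom :: "'g set \<Rightarrow> ('g \<Rightarrow> 'e) \<Rightarrow> 'g set \<Rightarrow> ('g \<Rightarrow> 'e) \<Rightarrow> 'g set \<Rightarrow> ('e \<times> 'e) set" where
  "mult_dom U \<phi> V \<psi> W = {(\<phi> x, \<psi> y) | x y. x \<in> U \<and> y \<in> V \<and> x \<otimes> y \<in> W}"

lemma mult_dom_iff:
  assumes "(U, \<phi>) \<in> atlas G" "(V, \<psi>) \<in> atlas G"
  shows "(a, b) \<in> mult_dom U \<phi> V \<psi> W \<longleftrightarrow>
    a \<in> \<phi> ` U \<and> b \<in> \<psi> ` V \<and> inv_into U \<phi> a \<otimes> inv_into V \<psi> b \<in> W"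
  unfolding mult_dom_def using chart_inv[OF assms(1)] chart_inv[OF assms(2)] by force

lemma open_mult_dom:
  assumes "(U, \<phi>) \<in> atlas G" "(V, \<psi>) \<in> atlas G" "open W"
  shows "open (mult_dom U \<phi> V \<psi> W)"
proof -
  let ?f = "\<lambda>(a, b). inv_into U \<phi> a \<otimes> inv_into V \<psi> b"
  have "continuous_on (\<phi> ` U \<times> \<psi> ` V) (\<lambda>z. (inv_into U \<phi> (fst z), inv_into V \<psi> (snd z)))"
    by (intro continuous_on_Pair continuous_on_compose2[OF chart_inv_cont[OF assms(1)]]
        continuous_on_compose2[OF chart_inv_cont[OF assms(2)]] continuous_intros) auto
  then have "continuous_on (\<phi> ` U \<times> \<psi> ` V) (\<lambda>z. case (inv_into U \<phi> (fst z), inv_into V \<psi> (snd z)) of (x, y) \<Rightarrow> x \<otimes> y)"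
    by (rule continuous_on_compose2[OF mult_cont]) auto
  then have "continuous_on (\<phi> ` U \<times> \<psi> ` V) ?f" by (simp add: case_prod_beta')
  moreover have "open (\<phi> ` U \<times> \<psi> ` V)"
    using chart_image_open assms by (auto intro: open_Times)
  ultimately have "open ((\<phi> ` U \<times> \<psi> ` V) \<inter> ?f -` W)"
    by (rule continuous_open_preimage) (rule assms(3))
  moreover have "(\<phi> ` U \<times> \<psi> ` V) \<inter> ?f -` W = mult_dom U \<phi> V \<psi> W"
  proof (rule Set.set_eqI)
    fix z :: "'e \<times> 'e"
    show "z \<in> (\<phi> ` U \<times> \<psi> ` V) \<inter> ?f -` W \<longleftrightarrow> z \<in> mult_dom U \<phi> V \<psi> W"
      by (cases z) (simp add: mult_dom_iff[OF assms(1,2)])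
  qed
  ultimately show ?thesis by simp
qed

lemma mult_smooth:
  assumes "(U, \<phi>) \<in> atlas G" "(V, \<psi>) \<in> atlas G" "(W, \<rho>) \<in> atlas G"
  shows "smooth_on (mult_dom U \<phi> V \<psi> W) (\<lambda>(a, b). \<rho> (inv_into U \<phi> a \<otimes> inv_into V \<psi> b))"
proof -
  have "\<forall>(U, \<phi>)\<in>atlas G. \<forall>(V, \<psi>)\<in>atlas G. \<forall>(W, \<rho>)\<in>atlas G.
        smooth_on {(\<phi> x, \<psi> y) | x y. x \<in> U \<and> y \<in> V \<and> x \<otimes> y \<in> W}
          (\<lambda>(a, b). \<rho> (inv_into U \<phi> a \<otimes> inv_into V \<psi> b))"
    using lie by (simp add: lie_group_def)
  from bspec[OF bspec[OF bspec[OF this assms(1), simplified] assms(2), simplified] assms(3), simplified]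
  show ?thesis by (simp add: mult_dom_def)
qed

lemma
  assumes "(U, \<phi>) \<in> atlas G" "(W, \<rho>) \<in> atlas G"
  shows mult_left_smooth: "smooth_on {a \<in> \<phi> ` U. g \<otimes> inv_into U \<phi> a \<in> W} (\<lambda>a. \<rho> (g \<otimes> inv_into U \<phi> a))"
    and mult_right_smooth: "smooth_on {a \<in> \<phi> ` U. inv_into U \<phi> a \<otimes> g \<in> W} (\<lambda>a. \<rho> (inv_into U \<phi> a \<otimes> g))"
proof -
  obtain V \<psi> where V: "(V, \<psi>) \<in> atlas G" "g \<in> V" by (rule chart_ex)
  let ?L = "{a \<in> \<phi> ` U. g \<otimes> inv_into U \<phi> a \<in> W}" and ?R = "{a \<in> \<phi> ` U. inv_into U \<phi> a \<otimes> g \<in> W}"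
  have oW: "open W" using chart_open assms by blast
  have "open {x. g \<otimes> x \<in> W}" "open {x. x \<otimes> g \<in> W}"
    using continuous_open_vimage[of W "\<lambda>x. g \<otimes> x"] continuous_open_vimage[of W "\<lambda>x. x \<otimes> g"]
      mult_left_cont mult_right_cont oW by (auto simp: vimage_def continuous_on_eq_continuous_at)
  then have o: "open ?L" "open ?R"
    using open_chart_preimage[OF assms(1), of "\<lambda>x. g \<otimes> x \<in> W"]
      open_chart_preimage[OF assms(1), of "\<lambda>x. x \<otimes> g \<in> W"] by auto
  have c: "smooth_on S (\<lambda>a. \<psi> g)" "smooth_on S (\<lambda>a. a)" if "open S" for S :: "'e set"
    using smooth_on_const smooth_on_linear[OF _ bounded_linear_ident] that by auto
  have g: "inv_into V \<psi> (\<psi> g) = g" "\<psi> g \<in> \<psi> ` V" using chart_inv V by auto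
  have "(\<lambda>a. (\<psi> g, a)) ` ?L \<subseteq> mult_dom V \<psi> U \<phi> W" "(\<lambda>a. (a, \<psi> g)) ` ?R \<subseteq> mult_dom U \<phi> V \<psi> W"
    using g by (auto simp only: mult_dom_iff[OF V(1) assms(1)] mult_dom_iff[OF assms(1) V(1)])
  note comp = smooth_on_compose[OF finite_dim_prod[OF fin_dim fin_dim] o(1)
      smooth_on_Pair[OF o(1) c(1)[OF o(1)] c(2)[OF o(1)]] mult_smooth[OF V(1) assms(1,2)] this(1)]
    smooth_on_compose[OF finite_dim_prod[OF fin_dim fin_dim] o(2)
      smooth_on_Pair[OF o(2) c(2)[OF o(2)] c(1)[OF o(2)]] mult_smooth[OF assms(1) V(1) assms(2)] this(2)]
  from comp show "smooth_on ?L (\<lambda>a. \<rho> (g \<otimes> inv_into U \<phi> a))"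
    "smooth_on ?R (\<lambda>a. \<rho> (inv_into U \<phi> a \<otimes> g))" by (simp_all only: g(1) prod.case)
qed

text \<open>The chart that identifies the tangent space at the identity with the model space, its inverse,
  and the coordinates of the identity.\<close>

definition "U1 = fst (one_chart G)"
definition "\<phi>1 = snd (one_chart G)"
abbreviation "p \<equiv> inv_into U1 \<phi>1"
definition "x1 = \<phi>1 \<one>"

lemma one_chart_eq: "one_chart G = (U1, \<phi>1)"
  by (simp add: U1_def \<phi>1_def)

lemma chart1: "(U1, \<phi>1) \<in> atlas G" "\<one> \<in> U1"
proof -
  obtain U \<phi> where "(U, \<phi>) \<in> atlas G" "\<one> \<in> U" by (rule chart_ex)
  then have "\<exists>c. c \<in> atlas G \<and> \<one> \<in> fst c" by (intro exI[of _ "(U, \<phi>)"]) auto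
  from someI_ex[OF this] show "(U1, \<phi>1) \<in> atlas G" "\<one> \<in> U1"
    unfolding U1_def \<phi>1_def one_chart_def by auto
qed

lemma x1: "x1 \<in> \<phi>1 ` U1" "p x1 = \<one>"
  using chart1 chart_inv[OF chart1(1)] by (auto simp: x1_def)

lemma mult_left_isCont: "isCont (\<lambda>x. g \<otimes> x) y"
  using mult_left_cont continuous_on_eq_continuous_at by blast

lemma mult_right_isCont: "isCont (\<lambda>x. x \<otimes> g) y"
  using mult_right_cont continuous_on_eq_continuous_at by blast


section \<open>The adjoint and coadjoint actions\<close>

definition "conj1 g a = \<phi>1 (g \<otimes> p a \<otimes> inv g)"

lemma conj_chart_open: "open {a \<in> \<phi>1 ` U1. g \<otimes> p a \<otimes> inv g \<in> U1}"
proof (rule open_chart_preimage[OF chart1(1)])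
  have "continuous_on UNIV (\<lambda>x. g \<otimes> x \<otimes> inv g)"
    by (rule continuous_on_compose2[OF mult_right_cont mult_left_cont]) simp
  then show "open {x. g \<otimes> x \<otimes> inv g \<in> U1}"
    using continuous_open_vimage[of U1] chart_open[OF chart1(1)]
    by (auto simp: vimage_def continuous_on_eq_continuous_at)
qed

lemma conj1_one: "conj1 g x1 = x1"
  by (simp add: conj1_def x1) (simp add: x1_def)

text \<open>Conjugation by \<open>g\<close> leaves the chart domain in between, so the derivative is obtained through a
  chart around \<open>g\<close>.\<close>

lemma conj1_has_derivative: "(conj1 g has_derivative Ad G g) (at x1)"
proof -
  obtain W \<rho> where W: "(W, \<rho>) \<in> atlas G" "g \<in> W" by (rule chart_ex)
  let ?S = "{a \<in> \<phi>1 ` U1. g \<otimes> p a \<in> W}"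
  have S: "x1 \<in> ?S" using x1 W by simp
  have "open {x. g \<otimes> x \<in> W}"
    using continuous_open_vimage[of W "\<lambda>x. g \<otimes> x"] mult_left_isCont chart_open[OF W(1)] by (auto simp: vimage_def)
  then have oS: "open ?S" by (rule open_chart_preimage[OF chart1(1)])
  have "(\<lambda>a. \<rho> (g \<otimes> p a)) differentiable (at x1)"
    by (rule smooth_on_differentiable[OF mult_left_smooth[OF chart1(1) W(1)] S])
  then obtain D1 where D1: "((\<lambda>a. \<rho> (g \<otimes> p a)) has_derivative D1) (at x1)" by (auto simp: differentiable_def)
  have r: "\<rho> (g \<otimes> p x1) = \<rho> g" by (simp add: x1)
  have "\<rho> g \<in> {b \<in> \<rho> ` W. inv_into W \<rho> b \<otimes> inv g \<in> U1}"
    using W chart1 by (simp add: chart_inv[OF W(1)])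
  then have "(\<lambda>b. \<phi>1 (inv_into W \<rho> b \<otimes> inv g)) differentiable (at (\<rho> g))"
    by (rule smooth_on_differentiable[OF mult_right_smooth[OF W(1) chart1(1)]])
  then obtain D2 where D2: "((\<lambda>b. \<phi>1 (inv_into W \<rho> b \<otimes> inv g)) has_derivative D2) (at (\<rho> (g \<otimes> p x1)))"
    unfolding r by (auto simp: differentiable_def)
  have "((\<lambda>a. \<phi>1 (inv_into W \<rho> (\<rho> (g \<otimes> p a)) \<otimes> inv g)) has_derivative D2 \<circ> D1) (at x1)"
    using diff_chain_at[OF D1 D2] by (simp add: o_def)
  then have "(conj1 g has_derivative D2 \<circ> D1) (at x1)"
    by (rule has_derivative_transform_within_open[OF _ oS S]) (simp add: conj1_def chart_inv[OF W(1)])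
  then have "(conj1 g has_derivative frechet_derivative (conj1 g) (at x1)) (at x1)"
    using frechet_derivative_at by metis
  moreover have "frechet_derivative (conj1 g) (at x1) = Ad G g"
    by (simp add: Ad_def one_chart_eq conj1_def[abs_def] x1_def)
  ultimately show ?thesis by simp
qed

lemma Ad_bounded_linear: "bounded_linear (Ad G g)"
  using conj1_has_derivative by (rule has_derivative_bounded_linear)

lemma Ad_mult: "Ad G (g \<otimes> h) = Ad G g \<circ> Ad G h"
proof -
  let ?S = "{a \<in> \<phi>1 ` U1. h \<otimes> p a \<otimes> inv h \<in> U1}"
  have "(conj1 g has_derivative Ad G g) (at (conj1 h x1))"
    by (simp add: conj1_one conj1_has_derivative)
  from diff_chain_at[OF conj1_has_derivative this]
  have "((\<lambda>a. conj1 g (conj1 h a)) has_derivative Ad G g \<circ> Ad G h) (at x1)" by (simp add: o_def)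
  then have "(conj1 (g \<otimes> h) has_derivative Ad G g \<circ> Ad G h) (at x1)"
  proof (rule has_derivative_transform_within_open[OF _ conj_chart_open[of h]])
    show "x1 \<in> ?S" using x1 chart1 by simp
    fix a assume "a \<in> ?S"
    then show "conj1 g (conj1 h a) = conj1 (g \<otimes> h) a"
      by (simp add: conj1_def chart_inv[OF chart1(1)] inv_mult_group m_assoc)
  qed
  then show ?thesis using has_derivative_unique conj1_has_derivative by metis
qed

lemma coAd_apply: "blinfun_apply (coAd G g \<xi>) \<zeta> = blinfun_apply \<xi> (Ad G (inv g) \<zeta>)"
  unfolding coAd_def
  by (subst bounded_linear_Blinfun_apply)
    (auto intro: bounded_linear_compose[OF blinfun.bounded_linear_right Ad_bounded_linear])

text \<open>By this action law the flow \<open>t \<mapsto> coAd (exp (t \<eta>)) \<xi>\<close> of a point of the orbit lifts to a curve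
  \<open>exp (t \<eta>) g\<close> in the group, where smoothness is defined.\<close>

lemma coAd_mult: "coAd G g (coAd G h \<xi>) = coAd G (g \<otimes> h) \<xi>"
  by (rule blinfun_eqI) (simp add: coAd_apply inv_mult_group Ad_mult)


section \<open>One-parameter subgroups\<close>

abbreviation "chart_mult_dom \<equiv> mult_dom U1 \<phi>1 U1 \<phi>1 U1"
definition "chart_mult = (\<lambda>(a, b). \<phi>1 (p a \<otimes> p b))"

lemma chart_mult_dom_iff: "(a, b) \<in> chart_mult_dom \<longleftrightarrow> a \<in> \<phi>1 ` U1 \<and> b \<in> \<phi>1 ` U1 \<and> p a \<otimes> p b \<in> U1"
  by (rule mult_dom_iff[OF chart1(1) chart1(1)])

lemma open_chart_mult_dom: "open chart_mult_dom"
  by (rule open_mult_dom[OF chart1(1) chart1(1) chart_open[OF chart1(1)]])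

lemma chart_mult_smooth: "smooth_on chart_mult_dom chart_mult"
  unfolding chart_mult_def by (rule mult_smooth[OF chart1(1) chart1(1) chart1(1)])

lemma chart_mult_has_derivative: "z \<in> chart_mult_dom \<Longrightarrow> (chart_mult has_derivative frechet_derivative chart_mult (at z)) (at z)"
  by (rule smooth_on_has_derivative[OF chart_mult_smooth])

lemma p_chart_mult: "(a, b) \<in> chart_mult_dom \<Longrightarrow> p (chart_mult (a, b)) = p a \<otimes> p b"
  by (simp add: chart_mult_def chart_mult_dom_iff chart_inv[OF chart1(1)])

lemma chart_mult_mem: "(a, b) \<in> chart_mult_dom \<Longrightarrow> chart_mult (a, b) \<in> \<phi>1 ` U1"
  by (simp add: chart_mult_def chart_mult_dom_iff)

lemma p_mem: "a \<in> \<phi>1 ` U1 \<Longrightarrow> p a \<in> U1"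
  by (rule chart_inv_mem)

lemma chart_mult_one:
  assumes "a \<in> \<phi>1 ` U1"
  shows "(a, x1) \<in> chart_mult_dom" "(x1, a) \<in> chart_mult_dom" "chart_mult (a, x1) = a" "chart_mult (x1, a) = a"
  using assms by (simp_all add: chart_mult_dom_iff x1 p_mem chart_mult_def chart_inv_right)

text \<open>The left-invariant vector field with value \<open>\<eta>\<close> at the identity, read in the chart.\<close>

definition "left_field \<eta> a = frechet_derivative chart_mult (at (a, x1)) (0, \<eta>)"

lemma left_field_smooth: "smooth_on (\<phi>1 ` U1) (left_field \<eta>)"
proof -
  note o = chart_image_open[OF chart1(1)]
  have "smooth_on (\<phi>1 ` U1) (\<lambda>a. (a, x1))"
    by (intro smooth_on_Pair o smooth_on_const smooth_on_linear[OF o bounded_linear_ident])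
  moreover have "(\<lambda>a. (a, x1)) ` \<phi>1 ` U1 \<subseteq> chart_mult_dom" using chart_mult_one(1) by (auto simp only:)
  ultimately show ?thesis unfolding left_field_def[abs_def]
    by (intro smooth_on_compose[OF finite_dim_prod[OF fin_dim fin_dim] o _ smooth_on_frechet[OF chart_mult_smooth]])
qed

lemma chart_mult_snd_has_derivative:
  assumes "(a, b) \<in> chart_mult_dom"
  shows "((\<lambda>c. chart_mult (a, c)) has_derivative (\<lambda>v. frechet_derivative chart_mult (at (a, b)) (0, v))) (at b)"
proof -
  have "((\<lambda>c. (a, c)) has_derivative (\<lambda>v. (0, v))) (at b)"
    by (auto intro!: derivative_eq_intros)
  from diff_chain_at[OF this, of chart_mult] chart_mult_has_derivative[OF assms]
  show ?thesis by (simp add: o_def)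
qed

lemma left_field_has_derivative:
  assumes "a \<in> \<phi>1 ` U1"
  shows "((\<lambda>c. chart_mult (a, c)) has_derivative (\<lambda>v. left_field v a)) (at x1)"
  using chart_mult_snd_has_derivative[OF chart_mult_one(1)[OF assms]] by (simp add: left_field_def)

lemma left_field_one: "left_field \<eta> x1 = \<eta>"
proof -
  have "((\<lambda>c. chart_mult (x1, c)) has_derivative (\<lambda>v. v)) (at x1)"
    by (rule has_derivative_transform_within_open[OF has_derivative_ident chart_image_open[OF chart1(1)] x1(1)])
      (simp add: chart_mult_one)
  from has_derivative_unique[OF this left_field_has_derivative[OF x1(1)]] show ?thesis by metis
qed

text \<open>Associativity, differentiated in the last factor at the identity: left translation carries the
  field to itself, hence solutions of its differential equation to solutions.\<close>

lemma left_field_invariant: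
  assumes "(a, b) \<in> chart_mult_dom"
  shows "frechet_derivative chart_mult (at (a, b)) (0, left_field \<eta> b) = left_field \<eta> (chart_mult (a, b))"
proof -
  have ab: "a \<in> \<phi>1 ` U1" "b \<in> \<phi>1 ` U1" "chart_mult (a, b) \<in> \<phi>1 ` U1"
    using assms chart_mult_mem by (auto simp: chart_mult_dom_iff)
  let ?S = "{c \<in> \<phi>1 ` U1. p b \<otimes> p c \<in> U1 \<and> p a \<otimes> (p b \<otimes> p c) \<in> U1}"
  have "continuous_on UNIV (\<lambda>x. p a \<otimes> (p b \<otimes> x))"
    by (rule continuous_on_compose2[OF mult_left_cont mult_left_cont]) simp
  then have "open {x. p b \<otimes> x \<in> U1}" "open {x. p a \<otimes> (p b \<otimes> x) \<in> U1}"
    using continuous_open_vimage[of U1] chart_open[OF chart1(1)] mult_left_cont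
    by (auto simp: vimage_def continuous_on_eq_continuous_at)
  then have "open {x. p b \<otimes> x \<in> U1 \<and> p a \<otimes> (p b \<otimes> x) \<in> U1}" by (rule open_Collect_conj)
  then have oS: "open ?S" by (rule open_chart_preimage[OF chart1(1)])
  have S: "x1 \<in> ?S" using assms ab by (simp add: x1 p_mem chart_mult_dom_iff)
  have "((\<lambda>c. chart_mult (a, c)) has_derivative (\<lambda>v. frechet_derivative chart_mult (at (a, b)) (0, v))) (at (chart_mult (b, x1)))"
    using chart_mult_snd_has_derivative[OF assms] chart_mult_one ab by simp
  from diff_chain_at[OF left_field_has_derivative[OF ab(2)] this]
  have "((\<lambda>c. chart_mult (a, chart_mult (b, c))) has_derivative
      (\<lambda>v. frechet_derivative chart_mult (at (a, b)) (0, left_field v b))) (at x1)" by (simp add: o_def)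
  then have "((\<lambda>c. chart_mult (chart_mult (a, b), c)) has_derivative
      (\<lambda>v. frechet_derivative chart_mult (at (a, b)) (0, left_field v b))) (at x1)"
  proof (rule has_derivative_transform_within_open[OF _ oS S])
    fix c assume "c \<in> ?S"
    then have "(b, c) \<in> chart_mult_dom" using ab by (simp add: chart_mult_dom_iff)
    then show "chart_mult (a, chart_mult (b, c)) = chart_mult (chart_mult (a, b), c)"
      using p_chart_mult[OF assms] p_chart_mult[of b c] by (simp add: chart_mult_def m_assoc)
  qed
  from has_derivative_unique[OF this left_field_has_derivative[OF ab(3)]] show ?thesis by metis
qed

lemma left_field_Lipschitz:
  obtains \<rho> L where "\<rho> > 0" "L \<ge> 0" "ball x1 \<rho> \<subseteq> \<phi>1 ` U1"
    "\<And>a b. a \<in> ball x1 \<rho> \<Longrightarrow> b \<in> ball x1 \<rho> \<Longrightarrow> norm (left_field \<eta> a - left_field \<eta> b) \<le> L * norm (a - b)"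
proof -
  obtain \<rho> L where "\<rho> > 0" "L \<ge> 0" "ball x1 \<rho> \<subseteq> \<phi>1 ` U1"
    "\<forall>a\<in>ball x1 \<rho>. \<forall>b\<in>ball x1 \<rho>. norm (left_field \<eta> a - left_field \<eta> b) \<le> L * norm (a - b)"
    using smooth_on_locally_Lipschitz[OF fin_dim chart_image_open[OF chart1(1)] x1(1) left_field_smooth[of \<eta>]]
    by blast
  then show thesis using that[of \<rho> L] by blast
qed

lemma chart_mult_near_one:
  assumes "\<rho> > 0"
  obtains r where "r > 0" "\<And>a b. a \<in> ball x1 r \<Longrightarrow> b \<in> ball x1 r \<Longrightarrow> (a, b) \<in> chart_mult_dom \<and> chart_mult (a, b) \<in> ball x1 \<rho>"
proof -
  have z: "(x1, x1) \<in> chart_mult_dom" "chart_mult (x1, x1) = x1" using chart_mult_one[OF x1(1)] by auto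
  have "open (chart_mult_dom \<inter> chart_mult -` ball x1 \<rho>)"
    by (rule continuous_open_preimage[OF smooth_on_imp_continuous_on[OF chart_mult_smooth] open_chart_mult_dom open_ball])
  moreover have "(x1, x1) \<in> chart_mult_dom \<inter> chart_mult -` ball x1 \<rho>" using z assms by simp
  ultimately obtain A B where AB: "open A" "open B" "(x1, x1) \<in> A \<times> B" "A \<times> B \<subseteq> chart_mult_dom \<inter> chart_mult -` ball x1 \<rho>"
    by (rule open_prod_elim)
  then have "open (A \<inter> B)" "x1 \<in> A \<inter> B" by auto
  then obtain r where "r > 0" "ball x1 r \<subseteq> A \<inter> B" using open_contains_ball by blast
  then show thesis using that[of r] AB(4) by fast
qed

text \<open>The solution \<open>x\<close> through the identity is a local one-parameter subgroup: for fixed \<open>s\<close> both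
  \<open>x (s + t)\<close> and the product of \<open>x s\<close> and \<open>x t\<close> solve the equation with value \<open>x s\<close> at 0.\<close>

lemma local_subgroup:
  obtains \<delta> x where "\<delta> > 0" "x 0 = x1"
    "\<And>t. \<bar>t\<bar> \<le> \<delta> \<Longrightarrow> x t \<in> \<phi>1 ` U1 \<and> (x has_vector_derivative left_field \<eta> (x t)) (at t)"
    "\<And>s t. \<bar>s\<bar> \<le> \<delta> \<Longrightarrow> \<bar>t\<bar> \<le> \<delta> \<Longrightarrow> p (x (s + t)) = p (x s) \<otimes> p (x t)"
proof -
  obtain \<rho> L where \<rho>: "\<rho> > 0" "L \<ge> 0" "ball x1 \<rho> \<subseteq> \<phi>1 ` U1"
    and lip: "\<And>a b. a \<in> ball x1 \<rho> \<Longrightarrow> b \<in> ball x1 \<rho> \<Longrightarrow> norm (left_field \<eta> a - left_field \<eta> b) \<le> L * norm (a - b)"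
    using left_field_Lipschitz[of \<eta>] by blast
  obtain \<delta>0 x where x: "\<delta>0 > 0" "x 0 = x1" "\<And>t. t \<in> {-\<delta>0..\<delta>0} \<Longrightarrow> x t \<in> ball x1 \<rho> \<and>
      (x has_vector_derivative left_field \<eta> (x t)) (at t within {-\<delta>0..\<delta>0})"
    using ode_exists[OF fin_dim \<rho>(1,2) lip] by blast
  have xd: "(x has_vector_derivative left_field \<eta> (x t)) (at t)" if "\<bar>t\<bar> < \<delta>0" for t
  proof -
    have "t \<in> {-\<delta>0..\<delta>0}" "-\<delta>0 < t" "t < \<delta>0" using that by auto
    then show ?thesis using x(3)[of t] at_within_Icc_at[of "-\<delta>0" t \<delta>0] by simp
  qed
  obtain r where r: "r > 0" "\<And>a b. a \<in> ball x1 r \<Longrightarrow> b \<in> ball x1 r \<Longrightarrow> (a, b) \<in> chart_mult_dom \<and> chart_mult (a, b) \<in> ball x1 \<rho>"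
    using chart_mult_near_one[OF \<rho>(1)] by blast
  have "isCont x 0" using xd[of 0] x(1) has_vector_derivative_continuous by auto
  then obtain d where "d > 0" "\<forall>t. dist t 0 < d \<longrightarrow> dist (x t) (x 0) < r"
    using r(1) unfolding continuous_at_eps_delta by blast
  then have d: "d > 0" "\<And>t. \<bar>t\<bar> < d \<Longrightarrow> x t \<in> ball x1 r"
    using x(2) by (auto simp: dist_commute dist_real_def)
  \<comment> \<open>Sums of two times bounded by \<open>\<delta>\<close> must stay strictly inside the interval of existence.\<close>
  define \<delta> where "\<delta> = min (\<delta>0 / 3) (min (d / 2) (1 / (2 * (L + 1))))"
  have \<delta>: "\<delta> > 0" "2 * \<delta> < \<delta>0" "\<delta> < d" using x(1) d(1) \<rho>(2) by (auto simp: \<delta>_def)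
  have "\<delta> * L \<le> 1 / (2 * (L + 1)) * (L + 1)" using \<delta>(1) \<rho>(2) by (intro mult_mono) (auto simp: \<delta>_def)
  also have "\<dots> = 1/2" using \<rho>(2) by (simp add: field_simps)
  finally have \<delta>L: "\<delta> * L < 1" by simp
  have xb: "x t \<in> ball x1 r" if "\<bar>t\<bar> \<le> \<delta>" for t using d(2)[of t] \<delta>(3) that by simp
  have hom: "x (s + t) = chart_mult (x s, x t)" if s: "\<bar>s\<bar> \<le> \<delta>" and t: "\<bar>t\<bar> \<le> \<delta>" for s t
  proof (rule ode_unique[OF \<delta>(1) \<rho>(2) \<delta>L lip, where x="\<lambda>t. x (s + t)" and y="\<lambda>t. chart_mult (x s, x t)"])
    fix u assume u: "u \<in> {-\<delta>..\<delta>}"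
    then have su: "\<bar>s + u\<bar> < \<delta>0" "\<bar>u\<bar> < \<delta>0" "\<bar>u\<bar> \<le> \<delta>" using s \<delta> by auto
    have "((\<lambda>t. s + t) has_vector_derivative 1) (at u)" by (auto intro!: derivative_eq_intros)
    from vector_diff_chain_at[OF this xd[OF su(1)]]
    have "((\<lambda>t. x (s + t)) has_vector_derivative left_field \<eta> (x (s + u))) (at u)" by (simp add: o_def)
    then show "x (s + u) \<in> ball x1 \<rho> \<and>
        ((\<lambda>t. x (s + t)) has_vector_derivative left_field \<eta> (x (s + u))) (at u within {-\<delta>..\<delta>})"
      using x(3)[of "s + u"] su(1) by (simp add: abs_less_iff has_vector_derivative_at_within)
    have D: "(x s, x u) \<in> chart_mult_dom" "chart_mult (x s, x u) \<in> ball x1 \<rho>" using r(2) xb s su by auto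
    have "((\<lambda>t. chart_mult (x s, x t)) has_vector_derivative
        frechet_derivative chart_mult (at (x s, x u)) (0, left_field \<eta> (x u))) (at u)"
      using vector_derivative_diff_chain_within[OF xd[OF su(2)]
          has_derivative_at_withinI[OF chart_mult_snd_has_derivative[OF D(1)]]] by (simp add: o_def)
    then show "chart_mult (x s, x u) \<in> ball x1 \<rho> \<and> ((\<lambda>t. chart_mult (x s, x t)) has_vector_derivative
        left_field \<eta> (chart_mult (x s, x u))) (at u within {-\<delta>..\<delta>})"
      using D left_field_invariant[OF D(1)] has_vector_derivative_at_within by auto
  next
    have "s \<in> {-\<delta>0..\<delta>0}" using s \<delta> by auto
    then have "x s \<in> \<phi>1 ` U1" using x(3)[of s] \<rho>(3) by blast
    then show "x (s + 0) = chart_mult (x s, x 0)" by (simp add: x(2) chart_mult_one)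
  qed (use t in auto)
  show thesis
  proof (rule that[of \<delta> x])
    show "\<delta> > 0" "x 0 = x1" by fact+
    show "x t \<in> \<phi>1 ` U1 \<and> (x has_vector_derivative left_field \<eta> (x t)) (at t)" if "\<bar>t\<bar> \<le> \<delta>" for t
    proof -
      have "t \<in> {-\<delta>0..\<delta>0}" "\<bar>t\<bar> < \<delta>0" using that \<delta> by auto
      then show ?thesis using xd[of t] x(3)[of t] \<rho>(3) by blast
    qed
    show "p (x (s + t)) = p (x s) \<otimes> p (x t)" if "\<bar>s\<bar> \<le> \<delta>" "\<bar>t\<bar> \<le> \<delta>" for s t
      using hom[OF that] p_chart_mult[of "x s" "x t"] r(2) xb that by simp
  qed
qed

lemma small_steps:
  assumes "(\<delta>::real) > 0"
  obtains n :: nat where "n > 0" "\<bar>t / n\<bar> \<le> \<delta>" "\<bar>s / n\<bar> \<le> \<delta>"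
proof -
  obtain n :: nat where n: "(\<bar>t\<bar> + \<bar>s\<bar>) / \<delta> < n" using reals_Archimedean2 by blast
  moreover have "0 \<le> (\<bar>t\<bar> + \<bar>s\<bar>) / \<delta>" using assms by simp
  ultimately have "n > 0" by (cases n) auto
  moreover have "\<bar>t\<bar> + \<bar>s\<bar> < \<delta> * n" using n assms by (simp add: pos_divide_less_eq mult.commute)
  ultimately show thesis using that[of n] by (simp add: abs_divide pos_divide_le_eq)
qed

lemma hom_zero:
  assumes "\<And>s t::real. \<bar>s\<bar> \<le> \<delta> \<Longrightarrow> \<bar>t\<bar> \<le> \<delta> \<Longrightarrow> g (s + t) = g s \<otimes> g t" "\<delta> \<ge> 0"
  shows "g 0 = \<one>"
proof -
  have "g 0 \<otimes> g 0 = g 0" using assms(1)[of 0 0] assms(2) by simp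
  then show ?thesis using l_cancel_one[of "g 0" "g 0"] by simp
qed

text \<open>Put \<open>\<gamma> t = g (t / n)^n\<close> for any \<open>n\<close> that makes \<open>t / n\<close> small; refining both subdivisions to a
  common one shows that \<open>n\<close> does not matter, and \<open>g (s / n)\<close> and \<open>g (t / n)\<close> commute.\<close>

lemma local_hom_extends:
  fixes g :: "real \<Rightarrow> 'g"
  assumes "\<delta> > 0" and g: "\<And>s t. \<bar>s\<bar> \<le> \<delta> \<Longrightarrow> \<bar>t\<bar> \<le> \<delta> \<Longrightarrow> g (s + t) = g s \<otimes> g t"
  shows "\<exists>\<gamma>. (\<forall>s t. \<gamma> (s + t) = \<gamma> s \<otimes> \<gamma> t) \<and> (\<forall>t. \<bar>t\<bar> \<le> \<delta> \<longrightarrow> \<gamma> t = g t)"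
proof -
  have g0: "g 0 = \<one>" using hom_zero[OF g] assms by simp
  have pow: "g (real k * u) = g u [^] k" if "\<bar>real k * u\<bar> \<le> \<delta>" for k u
    using that
  proof (induction k)
    case 0
    then show ?case by (simp add: g0)
  next
    case (Suc k)
    have "\<bar>real k * u\<bar> \<le> \<bar>real (Suc k) * u\<bar>" "\<bar>u\<bar> \<le> \<bar>real (Suc k) * u\<bar>"
      unfolding abs_mult using mult_right_mono[of 1 "real (Suc k)" "\<bar>u\<bar>"] by (auto intro!: mult_right_mono)
    then have le: "\<bar>real k * u\<bar> \<le> \<delta>" "\<bar>u\<bar> \<le> \<delta>" using Suc.prems by linarith+
    have "g (real (Suc k) * u) = g (real k * u + u)" by (simp add: algebra_simps)
    also have "\<dots> = g u [^] Suc k" using g[OF le] Suc.IH[OF le(1)] by simp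
    finally show ?case .
  qed
  have refine: "g (t / n) [^] n = g (t / (n * k)) [^] (n * k)"
    if "n > 0" "k > 0" "\<bar>t / n\<bar> \<le> \<delta>" for n k :: nat and t
  proof -
    have "t / n = real k * (t / (n * k))" using that by simp
    then have "g (t / n) = g (t / (n * k)) [^] k" using pow[of k "t / (n * k)"] that by simp
    then show ?thesis by (simp add: nat_pow_pow mult.commute)
  qed
  have indep: "g (t / n) [^] n = g (t / k) [^] k"
    if "n > 0" "k > 0" "\<bar>t / n\<bar> \<le> \<delta>" "\<bar>t / k\<bar> \<le> \<delta>" for n k :: nat and t
    using refine[of n k t] refine[of k n t] that by (simp add: mult.commute)
  define N where "N t = (SOME n::nat. (0::nat) < n \<and> \<bar>t / n\<bar> \<le> \<delta>)" for t
  have N: "N t > 0" "\<bar>t / N t\<bar> \<le> \<delta>" for t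
  proof -
    obtain n :: nat where "n > 0" "\<bar>t / n\<bar> \<le> \<delta>" by (rule small_steps[OF assms(1), of t t])
    then have "\<exists>n::nat. (0::nat) < n \<and> \<bar>t / n\<bar> \<le> \<delta>" by blast
    from someI_ex[OF this] show "N t > 0" "\<bar>t / N t\<bar> \<le> \<delta>" unfolding N_def by auto
  qed
  define \<gamma> where "\<gamma> t = g (t / N t) [^] N t" for t
  have \<gamma>: "\<gamma> t = g (t / n) [^] n" if "n > 0" "\<bar>t / n\<bar> \<le> \<delta>" for n :: nat and t
    unfolding \<gamma>_def using indep[OF N(1) that(1) N(2) that(2)] .
  show ?thesis
  proof (intro exI[of _ \<gamma>] conjI allI impI)
    fix s t :: real
    obtain n :: nat where n: "n > 0" "\<bar>t / n\<bar> \<le> \<delta> / 2" "\<bar>s / n\<bar> \<le> \<delta> / 2"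
      by (rule small_steps[of "\<delta> / 2" t s]) (use assms(1) in auto)
    have n': "\<bar>t / n\<bar> \<le> \<delta>" "\<bar>s / n\<bar> \<le> \<delta>" "\<bar>(s + t) / n\<bar> \<le> \<delta>"
      using n(2,3) assms(1) unfolding add_divide_distrib by linarith+
    have "g (s / n) \<otimes> g (t / n) = g (t / n) \<otimes> g (s / n)"
      using g[OF n'(1,2)] g[OF n'(2,1)] by (simp add: add.commute)
    then have "(g (s / n) \<otimes> g (t / n)) [^] n = g (s / n) [^] n \<otimes> g (t / n) [^] n"
      by (intro pow_mult_distrib) auto
    moreover have "g ((s + t) / n) = g (s / n) \<otimes> g (t / n)"
      using g[OF n'(2,1)] by (simp add: add_divide_distrib)
    ultimately show "\<gamma> (s + t) = \<gamma> s \<otimes> \<gamma> t" using \<gamma>[OF n(1)] n' by simp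
  next
    fix t assume "\<bar>t\<bar> \<le> \<delta>"
    then show "\<gamma> t = g t" using \<gamma>[of 1 t] by simp
  qed
qed

lemma hom_pow:
  assumes "\<And>s t::real. \<gamma> (s + t) = \<gamma> s \<otimes> \<gamma> t"
  shows "\<gamma> (real n * t) = \<gamma> t [^] n"
proof (induction n)
  case 0
  then show ?case using hom_zero[of 1 \<gamma>] assms by simp
next
  case (Suc n)
  have "\<gamma> (real (Suc n) * t) = \<gamma> (real n * t + t)" by (simp add: algebra_simps)
  then show ?case using assms Suc by simp
qed

definition "generated_by \<gamma> \<eta> \<longleftrightarrow> one_param_subgroup G \<gamma> \<and> ((\<phi>1 \<circ> \<gamma>) has_vector_derivative \<eta>) (at 0)"

lemma one_param_subgroup_exists: "\<exists>\<gamma>. generated_by \<gamma> \<eta>"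
proof -
  obtain \<delta> x where \<delta>: "\<delta> > 0" and x: "x 0 = x1"
    "\<And>t. \<bar>t\<bar> \<le> \<delta> \<Longrightarrow> x t \<in> \<phi>1 ` U1 \<and> (x has_vector_derivative left_field \<eta> (x t)) (at t)"
    "\<And>s t. \<bar>s\<bar> \<le> \<delta> \<Longrightarrow> \<bar>t\<bar> \<le> \<delta> \<Longrightarrow> p (x (s + t)) = p (x s) \<otimes> p (x t)"
    using local_subgroup[of \<eta>] by blast
  obtain \<gamma> where \<gamma>: "\<And>s t. \<gamma> (s + t) = \<gamma> s \<otimes> \<gamma> t" "\<And>t. \<bar>t\<bar> \<le> \<delta> \<Longrightarrow> \<gamma> t = p (x t)"
    using local_hom_extends[of \<delta> "\<lambda>t. p (x t)", OF \<delta> x(3)] by blast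
  define I where "I = {-\<delta><..<\<delta>}"
  have I: "open I" "0 \<in> I" "\<And>t. t \<in> I \<Longrightarrow> \<bar>t\<bar> \<le> \<delta>" using \<delta> by (auto simp: I_def)
  have x_in: "x ` I \<subseteq> \<phi>1 ` U1" using x(2) I(3) by blast
  \<comment> \<open>The equation \<open>x' = left_field \<eta> x\<close> gains one derivative at a time.\<close>
  have Ck: "Ck_on k I x" for k
  proof (induction k)
    case 0
    have "isCont x t" if "t \<in> I" for t
      using x(2)[OF I(3)[OF that]] has_vector_derivative_continuous by blast
    then show ?case by (simp add: continuous_at_imp_continuous_on)
  next
    case (Suc k)
    show ?case
    proof (rule Ck_on_SucI[OF I(1)])
      show "(x has_derivative (\<lambda>v. v *\<^sub>R left_field \<eta> (x t))) (at t)" if "t \<in> I" for t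
        using x(2)[OF I(3)[OF that]] by (simp add: has_vector_derivative_def)
      fix v
      have "Ck_on k (\<phi>1 ` U1) (left_field \<eta>)" using left_field_smooth by (simp add: smooth_on_def)
      from Ck_on_compose[OF fin_dim I(1) Suc this x_in]
      show "Ck_on k I (\<lambda>t. v *\<^sub>R left_field \<eta> (x t))"
        by (rule Ck_on_linear_compose[OF I(1) bounded_linear_scaleR_right])
    qed
  qed
  then have smooth_x: "smooth_on I x" by (simp add: smooth_on_def)
  have shift: "\<gamma> t = \<gamma> t0 \<otimes> p (x (t - t0))" if "t - t0 \<in> I" for t t0
    using \<gamma>(1)[of t0 "t - t0"] \<gamma>(2)[OF I(3)[OF that]] by simp
  have oI: "open {t. t - t0 \<in> I}" for t0
    using open_vimage[OF I(1), of "\<lambda>t. t - t0"] by (simp add: vimage_def continuous_intros)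
  have cont: "isCont \<gamma> t0" for t0
  proof -
    have "continuous_on {t. t - t0 \<in> I} (\<lambda>t. p (x (t - t0)))"
      using x_in by (intro continuous_on_compose2[OF chart_inv_cont[OF chart1(1)]]
          continuous_on_compose2[OF smooth_on_imp_continuous_on[OF smooth_x]] continuous_intros) auto
    then have "continuous_on {t. t - t0 \<in> I} (\<lambda>t. \<gamma> t0 \<otimes> p (x (t - t0)))"
      by (rule continuous_on_compose2[OF mult_left_cont]) auto
    then have "continuous_on {t. t - t0 \<in> I} \<gamma>"
      by (rule continuous_on_eq) (auto simp: shift[symmetric])
    then show ?thesis using oI[of t0] I(2) continuous_on_eq_continuous_at[of "{t. t - t0 \<in> I}" \<gamma>] by auto
  qed
  have "open (\<gamma> -` U) \<and> smooth_on (\<gamma> -` U) (\<phi> \<circ> \<gamma>)" if ch: "(U, \<phi>) \<in> atlas G" for U \<phi>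
  proof
    show o: "open (\<gamma> -` U)"
      using continuous_open_vimage[OF chart_open[OF ch], of \<gamma>] cont by blast
    show "smooth_on (\<gamma> -` U) (\<phi> \<circ> \<gamma>)"
    proof (rule smooth_on_local)
      fix t0 assume t0: "t0 \<in> \<gamma> -` U"
      let ?T = "{t. t - t0 \<in> I} \<inter> \<gamma> -` U"
      have oT: "open ?T" using oI o by blast
      have "smooth_on ?T (\<lambda>t. t - t0)"
        using smooth_on_add[OF oT smooth_on_linear[OF oT bounded_linear_ident] smooth_on_const[OF oT, of "- t0"]]
        by simp
      from smooth_on_compose[OF finite_dim_real oT this smooth_x]
      have "smooth_on ?T (\<lambda>t. x (t - t0))" by auto
      moreover have "(\<lambda>t. x (t - t0)) ` ?T \<subseteq> {a \<in> \<phi>1 ` U1. \<gamma> t0 \<otimes> p a \<in> U}"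
        using x_in by (auto simp: shift[symmetric])
      ultimately have "smooth_on ?T (\<lambda>t. \<phi> (\<gamma> t0 \<otimes> p (x (t - t0))))"
        using smooth_on_compose[OF fin_dim oT _ mult_left_smooth[OF chart1(1) ch]] by blast
      then have "smooth_on ?T (\<phi> \<circ> \<gamma>)"
        by (rule smooth_on_cong[OF oT, rotated]) (auto simp: shift[symmetric])
      then show "\<exists>T. open T \<and> t0 \<in> T \<and> smooth_on T (\<phi> \<circ> \<gamma>)" using oT t0 I(2) by (intro exI[of _ ?T]) auto
    qed
  qed
  moreover have "((\<phi>1 \<circ> \<gamma>) has_vector_derivative \<eta>) (at 0)"
  proof -
    have "(x has_vector_derivative \<eta>) (at 0)" using x(1) x(2)[of 0] \<delta> by (simp add: left_field_one)
    then show ?thesis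
    proof (rule has_vector_derivative_transform_within_open[OF _ I(1,2)])
      fix t assume "t \<in> I"
      then show "x t = (\<phi>1 \<circ> \<gamma>) t"
        using x(2)[OF I(3)] \<gamma>(2)[OF I(3)] chart_inv_right[of "x t" \<phi>1 U1] by simp
    qed
  qed
  ultimately show ?thesis
    using \<gamma>(1) by (intro exI[of _ \<gamma>]) (auto simp: generated_by_def one_param_subgroup_def)
qed

lemma generated_hom: "generated_by \<gamma> \<eta> \<Longrightarrow> \<gamma> (s + t) = \<gamma> s \<otimes> \<gamma> t"
  unfolding generated_by_def one_param_subgroup_def by blast

lemma generated_zero: "generated_by \<gamma> \<eta> \<Longrightarrow> \<gamma> 0 = \<one>"
  using hom_zero[of 1 \<gamma>] generated_hom by simp

lemma generated_chart:
  assumes "generated_by \<gamma> \<eta>" "(U, \<phi>) \<in> atlas G"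
  shows "open (\<gamma> -` U)" "smooth_on (\<gamma> -` U) (\<phi> \<circ> \<gamma>)"
  using assms unfolding generated_by_def one_param_subgroup_def by blast+

text \<open>Differentiating \<open>\<gamma> (t + s) = \<gamma> t \<gamma> s\<close> at \<open>s = 0\<close>.\<close>

lemma generated_ode:
  assumes "generated_by \<gamma> \<eta>" "\<gamma> t \<in> U1"
  shows "((\<phi>1 \<circ> \<gamma>) has_vector_derivative left_field \<eta> (\<phi>1 (\<gamma> t))) (at t)"
proof -
  let ?x = "\<phi>1 \<circ> \<gamma>"
  have xt: "?x t \<in> \<phi>1 ` U1" using assms(2) by simp
  have "(?x has_vector_derivative \<eta>) (at (t - t))" using assms(1) by (simp add: generated_by_def)
  moreover have "((\<lambda>u. u - t) has_vector_derivative 1) (at t)" by (auto intro!: derivative_eq_intros)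
  ultimately have "((\<lambda>u. ?x (u - t)) has_vector_derivative \<eta>) (at t)"
    using vector_diff_chain_at[of "\<lambda>u. u - t" 1 t ?x \<eta>] by (simp add: o_def)
  moreover have "((\<lambda>c. chart_mult (?x t, c)) has_derivative (\<lambda>v. left_field v (?x t))) (at (?x (t - t)))"
    using left_field_has_derivative[OF xt] generated_zero[OF assms(1)] by (simp add: x1_def)
  ultimately have *: "((\<lambda>u. chart_mult (?x t, ?x (u - t))) has_vector_derivative left_field \<eta> (?x t)) (at t)"
    using vector_derivative_diff_chain_within[of "\<lambda>u. ?x (u - t)" \<eta> t UNIV "\<lambda>c. chart_mult (?x t, c)" "\<lambda>v. left_field v (?x t)"]
    by (simp add: o_def has_derivative_at_withinI)
  have o: "open (\<gamma> -` U1)" using generated_chart[OF assms(1) chart1(1)] by blast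
  have oS: "open ((\<lambda>u. u - t) -` (\<gamma> -` U1))"
    by (rule open_vimage[OF o]) (intro continuous_intros)
  have "((\<phi>1 \<circ> \<gamma>) has_vector_derivative left_field \<eta> (?x t)) (at t)"
  proof (rule has_vector_derivative_transform_within_open[OF * oS])
    show "t \<in> (\<lambda>u. u - t) -` (\<gamma> -` U1)" using generated_zero[OF assms(1)] chart1 by simp
    fix u assume "u \<in> (\<lambda>u. u - t) -` (\<gamma> -` U1)"
    then show "chart_mult (?x t, ?x (u - t)) = (\<phi>1 \<circ> \<gamma>) u"
      using generated_hom[OF assms(1), of t "u - t"] assms(2) by (simp add: chart_mult_def chart_inv[OF chart1(1)])
  qed
  then show ?thesis by simp
qed

lemma generated_unique:
  assumes "generated_by \<gamma> \<eta>" "generated_by \<beta> \<eta>"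
  shows "\<gamma> = \<beta>"
proof -
  obtain \<rho> L where \<rho>: "\<rho> > 0" "L \<ge> 0" "ball x1 \<rho> \<subseteq> \<phi>1 ` U1"
    and lip: "\<And>a b. a \<in> ball x1 \<rho> \<Longrightarrow> b \<in> ball x1 \<rho> \<Longrightarrow> norm (left_field \<eta> a - left_field \<eta> b) \<le> L * norm (a - b)"
    using left_field_Lipschitz[of \<eta>] by blast
  have near: "\<exists>d>0. \<forall>t. \<bar>t\<bar> < d \<longrightarrow> \<gamma> t \<in> U1 \<and> \<phi>1 (\<gamma> t) \<in> ball x1 \<rho>" if gen: "generated_by \<gamma> \<eta>" for \<gamma>
  proof -
    let ?S = "\<gamma> -` U1 \<inter> (\<phi>1 \<circ> \<gamma>) -` ball x1 \<rho>"
    have "open ?S"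
      using generated_chart[OF gen chart1(1)]
      by (intro continuous_open_preimage smooth_on_imp_continuous_on) auto
    moreover have "0 \<in> ?S" using generated_zero[OF gen] chart1 \<rho>(1) by (simp add: x1_def)
    ultimately obtain d where "d > 0" "ball 0 d \<subseteq> ?S" using open_contains_ball by blast
    then show ?thesis by (intro exI[of _ d]) (auto simp: subset_eq dist_real_def)
  qed
  obtain d where d: "d > 0" "\<And>t. \<bar>t\<bar> < d \<Longrightarrow> \<gamma> t \<in> U1 \<and> \<phi>1 (\<gamma> t) \<in> ball x1 \<rho>"
    using near[OF assms(1)] by blast
  obtain d' where d': "d' > 0" "\<And>t. \<bar>t\<bar> < d' \<Longrightarrow> \<beta> t \<in> U1 \<and> \<phi>1 (\<beta> t) \<in> ball x1 \<rho>"
    using near[OF assms(2)] by blast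
  define \<delta> where "\<delta> = min (d / 2) (min (d' / 2) (1 / (2 * (L + 1))))"
  have \<delta>: "\<delta> > 0" "\<delta> < d" "\<delta> < d'" using d(1) d'(1) \<rho>(2) by (auto simp: \<delta>_def)
  have "\<delta> * L \<le> 1 / (2 * (L + 1)) * (L + 1)" using \<delta>(1) \<rho>(2) by (intro mult_mono) (auto simp: \<delta>_def)
  also have "\<dots> = 1/2" using \<rho>(2) by (simp add: field_simps)
  finally have \<delta>L: "\<delta> * L < 1" by simp
  have local: "\<gamma> t = \<beta> t" if t: "\<bar>t\<bar> \<le> \<delta>" for t
  proof -
    have "(\<phi>1 \<circ> \<gamma>) t = (\<phi>1 \<circ> \<beta>) t"
    proof (rule ode_unique[OF \<delta>(1) \<rho>(2) \<delta>L lip])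
      fix u assume u: "u \<in> {-\<delta>..\<delta>}"
      show "(\<phi>1 \<circ> \<gamma>) u \<in> ball x1 \<rho> \<and>
          ((\<phi>1 \<circ> \<gamma>) has_vector_derivative left_field \<eta> ((\<phi>1 \<circ> \<gamma>) u)) (at u within {-\<delta>..\<delta>})"
        using d(2)[of u] u \<delta> generated_ode[OF assms(1), of u] by (auto intro: has_vector_derivative_at_within)
      show "(\<phi>1 \<circ> \<beta>) u \<in> ball x1 \<rho> \<and>
          ((\<phi>1 \<circ> \<beta>) has_vector_derivative left_field \<eta> ((\<phi>1 \<circ> \<beta>) u)) (at u within {-\<delta>..\<delta>})"
        using d'(2)[of u] u \<delta> generated_ode[OF assms(2), of u] by (auto intro: has_vector_derivative_at_within)
    qed (use t generated_zero[OF assms(1)] generated_zero[OF assms(2)] in auto)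
    then have "\<phi>1 (\<gamma> t) = \<phi>1 (\<beta> t)" by simp
    moreover have "\<gamma> t \<in> U1" "\<beta> t \<in> U1" using d(2)[of t] d'(2)[of t] t \<delta> by auto
    ultimately show ?thesis using chart_inv[OF chart1(1)] by metis
  qed
  show ?thesis
  proof
    fix t
    obtain n :: nat where n: "n > 0" "\<bar>t / n\<bar> \<le> \<delta>" by (rule small_steps[OF \<delta>(1), of t t])
    have "\<gamma> (real n * (t / n)) = \<beta> (real n * (t / n))"
      using hom_pow[of \<gamma> n "t / n"] hom_pow[of \<beta> n "t / n"] generated_hom assms local[OF n(2)] by metis
    then show "\<gamma> t = \<beta> t" using n(1) by simp
  qed
qed

lemma generated_scale:
  assumes "generated_by \<gamma> \<eta>"
  shows "generated_by (\<lambda>s. \<gamma> (t * s)) (t *\<^sub>R \<eta>)"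
proof -
  have bl: "bounded_linear (\<lambda>s::real. t * s)" by (rule bounded_linear_mult_right)
  have "open ((\<lambda>s. \<gamma> (t * s)) -` U) \<and> smooth_on ((\<lambda>s. \<gamma> (t * s)) -` U) (\<phi> \<circ> (\<lambda>s. \<gamma> (t * s)))"
    if ch: "(U, \<phi>) \<in> atlas G" for U \<phi>
  proof
    have eq: "(\<lambda>s. \<gamma> (t * s)) -` U = (\<lambda>s. t * s) -` (\<gamma> -` U)" by auto
    show o: "open ((\<lambda>s. \<gamma> (t * s)) -` U)"
      unfolding eq by (rule open_vimage[OF generated_chart(1)[OF assms ch]]) (intro continuous_intros)
    from smooth_on_compose[OF finite_dim_real o smooth_on_linear[OF o bl] generated_chart(2)[OF assms ch]]
    show "smooth_on ((\<lambda>s. \<gamma> (t * s)) -` U) (\<phi> \<circ> (\<lambda>s. \<gamma> (t * s)))" by (auto simp: o_def)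
  qed
  moreover have "((\<phi>1 \<circ> (\<lambda>s. \<gamma> (t * s))) has_vector_derivative t *\<^sub>R \<eta>) (at 0)"
  proof -
    have "((\<lambda>s. t * s) has_vector_derivative t) (at 0)" by (auto intro!: derivative_eq_intros)
    from vector_diff_chain_at[OF this, of "\<phi>1 \<circ> \<gamma>" \<eta>] assms
    show ?thesis by (simp add: generated_by_def o_def)
  qed
  ultimately show ?thesis
    using generated_hom[OF assms] unfolding generated_by_def one_param_subgroup_def
    by (auto simp: distrib_left)
qed

text \<open>The definite description in \<open>lie_exp\<close> denotes something because one-parameter subgroups exist and
  are determined by their velocity.\<close>

lemma lie_exp_eq:
  assumes "generated_by \<gamma> \<eta>"
  shows "lie_exp G (t *\<^sub>R \<eta>) = \<gamma> t"
proof -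
  have "lie_exp G (t *\<^sub>R \<eta>) = (THE g. \<exists>\<gamma>. generated_by \<gamma> (t *\<^sub>R \<eta>) \<and> g = \<gamma> 1)"
    by (simp add: lie_exp_def generated_by_def one_chart_eq conj_assoc)
  also have "\<dots> = \<gamma> t"
  proof (rule the_equality)
    show "\<exists>\<beta>. generated_by \<beta> (t *\<^sub>R \<eta>) \<and> \<gamma> t = \<beta> 1"
      using generated_scale[OF assms, of t] by force
    fix g assume "\<exists>\<beta>. generated_by \<beta> (t *\<^sub>R \<eta>) \<and> g = \<beta> 1"
    then obtain \<beta> where \<beta>: "generated_by \<beta> (t *\<^sub>R \<eta>)" "g = \<beta> 1" by blast
    show "g = \<gamma> t" using generated_unique[OF \<beta>(1) generated_scale[OF assms]] \<beta>(2) by simp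
  qed
  finally show ?thesis .
qed

text \<open>The existence of one-parameter subgroups is what makes differentiation along \<open>lie_exp\<close> meaningful,
  hence linear in the function.\<close>

lemma differentiable_along_lie_exp:
  assumes "open W" "smooth_on_group G W F" "g \<in> W"
  shows "(\<lambda>t. F (lie_exp G (t *\<^sub>R \<eta>) \<otimes> g)) differentiable (at 0)"
proof -
  obtain \<gamma> where \<gamma>: "generated_by \<gamma> \<eta>" using one_param_subgroup_exists by blast
  obtain U \<phi> where ch: "(U, \<phi>) \<in> atlas G" "g \<in> U" by (rule chart_ex)
  let ?x = "\<phi>1 \<circ> \<gamma>" and ?R = "\<lambda>a. \<phi> (p a \<otimes> g)" and ?F = "F \<circ> inv_into U \<phi>"
  have x0: "?x 0 = x1" using generated_zero[OF \<gamma>] by (simp add: x1_def)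
  have "?x differentiable (at 0)" using \<gamma> by (auto simp: generated_by_def has_vector_derivative_def differentiable_def)
  moreover have "?R differentiable (at (?x 0))" unfolding x0
    by (rule smooth_on_differentiable[OF mult_right_smooth[OF chart1(1) ch(1)]]) (use x1 ch in simp)
  ultimately have "(?R \<circ> ?x) differentiable (at 0)" by (rule differentiable_chain_at)
  moreover have "?F differentiable (at ((?R \<circ> ?x) 0))"
  proof (rule smooth_on_differentiable)
    show "smooth_on (\<phi> ` (U \<inter> W)) ?F" using assms(2) ch(1) by (auto simp: smooth_on_group_def)
    show "(?R \<circ> ?x) 0 \<in> \<phi> ` (U \<inter> W)" using x0 ch(2) assms(3) by (simp add: x1)
  qed
  ultimately have "(?F \<circ> (?R \<circ> ?x)) differentiable (at 0)" by (rule differentiable_chain_at)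
  then obtain D where D: "((?F \<circ> (?R \<circ> ?x)) has_derivative D) (at 0)" by (auto simp: differentiable_def)
  let ?S = "(\<gamma> -` U1) \<inter> ?x -` {a \<in> \<phi>1 ` U1. p a \<otimes> g \<in> U}"
  have "open {x. x \<otimes> g \<in> U}"
    using continuous_open_vimage[of U "\<lambda>x. x \<otimes> g"] mult_right_isCont chart_open[OF ch(1)] by (auto simp: vimage_def)
  then have "open {a \<in> \<phi>1 ` U1. p a \<otimes> g \<in> U}" by (rule open_chart_preimage[OF chart1(1)])
  then have oS: "open ?S"
    using generated_chart[OF \<gamma> chart1(1)] by (intro continuous_open_preimage smooth_on_imp_continuous_on) auto
  have "((\<lambda>t. F (lie_exp G (t *\<^sub>R \<eta>) \<otimes> g)) has_derivative D) (at 0)"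
  proof (rule has_derivative_transform_within_open[OF D oS])
    show "0 \<in> ?S" using generated_zero[OF \<gamma>] chart1 ch by (simp add: chart_inv[OF chart1(1)])
    fix t assume "t \<in> ?S"
    then have "\<gamma> t \<in> U1" "\<gamma> t \<otimes> g \<in> U" using chart_inv[OF chart1(1), of "\<gamma> t"] by auto
    then show "(?F \<circ> (?R \<circ> ?x)) t = F (lie_exp G (t *\<^sub>R \<eta>) \<otimes> g)"
      by (simp add: lie_exp_eq[OF \<gamma>] chart_inv[OF chart1(1)] chart_inv[OF ch(1)])
  qed
  then show ?thesis by (auto simp: differentiable_def)
qed

end

section \<open>Unitary operators with a trace\<close>

text \<open>Gaussian elimination of one equation together with one unknown.\<close>

lemma homogeneous_system_nontrivial:
  fixes a :: "'f \<Rightarrow> 'u \<Rightarrow> 'k::field"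
  assumes "finite F" "finite U" "card F < card U"
  shows "\<exists>c. (\<exists>u\<in>U. c u \<noteq> 0) \<and> (\<forall>f\<in>F. (\<Sum>u\<in>U. c u * a f u) = 0)"
  using assms
proof (induction F arbitrary: U a rule: finite_induct)
  case empty
  then obtain p where "p \<in> U" by fastforce
  then show ?case by (intro exI[of _ "\<lambda>_. 1"]) auto
next
  case (insert f F)
  show ?case
  proof (cases "\<forall>u\<in>U. a f u = 0")
    case True
    from insert.IH[of U a] insert.prems insert.hyps
    obtain c where c: "\<exists>u\<in>U. c u \<noteq> 0" "\<forall>g\<in>F. (\<Sum>u\<in>U. c u * a g u) = 0" by auto
    then show ?thesis using True by (intro exI[of _ c]) auto
  next
    case False
    then obtain p where p: "p \<in> U" "a f p \<noteq> 0" by blast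
    define U' where "U' = U - {p}"
    have U: "U = insert p U'" "p \<notin> U'" "finite U'" using p insert.prems by (auto simp: U'_def)
    have "card F < card U'" using insert.prems insert.hyps U by simp
    from insert.IH[OF \<open>finite U'\<close> this, of "\<lambda>g u. a g u - a g p * a f u / a f p"]
    obtain c where c: "\<exists>u\<in>U'. c u \<noteq> 0"
      "\<And>g. g \<in> F \<Longrightarrow> (\<Sum>u\<in>U'. c u * (a g u - a g p * a f u / a f p)) = 0" by blast
    define s where "s = (\<Sum>u\<in>U'. c u * a f u)"
    define d where "d = c(p := - s / a f p)"
    have d: "(\<Sum>u\<in>U. d u * a g u) = - s / a f p * a g p + (\<Sum>u\<in>U'. c u * a g u)" for g
    proof -
      have "(\<Sum>u\<in>U'. d u * a g u) = (\<Sum>u\<in>U'. c u * a g u)"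
        using U by (intro sum.cong) (auto simp: d_def)
      then show ?thesis using U by (simp add: d_def)
    qed
    have "(\<Sum>u\<in>U. d u * a g u) = 0" if "g \<in> F" for g
    proof -
      have "(\<Sum>u\<in>U'. c u * a g u) - (a g p / a f p) * s = 0"
        using c(2)[OF that] by (simp add: algebra_simps sum_subtractf sum_distrib_left s_def)
      then show ?thesis using d[of g] by (simp add: mult.commute)
    qed
    moreover have "(\<Sum>u\<in>U. d u * a f u) = 0" using d[of f] p by (simp add: s_def)
    moreover have "\<exists>u\<in>U. d u \<noteq> 0" using c(1) U by (auto simp: d_def)
    ultimately show ?thesis by blast
  qed
qed

text \<open>Sections form a subset of a function type, so the space is given by a carrier with explicit
  operations; these enter only through their effect on inner products.\<close>

locale semi_inner_space =
  fixes H :: "'v set" and plus :: "'v \<Rightarrow> 'v \<Rightarrow> 'v" (infixl "\<oplus>" 65)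
    and scale :: "complex \<Rightarrow> 'v \<Rightarrow> 'v" (infixr "\<odot>" 75)
    and zero :: 'v and ip :: "'v \<Rightarrow> 'v \<Rightarrow> complex"
  assumes zero_mem: "zero \<in> H"
    and plus_mem: "x \<in> H \<Longrightarrow> y \<in> H \<Longrightarrow> x \<oplus> y \<in> H"
    and scale_mem: "x \<in> H \<Longrightarrow> c \<odot> x \<in> H"
    and ip_plus: "x \<in> H \<Longrightarrow> y \<in> H \<Longrightarrow> z \<in> H \<Longrightarrow> ip (x \<oplus> y) z = ip x z + ip y z"
    and ip_scale: "x \<in> H \<Longrightarrow> y \<in> H \<Longrightarrow> ip (c \<odot> x) y = c * ip x y"
    and ip_cnj: "x \<in> H \<Longrightarrow> y \<in> H \<Longrightarrow> ip x y = cnj (ip y x)"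
    and ip_nonneg: "x \<in> H \<Longrightarrow> 0 \<le> Re (ip x x)"
begin

lemma ip_plus_right:
  assumes "x \<in> H" "y \<in> H" "z \<in> H"
  shows "ip z (x \<oplus> y) = ip z x + ip z y"
proof -
  have "ip z (x \<oplus> y) = cnj (ip x z + ip y z)"
    using assms ip_cnj[of z "x \<oplus> y"] by (simp add: plus_mem ip_plus)
  then show ?thesis using assms ip_cnj[of z x] ip_cnj[of z y] by simp
qed

lemma ip_scale_right:
  assumes "x \<in> H" "y \<in> H"
  shows "ip x (c \<odot> y) = cnj c * ip x y"
proof -
  have "ip x (c \<odot> y) = cnj (c * ip y x)"
    using assms ip_cnj[of x "c \<odot> y"] by (simp add: scale_mem ip_scale)
  then show ?thesis using assms ip_cnj[of x y] by simp
qed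

lemmas mem = zero_mem plus_mem scale_mem
lemmas ip_simps = ip_plus ip_scale ip_plus_right ip_scale_right

lemma ip_real:
  assumes "x \<in> H"
  shows "ip x x = complex_of_real (Re (ip x x))"
proof -
  have "ip x x = cnj (ip x x)" by (rule ip_cnj[OF assms assms])
  then have "Im (ip x x) = 0" by (metis Reals_cnj_iff complex_is_Real_iff)
  then show ?thesis by (simp add: complex_eq_iff)
qed

text \<open>A null vector is orthogonal to everything: otherwise adding a large multiple of it to \<open>v\<close> would
  produce a vector of negative square.\<close>

lemma ip_null:
  assumes "u \<in> H" "v \<in> H" "ip u u = 0"
  shows "ip u v = 0"
proof (rule ccontr)
  assume nz: "ip u v \<noteq> 0"
  define a where "a = ip u v"
  \<comment> \<open>The multiple is chosen so that the square of \<open>w\<close> comes out as \<open>-1\<close>.\<close>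
  define s where "s = (Re (ip v v) + 1) / (2 * (cmod a)\<^sup>2)"
  define w where "w = v \<oplus> (- of_real s * cnj a) \<odot> u"
  have a: "cmod a > 0" using nz by (simp add: a_def)
  have aa: "a * cnj a = of_real ((cmod a)\<^sup>2)" using complex_norm_square[of a] by simp
  have "ip v u = cnj a" using ip_cnj[of v u] assms by (simp add: a_def)
  then have "ip w w = ip v v - of_real s * (a * cnj a) - of_real s * (a * cnj a)"
    using assms by (simp add: w_def ip_simps mem a_def[symmetric] algebra_simps)
  then have "Re (ip w w) = Re (ip v v) - 2 * s * (cmod a)\<^sup>2"
    unfolding aa by simp
  also have "\<dots> = - 1" using a by (simp add: s_def field_simps)
  finally show False using ip_nonneg[of w] assms by (simp add: w_def mem)
qed

definition orthonormal :: "'v set \<Rightarrow> bool" where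
  "orthonormal C \<longleftrightarrow> C \<subseteq> H \<and> (\<forall>u\<in>C. \<forall>v\<in>C. ip u v = (if u = v then 1 else 0))"

text \<open>Orthonormal bases in the sense of maximality; this makes sense without completeness, and Zorn's
  lemma extends every orthonormal set to such a basis.\<close>

definition basis :: "'v set \<Rightarrow> bool" where
  "basis C \<longleftrightarrow> orthonormal C \<and> (\<forall>u\<in>H. (\<forall>v\<in>C. ip u v = 0) \<longrightarrow> u = zero)"

lemma basis_imp_orthonormal: "basis C \<Longrightarrow> orthonormal C"
  unfolding basis_def by (rule conjunct1)

lemma basis_total: "basis C \<Longrightarrow> u \<in> H \<Longrightarrow> (\<And>v. v \<in> C \<Longrightarrow> ip u v = 0) \<Longrightarrow> u = zero"
  unfolding basis_def by blast

lemma orthonormal_subset: "orthonormal C \<Longrightarrow> C \<subseteq> H"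
  unfolding orthonormal_def by (rule conjunct1)

text \<open>The property \<open>P\<close> lets the same application of Zorn's lemma serve twice: with \<open>P\<close> true it extends
  orthonormal sets to bases, and with \<open>P\<close> a lower bound on diagonal values of an operator it collects
  as many large diagonal values as possible.\<close>

lemma maximal_orthonormal:
  assumes "orthonormal C" "\<forall>v\<in>C. P v"
  shows "\<exists>V. C \<subseteq> V \<and> orthonormal V \<and> (\<forall>v\<in>V. P v) \<and>
    \<not> (\<exists>u\<in>H. P u \<and> ip u u = 1 \<and> (\<forall>v\<in>V. ip u v = 0))"
proof -
  define A where "A = {V. C \<subseteq> V \<and> orthonormal V \<and> (\<forall>v\<in>V. P v)}"
  have "\<exists>M\<in>A. \<forall>V\<in>A. M \<subseteq> V \<longrightarrow> V = M"
  proof (rule subset_Zorn_nonempty)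
    show "A \<noteq> {}" using assms by (auto simp: A_def)
    fix \<C> assume "\<C> \<noteq> {}" and ch: "subset.chain A \<C>"
    have sub: "V \<in> A" if "V \<in> \<C>" for V using ch that by (auto simp: subset.chain_def)
    have "ip u v = (if u = v then 1 else 0)" if uv: "u \<in> \<Union>\<C>" "v \<in> \<Union>\<C>" for u v
    proof -
      obtain V W where VW: "V \<in> \<C>" "u \<in> V" "W \<in> \<C>" "v \<in> W" using uv by blast
      then have "V \<subseteq> W \<or> W \<subseteq> V" using ch by (auto simp: subset.chain_def)
      then have "(u \<in> W \<and> v \<in> W) \<or> (u \<in> V \<and> v \<in> V)" using VW by blast
      then show ?thesis using sub VW by (auto simp: A_def orthonormal_def)
    qed
    moreover have "C \<subseteq> \<Union>\<C>" using sub \<open>\<C> \<noteq> {}\<close> by (fastforce simp: A_def)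
    moreover have "\<Union>\<C> \<subseteq> H" "\<forall>v\<in>\<Union>\<C>. P v" using sub by (fastforce simp: A_def orthonormal_def)+
    ultimately show "\<Union>\<C> \<in> A" by (simp add: A_def orthonormal_def)
  qed
  then obtain M where M: "M \<in> A" "\<And>V. V \<in> A \<Longrightarrow> M \<subseteq> V \<Longrightarrow> V = M" by blast
  have "\<not> (\<exists>u\<in>H. P u \<and> ip u u = 1 \<and> (\<forall>v\<in>M. ip u v = 0))"
  proof
    assume "\<exists>u\<in>H. P u \<and> ip u u = 1 \<and> (\<forall>v\<in>M. ip u v = 0)"
    then obtain u where u: "u \<in> H" "P u" "ip u u = 1" "\<And>v. v \<in> M \<Longrightarrow> ip u v = 0" by blast
    have MH: "M \<subseteq> H" using M(1) by (simp add: A_def orthonormal_def)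
    have "ip v u = 0" if "v \<in> M" for v using ip_cnj[of v u] u that MH by auto
    then have "insert u M \<in> A" using M(1) u by (auto simp: A_def orthonormal_def)
    then have "u \<in> M" using M(2)[of "insert u M"] by blast
    then show False using u by fastforce
  qed
  then show ?thesis using M(1) by (auto simp: A_def)
qed

text \<open>Only the inner products of the combination matter, so it need not be written as a sum of vectors.\<close>

lemma linear_combination:
  assumes "finite U" "U \<subseteq> H"
  shows "\<exists>w\<in>H. \<forall>y\<in>H. ip w y = (\<Sum>u\<in>U. c u * ip u y)"
  using assms
proof (induction U)
  case empty
  have "ip (0 \<odot> zero) y = 0" if "y \<in> H" for y using that by (simp add: ip_scale mem)
  then show ?case using mem by (intro bexI[of _ "0 \<odot> zero"]) auto
next
  case (insert u U)
  then obtain w where w: "w \<in> H" "\<forall>y\<in>H. ip w y = (\<Sum>u\<in>U. c u * ip u y)" by auto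
  then show ?case using insert by (intro bexI[of _ "c u \<odot> u \<oplus> w"]) (auto simp: ip_simps mem)
qed

lemma unit_multiple:
  assumes "z \<in> H" "ip z z \<noteq> 0"
  obtains r where "r > 0" "r\<^sup>2 * Re (ip z z) = 1" "ip (of_real r \<odot> z) (of_real r \<odot> z) = 1"
proof -
  define n where "n = Re (ip z z)"
  have n: "ip z z = of_real n" using ip_real[OF assms(1)] by (simp add: n_def)
  then have "n \<noteq> 0" using assms by auto
  then have "n > 0" using ip_nonneg[OF assms(1)] by (simp add: n_def less_le)
  define r where "r = 1 / sqrt n"
  have r: "r > 0" "r\<^sup>2 * n = 1" using \<open>n > 0\<close> by (simp_all add: r_def power_divide)
  have "ip (of_real r \<odot> z) (of_real r \<odot> z) = of_real (r\<^sup>2 * n)"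
    using assms by (simp add: ip_simps mem n power2_eq_square)
  then show thesis using that[of r] r n by simp
qed

end

locale inner_space = semi_inner_space +
  fixes B :: "'a set"
  assumes basis: "basis B"
begin

text \<open>Definiteness is not among the axioms of the inner product; it follows from the existence of a basis,
  as a null vector is orthogonal to every basis vector.\<close>

lemma definite:
  assumes "u \<in> H" "ip u u = 0"
  shows "u = zero"
proof (rule basis_total[OF basis assms(1)])
  fix v assume "v \<in> B"
  then have "v \<in> H" using orthonormal_subset[OF basis_imp_orthonormal[OF basis]] by blast
  then show "ip u v = 0" by (rule ip_null[OF assms(1) _ assms(2)])
qed

lemma extend_to_basis:
  assumes "orthonormal C"
  shows "\<exists>V. C \<subseteq> V \<and> basis V"
proof -
  obtain V where V: "C \<subseteq> V" "orthonormal V" "\<not> (\<exists>u\<in>H. ip u u = 1 \<and> (\<forall>v\<in>V. ip u v = 0))"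
    using maximal_orthonormal[OF assms, of "\<lambda>_. True"] by auto
  have "u = zero" if u: "u \<in> H" "\<forall>v\<in>V. ip u v = 0" for u
  proof (rule ccontr)
    assume "u \<noteq> zero"
    then have "ip u u \<noteq> 0" using definite u by blast
    then obtain r where "ip (of_real r \<odot> u) (of_real r \<odot> u) = 1" using unit_multiple u by metis
    moreover have "ip (of_real r \<odot> u) v = 0" if "v \<in> V" for v
      using u that V(2) by (auto simp: ip_scale orthonormal_def)
    ultimately show False using V(3) u mem by blast
  qed
  then have "basis V" unfolding basis_def using V(2) by blast
  then show ?thesis using V(1) by blast
qed

lemma orthogonal_to_finite:
  assumes "infinite B" "finite F" "F \<subseteq> H"
  shows "\<exists>w\<in>H. ip w w \<noteq> 0 \<and> (\<forall>f\<in>F. ip w f = 0)"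
proof -
  obtain U where U: "U \<subseteq> B" "finite U" "card U = Suc (card F)"
    using infinite_arbitrarily_large[OF assms(1)] by blast
  have on: "orthonormal B" by (rule basis_imp_orthonormal[OF basis])
  then have UH: "U \<subseteq> H" using U by (auto simp: orthonormal_def)
  obtain c p where c: "p \<in> U" "c p \<noteq> 0" "\<And>f. f \<in> F \<Longrightarrow> (\<Sum>u\<in>U. c u * ip u f) = 0"
    using homogeneous_system_nontrivial[OF assms(2) U(2), of "\<lambda>f u. ip u f"] U(3) by auto
  obtain w where w: "w \<in> H" "\<And>y. y \<in> H \<Longrightarrow> ip w y = (\<Sum>u\<in>U. c u * ip u y)"
    using linear_combination[OF U(2) UH, of c] by blast
  have "ip w p = (\<Sum>u\<in>U. c u * (if u = p then 1 else 0))"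
  proof -
    have "ip u p = (if u = p then 1 else 0)" if "u \<in> U" for u
      using on U(1) c(1) that unfolding orthonormal_def by blast
    then show ?thesis using w(2)[of p] UH c(1) by (auto intro!: sum.cong)
  qed
  also have "\<dots> = c p" using U(2) c(1) by (simp add: if_distrib cong: if_cong)
  finally have "ip w w \<noteq> 0" using ip_null[of w p] w(1) UH c by auto
  then show ?thesis using w c assms(3) by (intro bexI[of _ w]) auto
qed

end

locale unitary_on = inner_space +
  fixes T :: "'a \<Rightarrow> 'a"
  assumes T_bij: "bij_betw T H H"
    and T_plus: "x \<in> H \<Longrightarrow> y \<in> H \<Longrightarrow> T (x \<oplus> y) = T x \<oplus> T y"
    and T_scale: "x \<in> H \<Longrightarrow> T (c \<odot> x) = c \<odot> T x"
    and T_ip: "x \<in> H \<Longrightarrow> y \<in> H \<Longrightarrow> ip (T x) (T y) = ip x y"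
begin

lemma T_mem: "x \<in> H \<Longrightarrow> T x \<in> H"
  using T_bij by (auto simp: bij_betw_def)

text \<open>If \<open>w\<close> is orthogonal to \<open>V\<close> and to the preimage of \<open>V\<close> under \<open>T\<close>, then \<open>w\<close> and \<open>T w\<close> are both
  orthogonal to \<open>V\<close>, and \<open>\<langle>T w, T w\<rangle> = 1\<close> is an off-diagonal value of \<open>T\<close> on the complement of \<open>V\<close>.
  Polarization turns it into a diagonal value that is not small.\<close>

lemma large_diagonal_value:
  assumes "infinite B" "finite V" "V \<subseteq> H"
  shows "\<exists>z\<in>H. ip z z = 1 \<and> (\<forall>v\<in>V. ip z v = 0) \<and> 1/4 \<le> cmod (ip (T z) z)"
proof -
  define F where "F = V \<union> {x \<in> H. T x \<in> V}"
  have "finite {x \<in> H. T x \<in> V}"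
    using finite_vimage_IntI[OF assms(2), of T H] T_bij
    by (auto simp: bij_betw_def vimage_def Int_def conj_commute)
  then obtain w0 where w0: "w0 \<in> H" "ip w0 w0 \<noteq> 0" "\<And>f. f \<in> F \<Longrightarrow> ip w0 f = 0"
    using orthogonal_to_finite[OF assms(1), of F] assms by (auto simp: F_def)
  obtain r where r: "ip (of_real r \<odot> w0) (of_real r \<odot> w0) = 1" using unit_multiple w0 by metis
  define w where "w = of_real r \<odot> w0"
  have w: "w \<in> H" "ip w w = 1" "\<And>f. f \<in> F \<Longrightarrow> ip w f = 0"
    using w0 r assms(3) by (auto simp: w_def mem ip_scale F_def)
  define y where "y = T w"
  have y: "y \<in> H" "ip y y = 1" using w by (auto simp: y_def T_mem T_ip)
  have wV: "ip w v = 0" if "v \<in> V" for v using w(3) that by (simp add: F_def)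
  have yV: "ip y v = 0" if "v \<in> V" for v
  proof -
    have "v \<in> T ` H" using T_bij assms(3) that by (auto simp: bij_betw_def)
    then obtain x where x: "x \<in> H" "T x = v" by blast
    then show ?thesis using w(3)[of x] that w(1) T_ip[of w x] by (simp add: F_def y_def)
  qed
  define z where "z c = w \<oplus> c \<odot> y" for c
  have zH: "z c \<in> H" for c using w y by (simp add: z_def mem)
  have q: "ip (T (z c)) (z c) = ip (T w) w + cnj c * ip y y + c * ip (T y) w + c * cnj c * ip (T y) y" for c
    using w y by (simp add: z_def T_plus T_scale mem ip_simps T_mem y_def[symmetric] algebra_simps)
  have n: "ip (z c) (z c) = 1 + cnj c * ip w y + c * ip y w + c * cnj c" for c
    using w y by (simp add: z_def mem ip_simps algebra_simps)
  \<comment> \<open>Polarization over the fourth roots of unity recovers \<open>4 \<langle>T w, y\<rangle> = 4\<close> from diagonal values at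
    vectors whose squared norms add up to 8.\<close>
  have "\<exists>c. 1/4 * Re (ip (z c) (z c)) < cmod (ip (T (z c)) (z c))"
  proof (rule ccontr)
    assume "\<not> ?thesis"
    then have le: "cmod (ip (T (z c)) (z c)) \<le> 1/4 * Re (ip (z c) (z c))" for c by (meson not_le)
    have "4 = 1 * ip (T (z 1)) (z 1) + \<i> * ip (T (z \<i>)) (z \<i>)
        + (- 1) * ip (T (z (- 1))) (z (- 1)) + (- \<i>) * ip (T (z (- \<i>))) (z (- \<i>))"
      unfolding q by (simp add: y algebra_simps)
    then have "4 \<le> cmod (1 * ip (T (z 1)) (z 1) + \<i> * ip (T (z \<i>)) (z \<i>)
        + (- 1) * ip (T (z (- 1))) (z (- 1)) + (- \<i>) * ip (T (z (- \<i>))) (z (- \<i>)))" by (metis norm_numeral order_refl)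
    also have "\<dots> \<le> cmod (1 * ip (T (z 1)) (z 1)) + cmod (\<i> * ip (T (z \<i>)) (z \<i>))
        + cmod ((- 1) * ip (T (z (- 1))) (z (- 1))) + cmod ((- \<i>) * ip (T (z (- \<i>))) (z (- \<i>)))"
      by (intro order_trans[OF norm_triangle_ineq] add_mono order_refl)
    also have "\<dots> \<le> 1/4 * (Re (ip (z 1) (z 1)) + Re (ip (z \<i>) (z \<i>))
        + Re (ip (z (- 1)) (z (- 1))) + Re (ip (z (- \<i>)) (z (- \<i>))))"
      using le[of 1] le[of \<i>] le[of "- 1"] le[of "- \<i>"] by (simp add: norm_mult)
    also have "\<dots> = 2" unfolding n by simp
    finally show False by simp
  qed
  then obtain c where c: "1/4 * Re (ip (z c) (z c)) < cmod (ip (T (z c)) (z c))" by blast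
  have "ip (z c) (z c) \<noteq> 0"
  proof
    assume "ip (z c) (z c) = 0"
    then have "ip (T (z c)) (z c) = 0"
      using ip_null[of "z c" "T (z c)"] ip_cnj[of "T (z c)" "z c"] zH T_mem by simp
    then show False using c ip_nonneg[OF zH, of c] by simp
  qed
  then obtain r where r: "r > 0" "r\<^sup>2 * Re (ip (z c) (z c)) = 1"
      "ip (of_real r \<odot> z c) (of_real r \<odot> z c) = 1" using unit_multiple zH by metis
  show ?thesis
  proof (intro bexI conjI ballI)
    show "of_real r \<odot> z c \<in> H" using zH mem by blast
    show "ip (of_real r \<odot> z c) (of_real r \<odot> z c) = 1" by fact
    show "ip (of_real r \<odot> z c) v = 0" if "v \<in> V" for v
      using that zH wV yV assms(3) w y mem by (auto simp: z_def ip_simps)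
    have "ip (T (of_real r \<odot> z c)) (of_real r \<odot> z c) = of_real (r\<^sup>2) * ip (T (z c)) (z c)"
      using zH T_mem by (simp add: T_scale ip_simps mem power2_eq_square)
    then have "cmod (ip (T (of_real r \<odot> z c)) (of_real r \<odot> z c)) = r\<^sup>2 * cmod (ip (T (z c)) (z c))"
      by (simp add: norm_mult norm_power)
    moreover have "r\<^sup>2 * (1/4 * Re (ip (z c) (z c))) \<le> r\<^sup>2 * cmod (ip (T (z c)) (z c))"
      using c by (intro mult_left_mono) auto
    ultimately show "1/4 \<le> cmod (ip (T (of_real r \<odot> z c)) (of_real r \<odot> z c))"
      using r(2) by simp
  qed
qed

text \<open>On an infinite-dimensional space a maximal orthonormal set of vectors with diagonal value at least
  \<open>1/4\<close> cannot be finite; a basis that contains it has a divergent diagonal sum.  So a unitary operator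
  has a trace only in finite dimension.\<close>

lemma finite_if_diagonals_summable:
  assumes "\<And>C. basis C \<Longrightarrow> (\<lambda>u. ip (T u) u) summable_on C"
  shows "finite B"
proof (rule ccontr)
  assume inf: "infinite B"
  obtain V where V: "orthonormal V" "\<forall>v\<in>V. 1/4 \<le> cmod (ip (T v) v)"
    "\<not> (\<exists>u\<in>H. 1/4 \<le> cmod (ip (T u) u) \<and> ip u u = 1 \<and> (\<forall>v\<in>V. ip u v = 0))"
    using maximal_orthonormal[of "{}" "\<lambda>v. 1/4 \<le> cmod (ip (T v) v)"] by (auto simp: orthonormal_def)
  have "infinite V"
  proof
    assume "finite V"
    then show False
      using large_diagonal_value[OF inf \<open>finite V\<close>] V by (auto simp: orthonormal_def)
  qed
  obtain C where C: "V \<subseteq> C" "basis C" using extend_to_basis[OF V(1)] by blast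
  have "(\<lambda>u. ip (T u) u) summable_on V"
    by (rule summable_on_subset_banach[OF assms[OF C(2)] C(1)])
  then have "(\<lambda>u. cmod (ip (T u) u)) summable_on V"
    by (simp add: summable_on_iff_abs_summable_on_complex)
  then have sm: "(\<lambda>u. 1/4 :: real) summable_on V"
    by (rule summable_on_comparison_test) (use V in auto)
  obtain n :: nat where n: "real n > 4 * infsum (\<lambda>u. 1/4) V" using reals_Archimedean2 by blast
  obtain F where F: "finite F" "card F = n" "F \<subseteq> V"
    using infinite_arbitrarily_large[OF \<open>infinite V\<close>] by blast
  have "(\<Sum>u\<in>F. 1/4) \<le> infsum (\<lambda>u. 1/4 :: real) V"
    by (rule finite_sum_le_infsum[OF sm F(1,3)]) simp
  then show False using n F(2) by simp
qed

end

section \<open>Smooth functions on a coadjoint orbit\<close>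

locale orbit_geometry = lie_grp "lie X"
  for X :: "('g::{t2_space,second_countable_topology}, 'e::real_normed_vector, 'i) orbit_data"
begin

definition preimage :: "'e dual set \<Rightarrow> 'g set" where
  "preimage W = {g. coAd (lie X) g (base_pt X) \<in> W}"

abbreviation open_in_orbit :: "'e dual set \<Rightarrow> bool" where
  "open_in_orbit \<equiv> orbit_open (lie X) (base_pt X)"

lemma preimage_open: "open_in_orbit W \<Longrightarrow> open (preimage W)"
  by (simp add: orbit_open_def preimage_def)

lemma preimageE:
  assumes "open_in_orbit W" "\<xi> \<in> W"
  obtains g where "g \<in> preimage W" "\<xi> = coAd (lie X) g (base_pt X)"
  using assms by (auto simp: orbit_open_def coadjoint_orbit_def preimage_def)

lemma smooth_fun_iff:
  "smooth_fun X W f \<longleftrightarrow> smooth_on_group (lie X) (preimage W) (\<lambda>g. f (coAd (lie X) g (base_pt X)))"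
  by (simp add: smooth_on_orbit_def preimage_def)

text \<open>Derivatives on the orbit are defined as \<open>vector_derivative\<close>, which is an arbitrary value for a
  function that is not differentiable.  Additivity of the differential rests on this lemma.\<close>

lemma differentiable_along_flow:
  assumes "open_in_orbit W" "smooth_fun X W f" "\<xi> \<in> W"
  shows "(\<lambda>t. f (coAd (lie X) (lie_exp (lie X) (t *\<^sub>R \<eta>)) \<xi>)) differentiable (at 0)"
proof -
  obtain g where g: "g \<in> preimage W" "\<xi> = coAd (lie X) g (base_pt X)"
    by (rule preimageE[OF assms(1,3)])
  show ?thesis
    using differentiable_along_lie_exp[OF preimage_open[OF assms(1)] assms(2)[unfolded smooth_fun_iff] g(1)]
    by (simp add: g(2) coAd_mult)
qed

lemma diff_at_add:
  assumes "open_in_orbit W" "smooth_fun X W f" "smooth_fun X W g" "\<xi> \<in> W"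
  shows "diff_at (lie X) (\<lambda>\<xi>. f \<xi> + g \<xi>) \<xi> v = diff_at (lie X) f \<xi> v + diff_at (lie X) g \<xi> v"
  unfolding diff_at_def fund_deriv_def
  by (rule vector_derivative_add_at[OF differentiable_along_flow differentiable_along_flow]) fact+

lemma diff_at_linear:
  assumes "open_in_orbit W" "smooth_fun X W f" "\<xi> \<in> W" "bounded_linear L"
  shows "diff_at (lie X) (\<lambda>\<xi>. L (f \<xi>)) \<xi> v = L (diff_at (lie X) f \<xi> v)"
  unfolding diff_at_def fund_deriv_def
  by (rule vector_derivative_at, rule bounded_linear.has_vector_derivative[OF assms(4)])
    (use differentiable_along_flow[OF assms(1-3)] in \<open>simp add: vector_derivative_works\<close>)

lemma dz_add:
  assumes "open_in_orbit W" "smooth_fun X W f" "smooth_fun X W g" "\<xi> \<in> W"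
  shows "dz X \<alpha> \<mu> (\<lambda>\<xi>. f \<xi> + g \<xi>) \<xi> = dz X \<alpha> \<mu> f \<xi> + dz X \<alpha> \<mu> g \<xi>"
  unfolding dz_def diff_at_add[OF assms] by (simp add: algebra_simps add_divide_distrib diff_divide_distrib)

lemma dz_scale:
  assumes "open_in_orbit W" "smooth_fun X W f" "\<xi> \<in> W"
  shows "dz X \<alpha> \<mu> (\<lambda>\<xi>. c * f \<xi>) \<xi> = c * dz X \<alpha> \<mu> f \<xi>"
  unfolding dz_def diff_at_linear[OF assms bounded_linear_mult_right] by (simp add: algebra_simps)

lemma
  assumes "open_in_orbit W"
  shows smooth_fun_add: "smooth_fun X W f \<Longrightarrow> smooth_fun X W g \<Longrightarrow> smooth_fun X W (\<lambda>\<xi>. f \<xi> + g \<xi>)"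
    and smooth_fun_linear: "bounded_linear L \<Longrightarrow> smooth_fun X W f \<Longrightarrow> smooth_fun X W (\<lambda>\<xi>. L (f \<xi>))"
    and smooth_fun_const: "smooth_fun X W (\<lambda>\<xi>. c)"
proof -
  have o: "open (\<phi> ` (U \<inter> preimage W))" if "(U, \<phi>) \<in> atlas (lie X)" for U \<phi>
    by (rule open_chart_image[OF that preimage_open[OF assms]])
  show "smooth_fun X W (\<lambda>\<xi>. c)"
    unfolding smooth_fun_iff smooth_on_group_def
    by (auto simp: o_def intro: smooth_on_const o)
  have chart: "smooth_on (\<phi> ` (U \<inter> preimage W)) (\<lambda>a. f (coAd (lie X) (inv_into U \<phi> a) (base_pt X)))"
    if "smooth_fun X W f" "(U, \<phi>) \<in> atlas (lie X)"
    for f :: "'e dual \<Rightarrow> 'd::real_normed_vector" and U \<phi>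
    using that by (auto simp: smooth_fun_iff smooth_on_group_def o_def)
  show "smooth_fun X W (\<lambda>\<xi>. L (f \<xi>))" if "bounded_linear L" "smooth_fun X W f" for L f
    unfolding smooth_fun_iff smooth_on_group_def
  proof clarify
    fix U \<phi> assume ch: "(U, \<phi>) \<in> atlas (lie X)"
    from smooth_on_linear_compose[OF o[OF ch] that(1) chart[OF that(2) ch]]
    show "smooth_on (\<phi> ` (U \<inter> preimage W))
        ((\<lambda>g. L (f (coAd (lie X) g (base_pt X)))) \<circ> inv_into U \<phi>)" by (simp only: o_def)
  qed
  show "smooth_fun X W (\<lambda>\<xi>. f \<xi> + g \<xi>)" if "smooth_fun X W f" "smooth_fun X W g" for f g
    unfolding smooth_fun_iff smooth_on_group_def
  proof clarify
    fix U \<phi> assume ch: "(U, \<phi>) \<in> atlas (lie X)"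
    from smooth_on_add[OF o[OF ch] chart[OF that(1) ch] chart[OF that(2) ch]]
    show "smooth_on (\<phi> ` (U \<inter> preimage W))
        ((\<lambda>a. f (coAd (lie X) a (base_pt X)) + g (coAd (lie X) a (base_pt X))) \<circ> inv_into U \<phi>)"
      by (simp only: o_def)
  qed
qed

lemma smooth_on_group_continuous_on:
  assumes "open W" "smooth_on_group (lie X) W F"
  shows "continuous_on W F"
proof (rule continuous_at_imp_continuous_on, rule ballI)
  fix g assume g: "g \<in> W"
  obtain U \<phi> where ch: "(U, \<phi>) \<in> atlas (lie X)" "g \<in> U" by (rule chart_ex)
  have "smooth_on (\<phi> ` (U \<inter> W)) (F \<circ> inv_into U \<phi>)"
    using assms(2) ch(1) by (auto simp: smooth_on_group_def)
  then have "continuous_on (\<phi> ` (U \<inter> W)) (F \<circ> inv_into U \<phi>)" by (rule smooth_on_imp_continuous_on)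
  then have "continuous_on (U \<inter> W) (\<lambda>g. (F \<circ> inv_into U \<phi>) (\<phi> g))"
    by (rule continuous_on_compose2) (auto intro: continuous_on_subset[OF chart_cont[OF ch(1)]])
  then have "continuous_on (U \<inter> W) F"
    by (rule continuous_on_eq) (simp add: chart_inv[OF ch(1)])
  then show "isCont F g"
    using ch g continuous_on_eq_continuous_at[of "U \<inter> W" F] assms(1) chart_open[OF ch(1)] by auto
qed

text \<open>A set is open in the quotient topology if, near each of its points, membership is forced by an open
  condition on a smooth function.\<close>

lemma open_in_orbit_local:
  assumes "P \<subseteq> orb X"
    and loc: "\<And>\<xi>. \<xi> \<in> P \<Longrightarrow> \<exists>W (f :: 'e dual \<Rightarrow> 'c::real_normed_vector) S.
      open_in_orbit W \<and> \<xi> \<in> W \<and> smooth_fun X W f \<and> open S \<and>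
      f \<xi> \<in> S \<and> {\<zeta> \<in> W. f \<zeta> \<in> S} \<subseteq> P"
  shows "open_in_orbit P"
  unfolding orbit_open_def
proof (intro conjI assms(1))
  show "open {g. coAd (lie X) g (base_pt X) \<in> P}"
  proof (subst open_subopen, intro ballI)
    fix g assume g: "g \<in> {g. coAd (lie X) g (base_pt X) \<in> P}"
    let ?c = "\<lambda>g. coAd (lie X) g (base_pt X)"
    obtain W S and f :: "'e dual \<Rightarrow> 'c" where W: "open_in_orbit W" "?c g \<in> W" "smooth_fun X W f" "open S" "f (?c g) \<in> S"
      "{\<zeta> \<in> W. f \<zeta> \<in> S} \<subseteq> P"
      using loc[of "?c g"] g by blast
    have "continuous_on (preimage W) (\<lambda>g. f (?c g))"
      using smooth_on_group_continuous_on[OF preimage_open[OF W(1)]] W(3) by (simp add: smooth_fun_iff)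
    then have "open (preimage W \<inter> (\<lambda>g. f (?c g)) -` S)"
      by (rule continuous_open_preimage) (use W preimage_open in auto)
    moreover have "g \<in> preimage W \<inter> (\<lambda>g. f (?c g)) -` S" using W by (simp add: preimage_def)
    moreover have "preimage W \<inter> (\<lambda>g. f (?c g)) -` S \<subseteq> {g. ?c g \<in> P}"
      using W(6) by (auto simp: preimage_def)
    ultimately show "\<exists>T. open T \<and> g \<in> T \<and> T \<subseteq> {g. ?c g \<in> P}" by blast
  qed
qed

end


section \<open>The space of antiholomorphic sections\<close>

locale quantized_orbit = orbit_geometry X
  for X :: "('g::{t2_space,second_countable_topology}, 'e::real_normed_vector, 'i) orbit_data" +
  assumes hbar_pos: "hbar X > 0"
    and complex: "complex_structure X"
    and potentials: "kaehler_potentials X"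
    and line_bundle: "hermitian_line_bundle X"
    and liouville: "liouville_measure X"
begin

abbreviation "section_add u v \<equiv> (\<lambda>\<alpha> \<xi>. u \<alpha> \<xi> + v \<alpha> \<xi> :: complex)"
abbreviation "section_scale c u \<equiv> (\<lambda>\<alpha> \<xi>. c * u \<alpha> \<xi> :: complex)"

lemma patch_open: "\<alpha> \<in> patches X \<Longrightarrow> open_in_orbit (patch X \<alpha>)"
  using complex by (simp add: complex_structure_def)

lemma orb_eq: "orb X = (\<Union>\<alpha>\<in>patches X. patch X \<alpha>)"
  using complex by (simp add: complex_structure_def)

lemma patch_at: "\<xi> \<in> orb X \<Longrightarrow> patch_at X \<xi> \<in> patches X \<and> \<xi> \<in> patch X (patch_at X \<xi>)"
  unfolding patch_at_def by (rule someI_ex) (auto simp: orb_eq)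

lemma space_vol: "space (vol X) = orb X"
  using liouville by (simp add: liouville_measure_def)

lemma open_measurable: "open_in_orbit W \<Longrightarrow> W \<in> sets (vol X)"
  using liouville by (auto simp: liouville_measure_def)

lemma antiholomorphic_sectionsI:
  assumes "\<And>\<alpha> \<xi>. \<not> (\<alpha> \<in> patches X \<and> \<xi> \<in> patch X \<alpha>) \<Longrightarrow> u \<alpha> \<xi> = 0"
    and "\<And>\<alpha>. \<alpha> \<in> patches X \<Longrightarrow> smooth_fun X (patch X \<alpha>) (u \<alpha>)"
    and "\<And>\<alpha> \<xi> \<mu>. \<alpha> \<in> patches X \<Longrightarrow> \<xi> \<in> patch X \<alpha> \<Longrightarrow> \<mu> < cdim X \<Longrightarrow> dz X \<alpha> \<mu> (u \<alpha>) \<xi> = 0"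
    and "\<And>\<alpha> \<beta> \<xi>. \<alpha> \<in> patches X \<Longrightarrow> \<beta> \<in> patches X \<Longrightarrow> \<xi> \<in> patch X \<alpha> \<Longrightarrow> \<xi> \<in> patch X \<beta> \<Longrightarrow>
      u \<alpha> \<xi> = trans X \<alpha> \<beta> \<xi> * u \<beta> \<xi>"
  shows "u \<in> antiholomorphic_sections X"
  unfolding antiholomorphic_sections_def antiholomorphic_on_def using assms by blast

lemma
  assumes "u \<in> antiholomorphic_sections X"
  shows antiholomorphic_outside: "\<not> (\<alpha> \<in> patches X \<and> \<xi> \<in> patch X \<alpha>) \<Longrightarrow> u \<alpha> \<xi> = 0"
    and antiholomorphic_smooth: "\<alpha> \<in> patches X \<Longrightarrow> smooth_fun X (patch X \<alpha>) (u \<alpha>)"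
    and antiholomorphic_dz: "\<alpha> \<in> patches X \<Longrightarrow> \<xi> \<in> patch X \<alpha> \<Longrightarrow> \<mu> < cdim X \<Longrightarrow> dz X \<alpha> \<mu> (u \<alpha>) \<xi> = 0"
    and antiholomorphic_trans: "\<alpha> \<in> patches X \<Longrightarrow> \<beta> \<in> patches X \<Longrightarrow> \<xi> \<in> patch X \<alpha> \<Longrightarrow> \<xi> \<in> patch X \<beta> \<Longrightarrow>
      u \<alpha> \<xi> = trans X \<alpha> \<beta> \<xi> * u \<beta> \<xi>"
  using assms unfolding antiholomorphic_sections_def antiholomorphic_on_def by blast+

lemma antiholomorphic_add:
  assumes u: "u \<in> antiholomorphic_sections X" and v: "v \<in> antiholomorphic_sections X"
  shows "section_add u v \<in> antiholomorphic_sections X"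
proof (rule antiholomorphic_sectionsI)
  fix \<alpha> \<xi> assume "\<not> (\<alpha> \<in> patches X \<and> \<xi> \<in> patch X \<alpha>)"
  then show "u \<alpha> \<xi> + v \<alpha> \<xi> = 0"
    using antiholomorphic_outside[OF u] antiholomorphic_outside[OF v] by simp
next
  fix \<alpha> assume \<alpha>: "\<alpha> \<in> patches X"
  note s = antiholomorphic_smooth[OF u \<alpha>] antiholomorphic_smooth[OF v \<alpha>]
  show "smooth_fun X (patch X \<alpha>) (\<lambda>\<xi>. u \<alpha> \<xi> + v \<alpha> \<xi>)"
    by (rule smooth_fun_add[OF patch_open[OF \<alpha>] s])
  show "dz X \<alpha> \<mu> (\<lambda>\<xi>. u \<alpha> \<xi> + v \<alpha> \<xi>) \<xi> = 0" if "\<xi> \<in> patch X \<alpha>" "\<mu> < cdim X" for \<mu> \<xi>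
    using dz_add[OF patch_open[OF \<alpha>] s that(1)] antiholomorphic_dz[OF u \<alpha> that] antiholomorphic_dz[OF v \<alpha> that]
    by simp
  show "u \<alpha> \<xi> + v \<alpha> \<xi> = trans X \<alpha> \<beta> \<xi> * (u \<beta> \<xi> + v \<beta> \<xi>)"
    if "\<beta> \<in> patches X" "\<xi> \<in> patch X \<alpha>" "\<xi> \<in> patch X \<beta>" for \<beta> \<xi>
    using antiholomorphic_trans[OF u \<alpha> that] antiholomorphic_trans[OF v \<alpha> that] by (simp only: distrib_left)
qed

lemma antiholomorphic_scale:
  assumes u: "u \<in> antiholomorphic_sections X"
  shows "section_scale c u \<in> antiholomorphic_sections X"
proof (rule antiholomorphic_sectionsI)
  fix \<alpha> \<xi> assume "\<not> (\<alpha> \<in> patches X \<and> \<xi> \<in> patch X \<alpha>)"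
  then show "c * u \<alpha> \<xi> = 0" using antiholomorphic_outside[OF u] by simp
next
  fix \<alpha> assume \<alpha>: "\<alpha> \<in> patches X"
  note s = antiholomorphic_smooth[OF u \<alpha>]
  show "smooth_fun X (patch X \<alpha>) (\<lambda>\<xi>. c * u \<alpha> \<xi>)"
    by (rule smooth_fun_linear[OF patch_open[OF \<alpha>] bounded_linear_mult_right s])
  show "dz X \<alpha> \<mu> (\<lambda>\<xi>. c * u \<alpha> \<xi>) \<xi> = 0" if "\<xi> \<in> patch X \<alpha>" "\<mu> < cdim X" for \<mu> \<xi>
    using dz_scale[OF patch_open[OF \<alpha>] s that(1)] antiholomorphic_dz[OF u \<alpha> that] by simp
  show "c * u \<alpha> \<xi> = trans X \<alpha> \<beta> \<xi> * (c * u \<beta> \<xi>)"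
    if "\<beta> \<in> patches X" "\<xi> \<in> patch X \<alpha>" "\<xi> \<in> patch X \<beta>" for \<beta> \<xi>
    using antiholomorphic_trans[OF u \<alpha> that] by simp
qed

lemma antiholomorphic_zero: "(\<lambda>\<alpha> \<xi>. 0) \<in> antiholomorphic_sections X"
  by (rule antiholomorphic_sectionsI)
    (simp_all add: dz_def diff_at_def fund_deriv_def smooth_fun_const patch_open)

text \<open>The Hermitian form does not depend on the trivialization, so locally it is a continuous function.\<close>

lemma fiber_form_patch:
  assumes "u \<in> antiholomorphic_sections X" "v \<in> antiholomorphic_sections X"
    and "\<alpha> \<in> patches X" "\<xi> \<in> patch X \<alpha>"
  shows "fiber_form X u v \<xi> = u \<alpha> \<xi> * cnj (v \<alpha> \<xi>) * complex_of_real (exp (- pot X \<alpha> \<xi> / hbar X))"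
proof -
  define \<beta> where "\<beta> = patch_at X \<xi>"
  have \<beta>: "\<beta> \<in> patches X" "\<xi> \<in> patch X \<beta>"
    using patch_at[of \<xi>] assms by (auto simp: \<beta>_def orb_eq)
  have "u \<beta> \<xi> = trans X \<beta> \<alpha> \<xi> * u \<alpha> \<xi>" "v \<beta> \<xi> = trans X \<beta> \<alpha> \<xi> * v \<alpha> \<xi>"
    using antiholomorphic_trans assms \<beta> by blast+
  then have "fiber_form X u v \<xi> = (trans X \<beta> \<alpha> \<xi> * cnj (trans X \<beta> \<alpha> \<xi>)) *
      (u \<alpha> \<xi> * cnj (v \<alpha> \<xi>)) * complex_of_real (exp (- pot X \<beta> \<xi> / hbar X))"
    by (simp add: fiber_form_def Let_def \<beta>_def[symmetric])
  also have "trans X \<beta> \<alpha> \<xi> * cnj (trans X \<beta> \<alpha> \<xi>) = complex_of_real ((cmod (trans X \<beta> \<alpha> \<xi>))\<^sup>2)"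
    using complex_norm_square[of "trans X \<beta> \<alpha> \<xi>"] by simp
  also have "(cmod (trans X \<beta> \<alpha> \<xi>))\<^sup>2 = exp ((pot X \<beta> \<xi> - pot X \<alpha> \<xi>) / hbar X)"
    using line_bundle assms \<beta> by (simp add: hermitian_line_bundle_def)
  also have "complex_of_real (exp ((pot X \<beta> \<xi> - pot X \<alpha> \<xi>) / hbar X)) * (u \<alpha> \<xi> * cnj (v \<alpha> \<xi>)) *
      complex_of_real (exp (- pot X \<beta> \<xi> / hbar X)) = u \<alpha> \<xi> * cnj (v \<alpha> \<xi>) *
      complex_of_real (exp ((pot X \<beta> \<xi> - pot X \<alpha> \<xi>) / hbar X) * exp (- pot X \<beta> \<xi> / hbar X))"
    by simp
  also have "exp ((pot X \<beta> \<xi> - pot X \<alpha> \<xi>) / hbar X) * exp (- pot X \<beta> \<xi> / hbar X) = exp (- pot X \<alpha> \<xi> / hbar X)"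
    by (simp add: exp_add[symmetric] diff_divide_distrib)
  finally show ?thesis .
qed

lemma fiber_form_measurable:
  assumes "u \<in> antiholomorphic_sections X" "v \<in> antiholomorphic_sections X"
  shows "fiber_form X u v \<in> borel_measurable (vol X)"
proof (rule borel_measurableI)
  fix S :: "complex set" assume "open S"
  have "open_in_orbit (fiber_form X u v -` S \<inter> orb X)"
  proof (rule open_in_orbit_local)
    fix \<xi> assume \<xi>: "\<xi> \<in> fiber_form X u v -` S \<inter> orb X"
    then obtain \<alpha> where \<alpha>: "\<alpha> \<in> patches X" "\<xi> \<in> patch X \<alpha>" by (auto simp: orb_eq)
    let ?W = "patch X \<alpha>"
    define h where "h = (\<lambda>(a, b, F). a * cnj b * complex_of_real (exp (- F / hbar X)))"
    define f where "f \<zeta> = (u \<alpha> \<zeta>, v \<alpha> \<zeta>, pot X \<alpha> \<zeta>)" for \<zeta>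
    \<comment> \<open>The three local functions are combined into one map, of which the Hermitian form is a continuous
      function.\<close>
    have emb: "bounded_linear (\<lambda>a::complex. (a, 0::complex, 0::real))"
      "bounded_linear (\<lambda>a::complex. (0::complex, a, 0::real))" "bounded_linear (\<lambda>a::real. (0::complex, 0::complex, a))"
      by (auto intro!: bounded_linear_intro[where K=1] simp: norm_Pair)
    have "smooth_fun X ?W (u \<alpha>)" "smooth_fun X ?W (v \<alpha>)" "smooth_fun X ?W (pot X \<alpha>)"
      using antiholomorphic_smooth assms \<alpha> potentials by (auto simp: kaehler_potentials_def)
    then have "smooth_fun X ?W (\<lambda>\<zeta>. (u \<alpha> \<zeta>, 0, 0) + ((0, v \<alpha> \<zeta>, 0) + (0, 0, pot X \<alpha> \<zeta>)))"
      by (intro smooth_fun_add smooth_fun_linear[OF _ emb(1)] smooth_fun_linear[OF _ emb(2)]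
          smooth_fun_linear[OF _ emb(3)] patch_open \<alpha>)
    then have "smooth_fun X ?W f" by (simp add: f_def[abs_def])
    moreover have h: "fiber_form X u v \<zeta> = h (f \<zeta>)" if "\<zeta> \<in> ?W" for \<zeta>
      using fiber_form_patch[OF assms \<alpha>(1) that] by (simp add: h_def f_def)
    moreover have "continuous_on UNIV h"
      unfolding h_def case_prod_beta' using hbar_pos by (intro continuous_intros) auto
    then have "open (h -` S)"
      using \<open>open S\<close> by (simp add: continuous_on_open_vimage)
    ultimately show "\<exists>W f T. open_in_orbit W \<and> \<xi> \<in> W \<and> smooth_fun X W (f :: _ \<Rightarrow> complex \<times> complex \<times> real) \<and>
        open T \<and> f \<xi> \<in> T \<and> {\<zeta> \<in> W. f \<zeta> \<in> T} \<subseteq> fiber_form X u v -` S \<inter> orb X"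
      using patch_open \<alpha> \<xi> by (intro exI[of _ ?W] exI[of _ f] exI[of _ "h -` S"]) (auto simp: orb_eq)
  qed simp
  then show "fiber_form X u v -` S \<inter> space (vol X) \<in> sets (vol X)"
    using open_measurable by (simp add: space_vol)
qed

lemma fiber_form_self: "fiber_form X u u \<xi> = complex_of_real (cmod (fiber_form X u u \<xi>))"
proof -
  define \<alpha> where "\<alpha> = patch_at X \<xi>"
  have "u \<alpha> \<xi> * cnj (u \<alpha> \<xi>) = complex_of_real ((cmod (u \<alpha> \<xi>))\<^sup>2)"
    using complex_norm_square[of "u \<alpha> \<xi>"] by simp
  then have "fiber_form X u u \<xi> = complex_of_real ((cmod (u \<alpha> \<xi>))\<^sup>2 * exp (- pot X \<alpha> \<xi> / hbar X))"
    by (simp add: fiber_form_def Let_def \<alpha>_def[symmetric])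
  then show ?thesis by (simp only: norm_of_real) simp
qed

lemma fiber_form_le:
  "cmod (fiber_form X u v \<xi>) \<le> cmod (fiber_form X u u \<xi>) + cmod (fiber_form X v v \<xi>)"
proof -
  have "a * b \<le> a * a + b * b" if "a \<ge> 0" "b \<ge> 0" for a b :: real
    using sum_squares_bound[of a b] mult_nonneg_nonneg[OF that] by (simp add: power2_eq_square)
  then show ?thesis
    by (simp add: fiber_form_def Let_def norm_mult distrib_right[symmetric] mult_right_mono)
qed

lemma Lspace_antiholomorphic: "u \<in> Lspace X \<Longrightarrow> u \<in> antiholomorphic_sections X"
  by (simp add: Lspace_def)

lemma fiber_form_integrable:
  assumes "u \<in> Lspace X" "v \<in> Lspace X"
  shows "integrable (vol X) (fiber_form X u v)"
proof (rule Bochner_Integration.integrable_bound)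
  show "integrable (vol X) (\<lambda>\<xi>. cmod (fiber_form X u u \<xi>) + cmod (fiber_form X v v \<xi>))"
    using assms by (auto simp: Lspace_def)
  show "fiber_form X u v \<in> borel_measurable (vol X)"
    using assms by (intro fiber_form_measurable Lspace_antiholomorphic)
qed (simp add: fiber_form_le)

lemma fiber_form_add: "fiber_form X (section_add u v) w \<xi> = fiber_form X u w \<xi> + fiber_form X v w \<xi>"
  by (simp add: fiber_form_def Let_def algebra_simps)

lemma fiber_form_scale: "fiber_form X (section_scale c u) w \<xi> = c * fiber_form X u w \<xi>"
  by (simp add: fiber_form_def Let_def algebra_simps)

lemma fiber_form_cnj: "fiber_form X u v \<xi> = cnj (fiber_form X v u \<xi>)"
  by (simp add: fiber_form_def Let_def algebra_simps)

lemma Lspace_add: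
  assumes "u \<in> Lspace X" "v \<in> Lspace X"
  shows "section_add u v \<in> Lspace X"
proof -
  let ?w = "section_add u v"
  have "fiber_form X ?w ?w \<xi> = (fiber_form X u u \<xi> + fiber_form X v u \<xi>) + (fiber_form X u v \<xi> + fiber_form X v v \<xi>)" for \<xi>
    by (simp add: fiber_form_def Let_def algebra_simps)
  then have "fiber_form X ?w ?w = (\<lambda>\<xi>. (fiber_form X u u \<xi> + fiber_form X v u \<xi>) + (fiber_form X u v \<xi> + fiber_form X v v \<xi>))"
    by (rule ext)
  then have "integrable (vol X) (fiber_form X ?w ?w)"
    using assms fiber_form_integrable by simp
  then show ?thesis using antiholomorphic_add assms by (simp add: Lspace_def)
qed

lemma Lspace_scale:
  assumes "u \<in> Lspace X"
  shows "section_scale c u \<in> Lspace X"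
proof -
  let ?w = "section_scale c u"
  have "fiber_form X ?w ?w = (\<lambda>\<xi>. (c * cnj c) * fiber_form X u u \<xi>)"
    by (rule ext) (simp add: fiber_form_def Let_def algebra_simps)
  then have "integrable (vol X) (fiber_form X ?w ?w)"
    using assms fiber_form_integrable by simp
  then show ?thesis using antiholomorphic_scale assms by (simp add: Lspace_def)
qed

lemma Lspace_zero: "(\<lambda>\<alpha> \<xi>. 0) \<in> Lspace X"
proof -
  have "fiber_form X (\<lambda>\<alpha> \<xi>. 0) (\<lambda>\<alpha> \<xi>. 0) = (\<lambda>\<xi>. 0)" by (rule ext) (simp add: fiber_form_def Let_def)
  then show ?thesis using antiholomorphic_zero by (simp add: Lspace_def)
qed

sublocale L: semi_inner_space "Lspace X" section_add section_scale "\<lambda>\<alpha> \<xi>. 0" "sprod X"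
proof
  show "(\<lambda>\<alpha> \<xi>. 0) \<in> Lspace X" by (rule Lspace_zero)
  show "section_add u v \<in> Lspace X" if "u \<in> Lspace X" "v \<in> Lspace X" for u v by (rule Lspace_add[OF that])
  show "section_scale c u \<in> Lspace X" if "u \<in> Lspace X" for u c by (rule Lspace_scale[OF that])
  show "sprod X (section_add u v) w = sprod X u w + sprod X v w"
    if "u \<in> Lspace X" "v \<in> Lspace X" "w \<in> Lspace X" for u v w
    using fiber_form_integrable[OF that(1,3)] fiber_form_integrable[OF that(2,3)]
    by (simp add: sprod_def fiber_form_add distrib_left)
  show "sprod X (section_scale c u) v = c * sprod X u v" if "u \<in> Lspace X" "v \<in> Lspace X" for c u v
    using fiber_form_integrable[OF that] by (simp add: sprod_def fiber_form_scale)
  show "sprod X u v = cnj (sprod X v u)" for u v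
    by (simp add: sprod_def integral_cnj[symmetric] fiber_form_cnj[of u v])
  show "0 \<le> Re (sprod X u u)" for u
  proof -
    have "(\<integral>\<xi>. fiber_form X u u \<xi> \<partial>vol X) = complex_of_real (\<integral>\<xi>. cmod (fiber_form X u u \<xi>) \<partial>vol X)"
      by (subst fiber_form_self) (rule integral_complex_of_real)
    then show ?thesis using hbar_pos by (simp add: sprod_def)
  qed
qed

lemma basis_iff: "L.basis B \<longleftrightarrow> orthonormal_basis X B"
  unfolding L.basis_def L.orthonormal_def orthonormal_basis_def by (simp only: conj_assoc)


section \<open>The trace formula\<close>

lemma
  assumes "unitary_operator X T" "u \<in> Lspace X"
  shows unitary_add: "v \<in> Lspace X \<Longrightarrow> T (section_add u v) = section_add (T u) (T v)"
    and unitary_scale: "T (section_scale c u) = section_scale c (T u)"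
    and unitary_sprod: "v \<in> Lspace X \<Longrightarrow> sprod X (T u) (T v) = sprod X u v"
  using assms unfolding unitary_operator_def by blast+

lemma finite_basis_if_trace_defined:
  assumes "orthonormal_basis X B" "unitary_operator X T" "trace_defined X T"
  shows "finite B"
proof -
  interpret unitary_on "Lspace X" section_add section_scale "\<lambda>\<alpha> \<xi>. 0" "sprod X" B T
  proof unfold_locales
    show "L.basis B" using assms(1) basis_iff by blast
    show "bij_betw T (Lspace X) (Lspace X)" using assms(2) unfolding unitary_operator_def by blast
  qed (rule unitary_add[OF assms(2)] unitary_scale[OF assms(2)] unitary_sprod[OF assms(2)]; assumption)+
  show ?thesis
  proof (rule finite_if_diagonals_summable)
    fix C assume "L.basis C"
    then show "(\<lambda>u. sprod X (T u) u) summable_on C"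
      using assms(3) by (auto simp: basis_iff trace_defined_def has_trace_def summable_on_def)
  qed
qed

lemma op_trace_finite:
  assumes "orthonormal_basis X B" "finite B" "trace_defined X T"
  shows "op_trace X T = (\<Sum>u\<in>B. sprod X (T u) u)"
proof -
  have eq: "t = (\<Sum>u\<in>B. sprod X (T u) u)" if "has_trace X T t" for t
    using that assms(1) has_sum_finite[OF assms(2)] has_sum_unique unfolding has_trace_def by blast
  obtain t where "has_trace X T t" using assms(3) by (auto simp: trace_defined_def)
  then show ?thesis unfolding op_trace_def using eq by (metis (no_types, lifting) the_equality)
qed

text \<open>Membership of the partial sums in the space is part of the induction, since \<open>T\<close> is additive only
  there.\<close>

lemma unitary_sum:
  assumes "unitary_operator X T" "finite U" "U \<subseteq> Lspace X"
  shows "(\<lambda>\<alpha> \<xi>. \<Sum>u\<in>U. c u * u \<alpha> \<xi>) \<in> Lspace X \<and>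
    T (\<lambda>\<alpha> \<xi>. \<Sum>u\<in>U. c u * u \<alpha> \<xi>) = (\<lambda>\<alpha> \<xi>. \<Sum>u\<in>U. c u * T u \<alpha> \<xi>)"
  using assms(2,3)
proof (induction U)
  case empty
  show ?case using Lspace_zero unitary_scale[OF assms(1) Lspace_zero, of 0] by simp
next
  case (insert u U)
  let ?s = "\<lambda>\<alpha> \<xi>. \<Sum>u\<in>U. c u * u \<alpha> \<xi>"
  have s: "?s \<in> Lspace X" "T ?s = (\<lambda>\<alpha> \<xi>. \<Sum>u\<in>U. c u * T u \<alpha> \<xi>)" using insert by auto
  have u: "u \<in> Lspace X" "section_scale (c u) u \<in> Lspace X" using insert Lspace_scale by auto
  have "T (section_add (section_scale (c u) u) ?s) = section_add (section_scale (c u) (T u)) (T ?s)"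
    using unitary_add[OF assms(1) u(2) s(1)] unitary_scale[OF assms(1) u(1)] by simp
  then show ?case using insert.hyps s Lspace_add[OF u(2) s(1)] by simp
qed

text \<open>The normalization of the kernel: the squared lengths of the basis vectors add up to the constant 1.
  Integrated over the orbit, this gives the orbit finite volume as soon as the basis is finite.\<close>

lemma sum_fiber_form:
  assumes "kernel_normalized X B" "finite B" "\<xi> \<in> orb X"
  shows "(\<Sum>u\<in>B. fiber_form X u u \<xi>) = 1"
    and "repro_kernel B (patch_at X \<xi>) \<xi> (patch_at X \<xi>) \<xi> =
      complex_of_real (exp (pot X (patch_at X \<xi>) \<xi> / hbar X))"
proof -
  let ?\<alpha> = "patch_at X \<xi>"
  have "((\<lambda>u. (cmod (u ?\<alpha> \<xi>))\<^sup>2) has_sum exp (pot X ?\<alpha> \<xi> / hbar X)) B"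
    using assms(1) patch_at[OF assms(3)] by (simp add: kernel_normalized_def)
  then have "(\<Sum>u\<in>B. (cmod (u ?\<alpha> \<xi>))\<^sup>2) = exp (pot X ?\<alpha> \<xi> / hbar X)"
    using has_sum_finite[OF assms(2)] has_sum_unique by blast
  then have *: "(\<Sum>u\<in>B. u ?\<alpha> \<xi> * cnj (u ?\<alpha> \<xi>)) = complex_of_real (exp (pot X ?\<alpha> \<xi> / hbar X))"
    by (simp only: complex_norm_square[symmetric] of_real_sum[symmetric])
  then show "repro_kernel B ?\<alpha> \<xi> ?\<alpha> \<xi> = complex_of_real (exp (pot X ?\<alpha> \<xi> / hbar X))"
    using assms(2) by (simp add: repro_kernel_def)
  have "(\<Sum>u\<in>B. fiber_form X u u \<xi>) = complex_of_real (exp (pot X ?\<alpha> \<xi> / hbar X) * exp (- pot X ?\<alpha> \<xi> / hbar X))"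
    using * by (simp add: fiber_form_def Let_def sum_distrib_right[symmetric])
  then show "(\<Sum>u\<in>B. fiber_form X u u \<xi>) = 1" by (simp add: exp_minus)
qed

text \<open>The symbol is the diagonal of the kernel of \<open>T\<close>: for a finite basis \<open>T\<close> may be applied term by
  term to \<open>\<Sum>\<^sub>u u cnj (u \<xi>)\<close>, and division by \<open>exp (F\<^sub>0 / \<hbar>)\<close> turns products into Hermitian products.\<close>

lemma wick_symbol_finite:
  assumes "kernel_normalized X B" "finite B" "B \<subseteq> Lspace X" "unitary_operator X T" "\<xi> \<in> orb X"
  shows "wick_symbol X B T \<xi> = (\<Sum>u\<in>B. fiber_form X (T u) u \<xi>)"
proof -
  let ?\<alpha> = "patch_at X \<xi>"
  have "repro_kernel B ?\<alpha> \<xi> = (\<lambda>\<beta> \<zeta>. \<Sum>u\<in>B. cnj (u ?\<alpha> \<xi>) * u \<beta> \<zeta>)"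
    using assms(2) by (simp add: repro_kernel_def mult.commute)
  then have "T (repro_kernel B ?\<alpha> \<xi>) = (\<lambda>\<beta> \<zeta>. \<Sum>u\<in>B. cnj (u ?\<alpha> \<xi>) * T u \<beta> \<zeta>)"
    using unitary_sum[OF assms(4,2,3), of "\<lambda>u. cnj (u ?\<alpha> \<xi>)"] by simp
  then show ?thesis
    by (simp add: wick_symbol_def Let_def sum_fiber_form(2)[OF assms(1,2,5)] fiber_form_def
        exp_minus field_simps sum_divide_distrib)
qed

lemma trace_formula:
  assumes B: "orthonormal_basis X B" "kernel_normalized X B"
    and T: "unitary_operator X T" "trace_defined X T"
  shows "integrable (vol X) (wick_symbol X B T)"
    and "op_trace X T = complex_of_real (1 / (2 * pi * hbar X) ^ cdim X) * (\<integral>\<xi>. wick_symbol X B T \<xi> \<partial>vol X)"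
    and "integrable (vol X) (\<lambda>\<xi>. 1 :: complex)"
proof -
  have fin: "finite B" by (rule finite_basis_if_trace_defined[OF B(1) T])
  have BL: "B \<subseteq> Lspace X" using B(1) by (simp add: orthonormal_basis_def)
  have TL: "T u \<in> Lspace X" if "u \<in> Lspace X" for u
    using T(1) that by (auto simp: unitary_operator_def bij_betw_def)
  have int: "integrable (vol X) (fiber_form X (T u) u)" "integrable (vol X) (fiber_form X u u)" if "u \<in> B" for u
    using fiber_form_integrable TL BL that by auto
  have symb: "wick_symbol X B T \<xi> = (\<Sum>u\<in>B. fiber_form X (T u) u \<xi>)" if "\<xi> \<in> space (vol X)" for \<xi>
    using wick_symbol_finite[OF B(2) fin BL T(1)] that by (simp add: space_vol)
  have "integrable (vol X) (\<lambda>\<xi>. \<Sum>u\<in>B. fiber_form X (T u) u \<xi>)"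
    using int by (intro Bochner_Integration.integrable_sum)
  moreover have "integrable (vol X) (wick_symbol X B T) \<longleftrightarrow>
      integrable (vol X) (\<lambda>\<xi>. \<Sum>u\<in>B. fiber_form X (T u) u \<xi>)"
    by (rule Bochner_Integration.integrable_cong[OF refl symb])
  ultimately show "integrable (vol X) (wick_symbol X B T)" by simp
  have "(\<integral>\<xi>. wick_symbol X B T \<xi> \<partial>vol X) = (\<integral>\<xi>. (\<Sum>u\<in>B. fiber_form X (T u) u \<xi>) \<partial>vol X)"
    by (rule Bochner_Integration.integral_cong[OF refl symb])
  also have "\<dots> = (\<Sum>u\<in>B. \<integral>\<xi>. fiber_form X (T u) u \<xi> \<partial>vol X)"
    using int by (intro Bochner_Integration.integral_sum)
  finally have "(\<integral>\<xi>. wick_symbol X B T \<xi> \<partial>vol X) = (\<Sum>u\<in>B. \<integral>\<xi>. fiber_form X (T u) u \<xi> \<partial>vol X)" .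
  then show "op_trace X T = complex_of_real (1 / (2 * pi * hbar X) ^ cdim X) * (\<integral>\<xi>. wick_symbol X B T \<xi> \<partial>vol X)"
    by (simp add: op_trace_finite[OF B(1) fin T(2)] sprod_def sum_distrib_left)
  have "integrable (vol X) (\<lambda>\<xi>. \<Sum>u\<in>B. fiber_form X u u \<xi>)"
    using int by (intro Bochner_Integration.integrable_sum)
  moreover have "integrable (vol X) (\<lambda>\<xi>. \<Sum>u\<in>B. fiber_form X u u \<xi>) \<longleftrightarrow> integrable (vol X) (\<lambda>\<xi>. 1 :: complex)"
    by (rule Bochner_Integration.integrable_cong[OF refl sum_fiber_form(1)[OF B(2) fin]]) (simp add: space_vol)
  ultimately show "integrable (vol X) (\<lambda>\<xi>. 1 :: complex)" by simp
qed

text \<open>The Fourier transform of the orbit is a superposition of exponentials with the finite measure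
  \<open>dm\<close>, so the operator acts under the integral sign, and there it multiplies each exponential by its
  symbol.\<close>

lemma ordered_operator_integral:
  assumes "ordered_operator X (restriction_symbol X B \<pi>) Op" "integrable (vol X) (\<lambda>\<xi>. 1 :: complex)"
  shows "Op (\<lambda>\<eta>. \<integral>\<xi>. pure_exp (hbar X) \<xi> \<eta> \<partial>vol X) \<eta> = (\<integral>\<xi>. star_exp X B \<pi> \<eta> \<xi> \<partial>vol X)"
proof -
  have "Op (\<lambda>\<eta>. \<integral>\<xi>. 1 * pure_exp (hbar X) \<xi> \<eta> \<partial>vol X) =
      (\<lambda>\<eta>. \<integral>\<xi>. 1 * Op (pure_exp (hbar X) \<xi>) \<eta> \<partial>vol X)"
    using assms unfolding ordered_operator_def by blast
  then have "Op (\<lambda>\<eta>. \<integral>\<xi>. pure_exp (hbar X) \<xi> \<eta> \<partial>vol X) \<eta> = (\<integral>\<xi>. Op (pure_exp (hbar X) \<xi>) \<eta> \<partial>vol X)"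
    by simp
  also have "\<dots> = (\<integral>\<xi>. star_exp X B \<pi> \<eta> \<xi> \<partial>vol X)"
  proof (rule Bochner_Integration.integral_cong[OF refl])
    fix \<xi> assume "\<xi> \<in> space (vol X)"
    then have "Op (pure_exp (hbar X) \<xi>) \<eta> = restriction_symbol X B \<pi> \<xi> \<eta> * pure_exp (hbar X) \<xi> \<eta>"
      using assms(1) by (simp add: ordered_operator_def space_vol)
    then show "Op (pure_exp (hbar X) \<xi>) \<eta> = star_exp X B \<pi> \<eta> \<xi>"
      by (simp add: restriction_symbol_def pure_exp_def exp_minus field_simps)
  qed
  finally show ?thesis .
qed

end

theorem mainTheorem17:
  fixes X :: "('g::{t2_space,second_countable_topology}, 'e::real_normed_vector, 'i) orbit_data"
    and m :: nat and b :: "nat \<Rightarrow> 'e"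
    and B :: "('e, 'i) sect set"
    and \<pi> :: "'g \<Rightarrow> ('e, 'i) oper"
    and Op :: "('e \<Rightarrow> complex) \<Rightarrow> ('e \<Rightarrow> complex)"
    and \<eta> :: 'e
  assumes "hbar X > 0"
    and "lie_group (lie X)"
    and "maximal_orbit (lie X) (base_pt X)"
    and "complex_structure X"
    and "invariant_complex_structure X"
    and "kaehler_potentials X"
    and "integral_class X"
    and "hermitian_line_bundle X"
    and "liouville_measure X"
    and "orthonormal_basis X B"
    and "kernel_normalized X B"
    and "inj_on b {..<m}" "independent (b ` {..<m})" "span (b ` {..<m}) = UNIV"
    and "irreducible_unitary_rep X \<pi>"
    and "quantizes X m b \<pi>"
    and "ordered_operator X (restriction_symbol X B \<pi>) Op"
    and "trace_defined X (\<pi> (lie_exp (lie X) \<eta>))"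
  shows "integrable (vol X) (star_exp X B \<pi> \<eta>) \<and>
         op_trace X (\<pi> (lie_exp (lie X) \<eta>)) =
           1 / (2 * pi * hbar X) ^ cdim X * (\<integral>\<xi>. star_exp X B \<pi> \<eta> \<xi> \<partial>vol X) \<and>
         op_trace X (\<pi> (lie_exp (lie X) \<eta>)) =
           1 / (2 * pi * hbar X) ^ cdim X *
             Op (\<lambda>\<eta>. \<integral>\<xi>. pure_exp (hbar X) \<xi> \<eta> \<partial>vol X) \<eta>"
proof -
  interpret quantized_orbit X
    by (intro quantized_orbit.intro orbit_geometry.intro lie_grp.intro quantized_orbit_axioms.intro assms)
  have U: "unitary_operator X (\<pi> (lie_exp (lie X) \<eta>))"
    using assms(15) unfolding irreducible_unitary_rep_def by (rule conjunct1[THEN spec])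
  note trace = trace_formula[OF assms(10,11) U assms(18), folded star_exp_def]
  have "Op (\<lambda>\<eta>. \<integral>\<xi>. pure_exp (hbar X) \<xi> \<eta> \<partial>vol X) \<eta> = (\<integral>\<xi>. star_exp X B \<pi> \<eta> \<xi> \<partial>vol X)"
    by (rule ordered_operator_integral[OF assms(17) trace(3)])
  then show ?thesis using trace(1,2) by (simp only: simp_thms)
qed

end
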